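(* For each $\Delta^0_2$ random Turing degree $\mathbf{r}$ there exist a countably supported computable probability measure $\mu$ on $2^\omega$ and a sequence $R\in\mathbf{r}$ such that (i) $R$ is Martin-Löf random with respect to $\mu$, (ii) $R$ has Cantor-Bendixson rank $\omega$, and (iii) the support of $\mu$ is rank-faithful.
   Context: A Turing degree is a $\Delta^0_2$ random degree if it is $\Delta^0_2$ and contains a Martin-Löf random sequence (random with respect to the Lebesgue measure). A measure $\mu$ on $2^\omega$ is computable if $\sigma\mapsto\mu(\llbracket\sigma\rrbracket)$ is computable as a real-valued function; it is countably supported if there is a countable set $\{X_i\colon i\in\omega\}$ with $\mu(\{X_i\colon i\in\omega\})=1$. For computable $\mu$, a $\mu$-Martin-Löf test is a uniformly $\Sigma^0_1$ sequence of open sets $(\mathcal U_i)$ with $\mu(\mathcal U_i)\le 2^{-i}$; $X$ is random with respect to $\mu$ if $X\notin\bigcap_i\mathcal U_i$ for every such test. The support of $\mu$ is $\{X\colon \forall n\ \mu(\llbracket X\upharpoonright n\rrbracket)>0\}$. For a closed set $\mathcal P$, $D(\mathcal P)$ is the set of non-isolated points of $\mathcal P$, iterated transfinitely ($D^0=\mathcal P$, $D^{\beta+1}=D(D^\beta)$, intersections at limits). For a $\Pi^0_1$ class $\mathcal P$ and $X\in\mathcal P$, $\mathit{rk}_{\mathcal P}(X)$ is the least $\beta$ with $X\in D^\beta(\mathcal P)\setminus D^{\beta+1}(\mathcal P)$. $X$ is ranked if $\mathit{rk}_{\mathcal P}(X)$ is defined for some $\Pi^0_1$ class $\mathcal P$,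 and its Cantor-Bendixson rank $\mathit{rk}(X)$ is the least such value over all $\Pi^0_1$ classes. A $\Pi^0_1$ class $\mathcal P$ is rank-faithful if $\mathit{rk}(X)=\mathit{rk}_{\mathcal P}(X)$ for all ranked $X\in\mathcal P$. *)

theory Defs
  imports "HOL-Probability.Probability" "HOL-Library.Countable_Set_Type"
begin

section \<open>Recursive functions relative to an oracle\<close>

datatype recf =
    Zero
  | Succ
  | Proj nat
  | Oracle
  | Comp recf "recf list"
  | Prim recf recf
  | Mu recf

text \<open>
  \<^term>\<open>eval A e xs y\<close> means that the program \<^term>\<open>e\<close> with oracle \<^term>\<open>A\<close> halts on the
  argument tuple \<^term>\<open>xs\<close> with output \<^term>\<open>y\<close>; evaluation is partial.
\<close>

inductive eval :: "(nat \<Rightarrow> nat) \<Rightarrow> recf \<Rightarrow> nat list \<Rightarrow> nat \<Rightarrow> bool" for A :: "nat \<Rightarrow> nat" where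
  eval_Zero: "eval A Zero xs 0"
| eval_Succ: "eval A Succ [x] (Suc x)"
| eval_Proj: "i < length xs \<Longrightarrow> eval A (Proj i) xs (xs ! i)"
| eval_Oracle: "eval A Oracle [x] (A x)"
| eval_Comp: "length ys = length gs \<Longrightarrow> (\<forall>i < length gs. eval A (gs ! i) xs (ys ! i)) \<Longrightarrow>
    eval A f ys z \<Longrightarrow> eval A (Comp f gs) xs z"
| eval_Prim_0: "eval A f xs z \<Longrightarrow> eval A (Prim f g) (0 # xs) z"
| eval_Prim_Suc: "eval A (Prim f g) (n # xs) y \<Longrightarrow> eval A g (n # y # xs) z \<Longrightarrow>
    eval A (Prim f g) (Suc n # xs) z"
| eval_Mu: "eval A f (n # xs) 0 \<Longrightarrow> (\<forall>m < n. \<exists>k. eval A f (m # xs) (Suc k)) \<Longrightarrow>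
    eval A (Mu f) xs n"

text \<open>Oracle-free computation is computation with the constant zero oracle.\<close>

abbreviation eval0 :: "recf \<Rightarrow> nat list \<Rightarrow> nat \<Rightarrow> bool" where
  "eval0 \<equiv> eval (\<lambda>_. 0)"

definition computable :: "nat \<Rightarrow> (nat list \<Rightarrow> nat) \<Rightarrow> bool" where
  "computable k f \<longleftrightarrow> (\<exists>e. \<forall>xs. length xs = k \<longrightarrow> eval0 e xs (f xs))"

definition computable_rel :: "nat \<Rightarrow> (nat list \<Rightarrow> bool) \<Rightarrow> bool" where
  "computable_rel k P \<longleftrightarrow> computable k (\<lambda>xs. of_bool (P xs))"

text \<open>A relation is computably enumerable if it is the domain of a partial recursive function.\<close>

definition ce_rel :: "nat \<Rightarrow> (nat list \<Rightarrow> bool) \<Rightarrow> bool" where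
  "ce_rel k P \<longleftrightarrow> (\<exists>e. \<forall>xs. length xs = k \<longrightarrow> (P xs \<longleftrightarrow> (\<exists>y. eval0 e xs y)))"

section \<open>Turing degrees and the class Delta-0-2\<close>

type_synonym cantor = "nat \<Rightarrow> bool"

definition turing_reducible :: "cantor \<Rightarrow> cantor \<Rightarrow> bool" where
  "turing_reducible X Y \<longleftrightarrow>
    (\<exists>e. \<forall>n. eval (\<lambda>k. of_bool (Y k)) e [n] (of_bool (X n)))"

definition turing_equiv :: "(cantor \<times> cantor) set" where
  "turing_equiv = {(X, Y). turing_reducible X Y \<and> turing_reducible Y X}"

definition turing_degrees :: "cantor set set" where
  "turing_degrees = UNIV // turing_equiv"

definition sigma02 :: "cantor \<Rightarrow> bool" where
  "sigma02 X \<longleftrightarrow> (\<exists>P. computable_rel 3 P \<and> (\<forall>n. X n \<longleftrightarrow> (\<exists>a. \<forall>b. P [n, a, b])))"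

definition pi02 :: "cantor \<Rightarrow> bool" where
  "pi02 X \<longleftrightarrow> (\<exists>P. computable_rel 3 P \<and> (\<forall>n. X n \<longleftrightarrow> (\<forall>a. \<exists>b. P [n, a, b])))"

definition delta02 :: "cantor \<Rightarrow> bool" where
  "delta02 X \<longleftrightarrow> sigma02 X \<and> pi02 X"

section \<open>Effectively open and closed subsets of Cantor space\<close>

definition prefix_of :: "cantor \<Rightarrow> nat \<Rightarrow> bool list" where
  "prefix_of X n = map X [0..<n]"

definition cylinder :: "bool list \<Rightarrow> cantor set" where
  "cylinder s = {X. prefix_of X (length s) = s}"

text \<open>Bijective base-2 numeration, a bijection between finite binary strings and numbers.\<close>

fun code :: "bool list \<Rightarrow> nat" where
  "code [] = 0"
| "code (b # s) = 2 * code s + (if b then 2 else 1)"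

definition pi01_class :: "cantor set \<Rightarrow> bool" where
  "pi01_class P \<longleftrightarrow> (\<exists>W. ce_rel 1 W \<and> P = - (\<Union>s \<in> {s. W [code s]}. cylinder s))"

definition uniformly_sigma01 :: "(nat \<Rightarrow> cantor set) \<Rightarrow> bool" where
  "uniformly_sigma01 U \<longleftrightarrow>
    (\<exists>W. ce_rel 2 W \<and> (\<forall>i. U i = (\<Union>s \<in> {s. W [i, code s]}. cylinder s)))"

section \<open>Computable measures and randomness\<close>

definition cantor_prob :: "cantor measure \<Rightarrow> bool" where
  "cantor_prob \<mu> \<longleftrightarrow> prob_space \<mu> \<and> sets \<mu> = sets borel"

definition cantor_lebesgue :: "cantor measure" where
  "cantor_lebesgue = (\<Pi>\<^sub>M n \<in> UNIV. measure_pmf (bernoulli_pmf (1/2)))"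

instance bool :: second_countable_topology
proof
  show "\<exists>B :: bool set set. countable B \<and> open = generate_topology B"
    by (intro exI[of _ "range (\<lambda>a. {..< a}) \<union> range (\<lambda>a. {a <..})"])
      (simp add: open_bool_def)
qed

lemma cantor_prob_lebesgue: "cantor_prob cantor_lebesgue"
proof -
  interpret product_prob_space "\<lambda>_::nat. measure_pmf (bernoulli_pmf (1/2))" UNIV
    by unfold_locales
  have "sets cantor_lebesgue = sets (\<Pi>\<^sub>M n \<in> (UNIV :: nat set). (borel :: bool measure))"
    unfolding cantor_lebesgue_def by (intro sets_PiM_cong) (simp_all add: sets_borel_eq_count_space)
  also have "\<dots> = sets borel" by (rule sets_PiM_equal_borel)
  finally have "sets cantor_lebesgue = sets borel" .
  moreover have "prob_space cantor_lebesgue"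
    unfolding cantor_lebesgue_def by (rule prob_space_axioms)
  ultimately show ?thesis unfolding cantor_prob_def by blast
qed

text \<open>
  A function from strings to reals is computable if rational approximations of any prescribed
  precision are computable; \<^term>\<open>(p - q) / (r + 1)\<close> with natural \<^term>\<open>p\<close>, \<^term>\<open>q\<close>,
  \<^term>\<open>r\<close> runs through all rationals.
\<close>

definition computable_real_fun :: "(bool list \<Rightarrow> real) \<Rightarrow> bool" where
  "computable_real_fun F \<longleftrightarrow>
    (\<exists>p q r. computable 2 p \<and> computable 2 q \<and> computable 2 r \<and>
      (\<forall>s n. \<bar>F s - (real (p [code s, n]) - real (q [code s, n])) / (real (r [code s, n]) + 1)\<bar>
              \<le> (1/2) ^ n))"

definition computable_measure :: "cantor measure \<Rightarrow> bool" where
  "computable_measure \<mu> \<longleftrightarrow> computable_real_fun (\<lambda>s. measure \<mu> (cylinder s))"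

definition countably_supported :: "cantor measure \<Rightarrow> bool" where
  "countably_supported \<mu> \<longleftrightarrow> (\<exists>X :: nat \<Rightarrow> cantor. measure \<mu> (range X) = 1)"

definition support :: "cantor measure \<Rightarrow> cantor set" where
  "support \<mu> = {X. \<forall>n. measure \<mu> (cylinder (prefix_of X n)) > 0}"

definition ml_test :: "cantor measure \<Rightarrow> (nat \<Rightarrow> cantor set) \<Rightarrow> bool" where
  "ml_test \<mu> U \<longleftrightarrow> uniformly_sigma01 U \<and> (\<forall>i. measure \<mu> (U i) \<le> (1/2) ^ i)"

definition ml_random :: "cantor measure \<Rightarrow> cantor \<Rightarrow> bool" where
  "ml_random \<mu> X \<longleftrightarrow> (\<forall>U. ml_test \<mu> U \<longrightarrow> X \<notin> (\<Inter>i. U i))"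

definition delta02_random_degree :: "cantor set \<Rightarrow> bool" where
  "delta02_random_degree r \<longleftrightarrow>
    r \<in> turing_degrees \<and> (\<exists>X \<in> r. delta02 X) \<and> (\<exists>X \<in> r. ml_random cantor_lebesgue X)"

section \<open>Countable ordinals\<close>

text \<open>
  The elements of the first uncountable cardinal, in its well-order, are the countable ordinals.
  They suffice for Cantor-Bendixson ranks: a strictly decreasing transfinite sequence of closed
  subsets of a second countable space has countable length.
\<close>

typedef cord = "Field (cardSuc natLeq)"
  using Field_cardSuc_not_empty[OF natLeq_Card_order] by blast

lemma cardSuc_natLeq_Well_order: "Well_order (cardSuc natLeq)"
  by (rule cardSuc_Well_order[OF natLeq_Card_order])

instantiation cord :: wellorder
begin

definition less_eq_cord :: "cord \<Rightarrow> cord \<Rightarrow> bool" where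
  "a \<le> b \<longleftrightarrow> (Rep_cord a, Rep_cord b) \<in> cardSuc natLeq"

definition less_cord :: "cord \<Rightarrow> cord \<Rightarrow> bool" where
  "a < b \<longleftrightarrow> (Rep_cord a, Rep_cord b) \<in> cardSuc natLeq - Id"

instance
proof
  let ?r = "cardSuc natLeq"
  note W = cardSuc_natLeq_Well_order
  have rf: "refl_on (Field ?r) ?r" and tr: "trans ?r" and an: "antisym ?r"
    and tot: "total_on (Field ?r) ?r" and wf: "wf (?r - Id)"
    using W by (simp_all add: well_order_on_def linear_order_on_def partial_order_on_def
        preorder_on_def)
  fix a b c :: cord
  show refl: "a \<le> a"
    unfolding less_eq_cord_def by (rule refl_onD[OF rf Rep_cord])
  show antisym: "a \<le> b \<Longrightarrow> b \<le> a \<Longrightarrow> a = b"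
    unfolding less_eq_cord_def using antisymD[OF an] by (simp add: Rep_cord_inject[symmetric])
  show "a \<le> b \<Longrightarrow> b \<le> c \<Longrightarrow> a \<le> c"
    unfolding less_eq_cord_def by (rule transD[OF tr])
  have "a < b \<longleftrightarrow> a \<le> b \<and> a \<noteq> b"
    by (simp add: less_cord_def less_eq_cord_def Rep_cord_inject)
  then show "(a < b) = (a \<le> b \<and> \<not> b \<le> a)"
    using refl antisym by blast
  show "a \<le> b \<or> b \<le> a"
    using tot Rep_cord[of a] Rep_cord[of b] refl
    unfolding less_eq_cord_def total_on_def by (metis Rep_cord_inject)
  fix P :: "cord \<Rightarrow> bool"
  assume step: "\<And>x. (\<And>y. y < x \<Longrightarrow> P y) \<Longrightarrow> P x"
  have "wf (inv_image (?r - Id) Rep_cord)" by (rule wf_inv_image[OF wf])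
  moreover have "inv_image (?r - Id) Rep_cord = {(x, y). x < y}"
    by (auto simp: inv_image_def less_cord_def)
  ultimately have "wf {(x, y :: cord). x < y}" by simp
  then show "P a"
  proof (induction a rule: wf_induct_rule)
    case (less x)
    show ?case by (rule step) (use less in simp)
  qed
qed

end

lemma uncountable_Field_cardSuc_natLeq:
  includes cardinal_syntax
  shows "uncountable (Field (cardSuc natLeq))"
proof
  assume "countable (Field (cardSuc natLeq))"
  then have "|Field (cardSuc natLeq)| \<le>o natLeq"
    by (simp add: countable_card_le_natLeq)
  moreover have "cardSuc natLeq =o |Field (cardSuc natLeq)|"
    by (rule ordIso_symmetric[OF card_of_Field_ordIso[OF cardSuc_Card_order[OF natLeq_Card_order]]])
  ultimately have "cardSuc natLeq \<le>o natLeq" by (rule ordIso_ordLeq_trans[rotated])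
  then show False using not_ordLess_ordLeq[OF cardSuc_greater[OF natLeq_Card_order]] by blast
qed

lemma uncountable_cord: "uncountable (UNIV :: cord set)"
proof
  assume "countable (UNIV :: cord set)"
  then have "countable (range Rep_cord)" by (rule countable_image)
  then show False
    using uncountable_Field_cardSuc_natLeq
    by (simp add: type_definition.Rep_range[OF type_definition_cord])
qed

lemma countable_below_cord:
  includes cardinal_syntax
  shows "countable {..< \<beta> :: cord}"
proof -
  let ?r = "cardSuc natLeq"
  let ?S = "underS ?r (Rep_cord \<beta>)"
  have C: "Card_order ?r" by (rule cardSuc_Card_order[OF natLeq_Card_order])
  have less: "|?S| <o ?r" by (rule card_of_underS[OF C Rep_cord])
  have "\<not> natLeq <o |?S|"
  proof
    assume "natLeq <o |?S|"
    then have "?r \<le>o |?S|" by (rule cardSuc_least[OF natLeq_Card_order card_of_Card_order])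
    then show False using less not_ordLess_ordLeq by blast
  qed
  then have "|?S| \<le>o natLeq"
    by (rule iffD1[OF not_ordLess_iff_ordLeq[OF card_of_Well_order natLeq_Well_order]])
  then have "countable ?S" by (simp add: countable_card_le_natLeq)
  moreover have "Rep_cord ` {..< \<beta>} \<subseteq> ?S"
    by (auto simp: less_cord_def underS_def)
  ultimately have "countable (Rep_cord ` {..< \<beta>})" by (rule countable_subset[rotated])
  then show ?thesis
    by (rule countable_image_inj_on) (simp add: inj_on_def Rep_cord_inject)
qed

instance cord :: no_top
proof
  fix a :: cord
  have "UNIV \<noteq> insert a {..< a}"
    using uncountable_cord countable_insert[OF countable_below_cord] by metis
  then obtain b where "b \<noteq> a" "\<not> b < a" by auto
  then show "\<exists>b. a < b" by (auto simp: not_less_iff_gr_or_eq)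
qed

instantiation cord :: zero
begin
definition zero_cord :: cord where "0 = (LEAST \<beta> :: cord. True)"
instance ..
end

definition osucc :: "cord \<Rightarrow> cord" where
  "osucc \<beta> = (LEAST \<gamma>. \<beta> < \<gamma>)"

definition is_osucc :: "cord \<Rightarrow> bool" where
  "is_osucc \<beta> \<longleftrightarrow> (\<exists>\<gamma>. \<beta> = osucc \<gamma>)"

definition opred :: "cord \<Rightarrow> cord" where
  "opred \<beta> = (THE \<gamma>. \<beta> = osucc \<gamma>)"

definition omega :: cord where
  "omega = (LEAST \<beta>. \<beta> \<noteq> 0 \<and> \<not> is_osucc \<beta>)"

lemma zero_le_cord: "0 \<le> (\<beta> :: cord)"
  unfolding zero_cord_def by (rule Least_le) simp

lemma less_osucc: "\<beta> < osucc \<beta>"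
  unfolding osucc_def by (rule LeastI_ex) (rule gt_ex)

lemma osucc_le: "\<beta> < \<gamma> \<Longrightarrow> osucc \<beta> \<le> \<gamma>"
  unfolding osucc_def by (rule Least_le)

lemma osucc_inject: "osucc \<beta> = osucc \<gamma> \<longleftrightarrow> \<beta> = \<gamma>"
proof
  assume eq: "osucc \<beta> = osucc \<gamma>"
  have "\<not> \<beta> < \<gamma>" using eq osucc_le[of \<beta> \<gamma>] less_osucc[of \<gamma>] by auto
  moreover have "\<not> \<gamma> < \<beta>" using eq osucc_le[of \<gamma> \<beta>] less_osucc[of \<beta>] by auto
  ultimately show "\<beta> = \<gamma>" by auto
qed simp

lemma opred_osucc [simp]: "opred (osucc \<beta>) = \<beta>"
  unfolding opred_def by (auto simp: osucc_inject)

lemma opred_less: "is_osucc \<beta> \<Longrightarrow> opred \<beta> < \<beta>"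
  by (auto simp: is_osucc_def less_osucc)

lemma osucc_neq_0: "osucc \<beta> \<noteq> 0"
  using less_osucc[of \<beta>] zero_le_cord[of \<beta>] by (auto simp: not_less[symmetric])

lemma ex_limit_cord: "\<exists>\<beta>. \<beta> \<noteq> 0 \<and> \<not> is_osucc \<beta>"
proof (rule ccontr)
  assume no: "\<not> ?thesis"
  have "\<beta> \<in> range (\<lambda>n :: nat. (osucc ^^ n) 0)" for \<beta>
  proof (induction \<beta> rule: less_induct)
    case (less \<beta>)
    show ?case
    proof (cases "\<beta> = 0")
      case True
      then show ?thesis by (auto intro: range_eqI[of _ _ 0])
    next
      case False
      then obtain \<gamma> where g: "\<beta> = osucc \<gamma>" using no is_osucc_def by blast
      then obtain n where "\<gamma> = (osucc ^^ n) 0" using less[of \<gamma>] less_osucc by auto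
      then show ?thesis using g by (auto intro: range_eqI[of _ _ "Suc n"])
    qed
  qed
  then have "(UNIV :: cord set) \<subseteq> range (\<lambda>n :: nat. (osucc ^^ n) 0)" by blast
  then have "countable (UNIV :: cord set)" by (rule countable_subset) simp
  then show False using uncountable_cord by blast
qed

lemma omega_limit: "omega \<noteq> 0" "\<not> is_osucc omega"
  using LeastI_ex[OF ex_limit_cord] unfolding omega_def by auto

section \<open>Cantor-Bendixson rank\<close>

definition cb_derivative :: "cantor set \<Rightarrow> cantor set" where
  "cb_derivative P = {X \<in> P. \<not> X isolated_in P}"

function cb_iter :: "cantor set \<Rightarrow> cord \<Rightarrow> cantor set" where
  "cb_iter P \<beta> =
    (if \<beta> = 0 then P
     else if is_osucc \<beta> then cb_derivative (cb_iter P (opred \<beta>))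
     else (\<Inter>\<gamma> \<in> {..< \<beta>}. cb_iter P \<gamma>))"
  by pat_completeness auto
termination
  by (relation "inv_image {(x, y). x < y} snd") (auto simp: wf opred_less)

declare cb_iter.simps [simp del]

lemma cb_iter_0: "cb_iter P 0 = P"
  by (subst cb_iter.simps) simp

lemma cb_iter_osucc: "cb_iter P (osucc \<beta>) = cb_derivative (cb_iter P \<beta>)"
  by (subst cb_iter.simps) (auto simp: osucc_neq_0 is_osucc_def)

lemma cb_iter_limit: "\<beta> \<noteq> 0 \<Longrightarrow> \<not> is_osucc \<beta> \<Longrightarrow> cb_iter P \<beta> = (\<Inter>\<gamma> \<in> {..< \<beta>}. cb_iter P \<gamma>)"
  by (subst cb_iter.simps) simp

text \<open>Ranks are of type \<^typ>\<open>cord option\<close>, with \<^term>\<open>None\<close> for an undefined rank.\<close>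

definition rank_in :: "cantor set \<Rightarrow> cantor \<Rightarrow> cord option" where
  "rank_in P X =
    (if \<exists>\<beta>. X \<in> cb_iter P \<beta> - cb_iter P (osucc \<beta>)
     then Some (LEAST \<beta>. X \<in> cb_iter P \<beta> - cb_iter P (osucc \<beta>)) else None)"

definition ranked :: "cantor \<Rightarrow> bool" where
  "ranked X \<longleftrightarrow> (\<exists>P. pi01_class P \<and> X \<in> P \<and> rank_in P X \<noteq> None)"

definition cb_rank :: "cantor \<Rightarrow> cord option" where
  "cb_rank X =
    (if ranked X
     then Some (LEAST \<beta>. \<exists>P. pi01_class P \<and> X \<in> P \<and> rank_in P X = Some \<beta>) else None)"

definition rank_faithful :: "cantor set \<Rightarrow> bool" where
  "rank_faithful P \<longleftrightarrow> pi01_class P \<and> (\<forall>X \<in> P. ranked X \<longrightarrow> cb_rank X = rank_in P X)"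

end

theory Submission
  imports Defs
begin

text \<open>
  Let \<open>X\<close> be random with a computable approximation \<open>x s \<longlongrightarrow> X\<close>, and split the natural numbers into
  infinitely many infinite columns. A total functional maps \<open>Y\<close> to the sequence \<open>Z\<close> of hits: at
  stage \<open>s\<close> in column \<open>i > 0\<close> a hit is recorded if \<open>x s\<close> agrees with \<open>Y\<close> on those elements of
  column \<open>i\<close> up to the last hit of the column; in column \<open>0\<close> the comparison extends to all numbers up
  to its last hit. Column \<open>i > 0\<close> becomes active only with a hit at or beyond \<open>i\<close> in column \<open>0\<close>.
  Hence column \<open>0\<close> has infinitely many hits only for \<open>Y = X\<close>, while for other \<open>Y\<close> only finitely
  many columns are ever active, and an active one has infinitely many hits if and only if \<open>Y\<close> agrees
  with \<open>X\<close> on it. The range of the functional is therefore countable; it is the support of the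
  image \<open>\<mu>\<close> of Lebesgue measure.

  A sequence in the range with \<open>k\<close> columns of infinitely many hits, not including column \<open>0\<close>, has
  rank \<open>k\<close>. Near it the finite columns are frozen, so all other members of the range have fewer
  infinite columns. Conversely, let it belong to an effectively closed set \<open>Q\<close>. By van Lambalgen's
  theorem a single infinite column of \<open>Y\<close> can be changed arbitrarily far out while staying in the
  preimage of \<open>Q\<close>, which loses only that column; inductively the sequence lies in the \<open>k\<close>-th
  derivative of \<open>Q\<close>. Changing column \<open>0\<close> of \<open>X\<close> likewise shows that the image of \<open>X\<close> is a limit of
  points of arbitrarily large finite rank in every such \<open>Q\<close>, so its rank is \<open>omega\<close>.
\<close>

section \<open>Functions recursive in an oracle\<close>

text \<open>
  Arguments are passed as environments, so that \<open>\<lambda>\<rho>. t \<rho>\<close> can be decomposed by unification alone and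
  binders shift indices definitionally. The values of \<open>(!) xs\<close> beyond the length of \<open>xs\<close> are
  unspecified.
\<close>

definition rec_in :: "(nat \<Rightarrow> nat) \<Rightarrow> nat \<Rightarrow> ((nat \<Rightarrow> nat) \<Rightarrow> nat) \<Rightarrow> bool" where
  "rec_in A k f \<longleftrightarrow> (\<exists>e. \<forall>xs. length xs = k \<longrightarrow> eval A e xs (f ((!) xs)))"

abbreviation dec_in :: "(nat \<Rightarrow> nat) \<Rightarrow> nat \<Rightarrow> ((nat \<Rightarrow> nat) \<Rightarrow> bool) \<Rightarrow> bool" where
  "dec_in A k P \<equiv> rec_in A k (\<lambda>\<rho>. of_bool (P \<rho>))"

lemma rec_in_var: "i < k \<Longrightarrow> rec_in A k (\<lambda>\<rho>. \<rho> i)"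
  unfolding rec_in_def by (intro exI[of _ "Proj i"] allI impI) (auto intro: eval_Proj)

text \<open>The program for \<open>F\<close> is known to be correct only on environments that come
  from lists of length \<open>q\<close>, so the composite is stated for the list of intermediate
  values.\<close>

lemma rec_in_comp_list:
  assumes "rec_in A q F" and "\<And>i. i < q \<Longrightarrow> rec_in A k (G i)"
  shows "rec_in A k (\<lambda>\<rho>. F ((!) (map (\<lambda>i. G i \<rho>) [0..<q])))"
proof -
  obtain e where e: "\<And>xs. length xs = q \<Longrightarrow> eval A e xs (F ((!) xs))"
    using assms(1) unfolding rec_in_def by blast
  have "\<exists>g. \<forall>i<q. \<forall>xs. length xs = k \<longrightarrow> eval A (g i) xs (G i ((!) xs))"
    using assms(2) unfolding rec_in_def by metis
  then obtain g where g: "\<And>i xs. i < q \<Longrightarrow> length xs = k \<Longrightarrow> eval A (g i) xs (G i ((!) xs))"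
    by blast
  have "eval A (Comp e (map g [0..<q])) xs (F ((!) (map (\<lambda>i. G i ((!) xs)) [0..<q])))"
    if "length xs = k" for xs
    using that by (intro eval_Comp[where ys = "map (\<lambda>i. G i ((!) xs)) [0..<q]"] e) (auto intro: g)
  then show ?thesis unfolding rec_in_def by blast
qed

lemma rec_in_comp1:
  assumes "rec_in A 1 (\<lambda>\<rho>. F (\<rho> 0))" "rec_in A k f"
  shows "rec_in A k (\<lambda>\<rho>. F (f \<rho>))"
  using rec_in_comp_list[OF assms(1), of k "\<lambda>_. f"] assms(2) by simp

lemma rec_in_comp2:
  assumes "rec_in A 2 (\<lambda>\<rho>. F (\<rho> 0) (\<rho> 1))" "rec_in A k f" "rec_in A k g"
  shows "rec_in A k (\<lambda>\<rho>. F (f \<rho>) (g \<rho>))"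
  using rec_in_comp_list[OF assms(1), of k "\<lambda>i. if i = 0 then f else g"] assms(2,3)
  by (simp add: upt_rec)

lemma rec_in_0: "rec_in A k (\<lambda>\<rho>. 0)"
  unfolding rec_in_def by (intro exI[of _ Zero] allI impI eval_Zero)

lemma rec_in_Suc:
  assumes "rec_in A k f" shows "rec_in A k (\<lambda>\<rho>. Suc (f \<rho>))"
proof (rule rec_in_comp1[OF _ assms])
  show "rec_in A 1 (\<lambda>\<rho>. Suc (\<rho> 0))"
    unfolding rec_in_def
    by (intro exI[of _ Succ] allI impI) (auto simp: length_Suc_conv intro: eval_Succ)
qed

lemma rec_in_oracle:
  assumes "rec_in A k f" shows "rec_in A k (\<lambda>\<rho>. A (f \<rho>))"
proof (rule rec_in_comp1[OF _ assms])
  show "rec_in A 1 (\<lambda>\<rho>. A (\<rho> 0))"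
    unfolding rec_in_def
    by (intro exI[of _ Oracle] allI impI) (auto simp: length_Suc_conv intro: eval_Oracle)
qed

lemma rec_in_const: "rec_in A k (\<lambda>\<rho>. c)"
  by (induction c) (auto intro: rec_in_0 rec_in_Suc)

text \<open>Weakening by a new variable with index 0. The shifted environment of
  \<open>y # ys\<close> equals \<open>(!) ys\<close> as a function, also beyond the end of the
  list.\<close>

lemma rec_in_shift:
  assumes "rec_in A k f" shows "rec_in A (Suc k) (\<lambda>\<rho>. f (\<lambda>i. \<rho> (Suc i)))"
proof -
  obtain e where e: "\<And>xs. length xs = k \<Longrightarrow> eval A e xs (f ((!) xs))"
    using assms unfolding rec_in_def by blast
  have "eval A (Comp e (map Proj [1..<Suc k])) xs (f (\<lambda>i. xs ! Suc i))" if len: "length xs = Suc k" for xs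
  proof -
    obtain y ys where xs: "xs = y # ys" "length ys = k" using len by (auto simp: length_Suc_conv)
    show ?thesis
    proof (rule eval_Comp[where ys = ys])
      show "\<forall>i<length (map Proj [1..<Suc k]). eval A (map Proj [1..<Suc k] ! i) xs (ys ! i)"
        using eval_Proj[of "Suc i" xs A for i] xs by (auto simp del: upt_Suc)
    next
      have "(\<lambda>i. xs ! Suc i) = (!) ys" using xs by auto
      then show "eval A e ys (f (\<lambda>i. xs ! Suc i))" using e xs(2) by simp
    qed (use xs in simp)
  qed
  then show ?thesis unfolding rec_in_def by blast
qed

text \<open>Weakening just below the newest variable: in a primitive recursion the counter has index
  0 and the previous value index 1, and a body that reads only the counter has to step over the
  previous value.\<close>

lemma rec_in_skip:
  assumes "rec_in A (Suc k) (\<lambda>\<rho>. s (\<rho> 0) (\<lambda>i. \<rho> (Suc i)))"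
  shows "rec_in A (Suc (Suc k)) (\<lambda>\<rho>. s (\<rho> 0) (\<lambda>i. \<rho> (Suc (Suc i))))"
proof -
  obtain e where e: "\<And>xs. length xs = Suc k \<Longrightarrow> eval A e xs (s (xs ! 0) (\<lambda>i. xs ! Suc i))"
    using assms unfolding rec_in_def by blast
  have "eval A (Comp e (Proj 0 # map Proj [2..<Suc (Suc k)])) xs (s (xs ! 0) (\<lambda>i. xs ! Suc (Suc i)))"
    if len: "length xs = Suc (Suc k)" for xs
  proof -
    obtain y z ys where xs: "xs = y # z # ys" "length ys = k" using len by (auto simp: length_Suc_conv)
    show ?thesis
    proof (rule eval_Comp[where ys = "y # ys"])
      show "\<forall>i<length (Proj 0 # map Proj [2..<Suc (Suc k)]).
          eval A ((Proj 0 # map Proj [2..<Suc (Suc k)]) ! i) xs ((y # ys) ! i)"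
        using eval_Proj[of 0 xs A] eval_Proj[of "Suc (Suc i)" xs A for i] xs
        by (auto simp: nth_Cons' less_Suc_eq_0_disj simp del: upt_Suc)
    next
      show "eval A e (y # ys) (s (xs ! 0) (\<lambda>i. xs ! Suc (Suc i)))"
        using e[of "y # ys"] xs by simp
    qed (simp add: xs del: upt_Suc)
  qed
  then show ?thesis unfolding rec_in_def by blast
qed

lemma rec_in_rec_nat:
  assumes "rec_in A k b" "rec_in A k n"
    and "rec_in A (Suc (Suc k)) (\<lambda>\<rho>. s (\<rho> 0) (\<rho> 1) (\<lambda>i. \<rho> (Suc (Suc i))))"
  shows "rec_in A k (\<lambda>\<rho>. rec_nat (b \<rho>) (\<lambda>i v. s i v \<rho>) (n \<rho>))"
proof -
  obtain eb where eb: "\<And>xs. length xs = k \<Longrightarrow> eval A eb xs (b ((!) xs))"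
    using assms(1) unfolding rec_in_def by blast
  obtain en where en: "\<And>xs. length xs = k \<Longrightarrow> eval A en xs (n ((!) xs))"
    using assms(2) unfolding rec_in_def by blast
  obtain es where es: "\<And>xs. length xs = Suc (Suc k) \<Longrightarrow>
      eval A es xs (s (xs ! 0) (xs ! 1) (\<lambda>i. xs ! Suc (Suc i)))"
    using assms(3) unfolding rec_in_def by blast
  have rec: "eval A (Prim eb es) (m # xs) (rec_nat (b ((!) xs)) (\<lambda>i v. s i v ((!) xs)) m)"
    if len: "length xs = k" for xs m
  proof (induction m)
    case 0
    then show ?case using eb[OF len] by (auto intro: eval_Prim_0)
  next
    case (Suc m)
    then show ?case
      using es[of "m # rec_nat (b ((!) xs)) (\<lambda>i v. s i v ((!) xs)) m # xs"] len
      by (auto intro: eval_Prim_Suc)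
  qed
  have "eval A (Comp (Prim eb es) (en # map Proj [0..<k])) xs
      (rec_nat (b ((!) xs)) (\<lambda>i v. s i v ((!) xs)) (n ((!) xs)))" if len: "length xs = k" for xs
  proof (rule eval_Comp[where ys = "n ((!) xs) # xs"])
    show "\<forall>i<length (en # map Proj [0..<k]).
        eval A ((en # map Proj [0..<k]) ! i) xs ((n ((!) xs) # xs) ! i)"
      using en[OF len] eval_Proj[of i xs A for i] len by (auto simp: nth_Cons')
  qed (use len rec[OF len] in auto)
  then show ?thesis unfolding rec_in_def by blast
qed

lemma rec_in_iter:
  assumes "rec_in A k b" "rec_in A k n"
    and "rec_in A (Suc k) (\<lambda>\<rho>. s (\<rho> 0) (\<lambda>i. \<rho> (Suc i)))"
  shows "rec_in A k (\<lambda>\<rho>. ((\<lambda>v. s v \<rho>) ^^ n \<rho>) (b \<rho>))"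
proof -
  have "rec_in A (Suc (Suc k)) (\<lambda>\<rho>. s (\<rho> 1) (\<lambda>i. \<rho> (Suc (Suc i))))"
    using rec_in_shift[OF assms(3)] by simp
  then have "rec_in A k (\<lambda>\<rho>. rec_nat (b \<rho>) (\<lambda>i v. s v \<rho>) (n \<rho>))"
    by (intro rec_in_rec_nat assms)
  moreover have "rec_nat b (\<lambda>i. f) n = (f ^^ n) b" for f :: "nat \<Rightarrow> nat" and b n
    by (induction n) auto
  ultimately show ?thesis by simp
qed

section \<open>Arithmetic, connectives and bounded operators\<close>

lemma rec_in_add:
  assumes "rec_in A k f" "rec_in A k g" shows "rec_in A k (\<lambda>\<rho>. f \<rho> + g \<rho>)"
proof -
  have "rec_in A k (\<lambda>\<rho>. (Suc ^^ f \<rho>) (g \<rho>))"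
    by (rule rec_in_iter[OF assms(2,1)]) (intro rec_in_Suc rec_in_var, simp)
  then show ?thesis by simp
qed

lemma rec_in_mult:
  assumes "rec_in A k f" "rec_in A k g" shows "rec_in A k (\<lambda>\<rho>. f \<rho> * g \<rho>)"
proof -
  have "rec_in A k (\<lambda>\<rho>. ((\<lambda>v. v + g \<rho>) ^^ f \<rho>) 0)"
    by (rule rec_in_iter[OF rec_in_0 assms(1)]) (intro rec_in_add rec_in_var assms(2)[THEN rec_in_shift], simp)
  moreover have "((\<lambda>v. v + b) ^^ a) 0 = a * b" for a b :: nat by (induction a) auto
  ultimately show ?thesis by simp
qed

lemma rec_in_power:
  assumes "rec_in A k f" "rec_in A k g" shows "rec_in A k (\<lambda>\<rho>. f \<rho> ^ g \<rho>)"
proof -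
  have "rec_in A k (\<lambda>\<rho>. ((\<lambda>v. v * f \<rho>) ^^ g \<rho>) 1)"
    by (rule rec_in_iter[OF rec_in_const assms(2)]) (intro rec_in_mult rec_in_var assms(1)[THEN rec_in_shift], simp)
  moreover have "((\<lambda>v. v * b) ^^ a) 1 = b ^ a" for a b :: nat by (induction a) auto
  ultimately show ?thesis by simp
qed

lemma rec_in_diff:
  assumes "rec_in A k f" "rec_in A k g" shows "rec_in A k (\<lambda>\<rho>. f \<rho> - g \<rho>)"
proof -
  \<comment> \<open>The predecessor is the recursion that returns its counter; subtraction iterates
    it.\<close>
  have "rec_in A k (\<lambda>\<rho>. rec_nat 0 (\<lambda>i v. i) (f \<rho>))" if "rec_in A k f" for k and f
    by (intro rec_in_rec_nat rec_in_0 that rec_in_var) simp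
  moreover have "rec_nat 0 (\<lambda>i v. i) n = n - 1" for n :: nat by (cases n) auto
  ultimately have pred: "rec_in A k (\<lambda>\<rho>. f \<rho> - 1)" if "rec_in A k f" for k and f using that by simp
  have "rec_in A k (\<lambda>\<rho>. ((\<lambda>v. v - 1) ^^ g \<rho>) (f \<rho>))"
    by (rule rec_in_iter[OF assms]) (intro pred rec_in_var, simp)
  moreover have "((\<lambda>v. v - 1) ^^ a) b = b - a" for a b :: nat by (induction a) auto
  ultimately show ?thesis by simp
qed

lemma dec_in_not: 
  assumes "dec_in A k P" shows "dec_in A k (\<lambda>\<rho>. \<not> P \<rho>)"
proof -
  have "rec_in A k (\<lambda>\<rho>. 1 - of_bool (P \<rho>))" by (intro rec_in_diff rec_in_const assms)
  moreover have "1 - of_bool b = (of_bool (\<not> b) :: nat)" for b by simp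
  ultimately show ?thesis by simp
qed

lemma dec_in_conj:
  assumes "dec_in A k P" "dec_in A k Q" shows "dec_in A k (\<lambda>\<rho>. P \<rho> \<and> Q \<rho>)"
  using rec_in_mult[OF assms] by (simp only: of_bool_conj)

lemma dec_in_disj:
  assumes "dec_in A k P" "dec_in A k Q" shows "dec_in A k (\<lambda>\<rho>. P \<rho> \<or> Q \<rho>)"
  using dec_in_not[OF dec_in_conj[OF assms[THEN dec_in_not]]] by simp

lemma dec_in_imp:
  assumes "dec_in A k P" "dec_in A k Q" shows "dec_in A k (\<lambda>\<rho>. P \<rho> \<longrightarrow> Q \<rho>)"
  using dec_in_disj[OF dec_in_not[OF assms(1)] assms(2)] by (simp only: imp_conv_disj)

lemma dec_in_iff:
  assumes "dec_in A k P" "dec_in A k Q" shows "dec_in A k (\<lambda>\<rho>. P \<rho> = Q \<rho>)"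
  using dec_in_conj[OF dec_in_imp[OF assms] dec_in_imp[OF assms(2,1)]]
  by (simp only: iff_conv_conj_imp)

lemma rec_in_if:
  assumes "dec_in A k P" "rec_in A k f" "rec_in A k g"
  shows "rec_in A k (\<lambda>\<rho>. if P \<rho> then f \<rho> else g \<rho>)"
proof -
  have "rec_in A k (\<lambda>\<rho>. of_bool (P \<rho>) * f \<rho> + of_bool (\<not> P \<rho>) * g \<rho>)"
    by (intro rec_in_add rec_in_mult assms dec_in_not)
  moreover have "of_bool b * x + of_bool (\<not> b) * y = (if b then x else y)" for b and x y :: nat by auto
  ultimately show ?thesis by simp
qed

lemma dec_in_const: "dec_in A k (\<lambda>\<rho>. b)"
  by (rule rec_in_const)

lemma dec_in_le:
  assumes "rec_in A k f" "rec_in A k g" shows "dec_in A k (\<lambda>\<rho>. f \<rho> \<le> g \<rho>)"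
proof -
  have "rec_in A k (\<lambda>\<rho>. 1 - (f \<rho> - g \<rho>))"
    by (intro rec_in_diff rec_in_const assms)
  moreover have "1 - (a - b) = of_bool (a \<le> b)" for a b :: nat by auto
  ultimately show ?thesis by simp
qed

lemma dec_in_less:
  assumes "rec_in A k f" "rec_in A k g" shows "dec_in A k (\<lambda>\<rho>. f \<rho> < g \<rho>)"
  using dec_in_le[OF rec_in_Suc[OF assms(1)] assms(2)] by (simp add: Suc_le_eq)

lemma dec_in_eq:
  assumes "rec_in A k f" "rec_in A k g" shows "dec_in A k (\<lambda>\<rho>. f \<rho> = g \<rho>)"
  using dec_in_conj[OF dec_in_le[OF assms] dec_in_le[OF assms(2,1)]] by (simp only: eq_iff)

text \<open>A bounded universal quantifier is the product of the truth values below the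
  bound.\<close>

lemma dec_in_Ball:
  assumes "rec_in A k n" "dec_in A (Suc k) (\<lambda>\<rho>. P (\<rho> 0) (\<lambda>i. \<rho> (Suc i)))"
  shows "dec_in A k (\<lambda>\<rho>. \<forall>m < n \<rho>. P m \<rho>)"
proof -
  have "rec_in A (Suc (Suc k)) (\<lambda>\<rho>. \<rho> 1 * of_bool (P (\<rho> 0) (\<lambda>i. \<rho> (Suc (Suc i)))))"
    using rec_in_skip[of A k "\<lambda>m \<rho>. of_bool (P m \<rho>)"] assms(2)
    by (intro rec_in_mult rec_in_var) auto
  then have "rec_in A k (\<lambda>\<rho>. rec_nat 1 (\<lambda>i v. v * of_bool (P i \<rho>)) (n \<rho>))"
    by (intro rec_in_rec_nat rec_in_const assms)
  moreover have "rec_nat 1 (\<lambda>i v. v * of_bool (Q i)) N = (of_bool (\<forall>m < N. Q m) :: nat)" for Q N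
    by (induction N) (auto simp: less_Suc_eq)
  ultimately show ?thesis by simp
qed

lemma dec_in_Bex:
  assumes "rec_in A k n" "dec_in A (Suc k) (\<lambda>\<rho>. P (\<rho> 0) (\<lambda>i. \<rho> (Suc i)))"
  shows "dec_in A k (\<lambda>\<rho>. \<exists>m < n \<rho>. P m \<rho>)"
  using dec_in_not[OF dec_in_Ball[OF assms(1) dec_in_not[OF assms(2)]]] by simp

lemma rec_in_sum:
  assumes "rec_in A k n" "rec_in A (Suc k) (\<lambda>\<rho>. f (\<rho> 0) (\<lambda>i. \<rho> (Suc i)))"
  shows "rec_in A k (\<lambda>\<rho>. \<Sum>m < n \<rho>. f m \<rho>)"
proof -
  have "rec_in A (Suc (Suc k)) (\<lambda>\<rho>. \<rho> 1 + f (\<rho> 0) (\<lambda>i. \<rho> (Suc (Suc i))))"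
    using rec_in_skip[of A k f] assms(2) by (intro rec_in_add rec_in_var) auto
  then have "rec_in A k (\<lambda>\<rho>. rec_nat 0 (\<lambda>i v. v + f i \<rho>) (n \<rho>))"
    by (intro rec_in_rec_nat rec_in_const assms)
  moreover have "rec_nat 0 (\<lambda>i v. v + g i) N = (\<Sum>m < N. g m :: nat)" for g N
    by (induction N) auto
  ultimately show ?thesis by simp
qed

text \<open>\<open>Mu\<close> looks for a zero, so it is applied to the negation; a witness in every
  environment makes the search total.\<close>

lemma rec_in_Least:
  assumes "dec_in A (Suc k) (\<lambda>\<rho>. P (\<rho> 0) (\<lambda>i. \<rho> (Suc i)))" and ex: "\<And>\<rho>. \<exists>n. P n \<rho>"
  shows "rec_in A k (\<lambda>\<rho>. LEAST n. P n \<rho>)"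
proof -
  obtain e where e: "\<And>xs. length xs = Suc k \<Longrightarrow>
      eval A e xs (of_bool (\<not> P (xs ! 0) (\<lambda>i. xs ! Suc i)))"
    using dec_in_not[OF assms(1)] unfolding rec_in_def by blast
  have "eval A (Mu e) xs (LEAST n. P n ((!) xs))" if len: "length xs = k" for xs
  proof (rule eval_Mu)
    have "P (LEAST n. P n ((!) xs)) ((!) xs)" by (rule LeastI_ex[OF ex])
    then show "eval A e ((LEAST n. P n ((!) xs)) # xs) 0"
      using e[of "(LEAST n. P n ((!) xs)) # xs"] len by simp
    show "\<forall>m<LEAST n. P n ((!) xs). \<exists>i. eval A e (m # xs) (Suc i)"
    proof (intro allI impI exI)
      fix m assume "m < (LEAST n. P n ((!) xs))"
      then have "\<not> P m ((!) xs)" by (rule not_less_Least)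
      then show "eval A e (m # xs) (Suc 0)" using e[of "m # xs"] len by simp
    qed
  qed
  then show ?thesis unfolding rec_in_def by blast
qed

lemma rec_in_half:
  assumes "rec_in A k f" shows "rec_in A k (\<lambda>\<rho>. f \<rho> div 2)"
proof -
  have "rec_in A k (\<lambda>\<rho>. LEAST q. f \<rho> < 2 * Suc q)"
    by (rule rec_in_Least)
      (intro dec_in_less rec_in_mult rec_in_Suc rec_in_const rec_in_var assms[THEN rec_in_shift],
        simp, presburger)
  moreover have "(LEAST q. n < 2 * Suc q) = n div 2" for n :: nat
    by (rule Least_equality) auto
  ultimately show ?thesis by simp
qed

lemma dec_in_even:
  assumes "rec_in A k f" shows "dec_in A k (\<lambda>\<rho>. even (f \<rho>))"
proof -
  have "dec_in A k (\<lambda>\<rho>. 2 * (f \<rho> div 2) = f \<rho>)"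
    by (intro dec_in_eq rec_in_mult rec_in_const rec_in_half assms)
  moreover have "(2 * (n div 2) = n) = even n" for n :: nat by presburger
  ultimately show ?thesis by simp
qed

lemmas rec_in_intros =
  rec_in_var rec_in_const rec_in_Suc rec_in_add rec_in_mult rec_in_power rec_in_diff rec_in_half
  rec_in_if rec_in_sum dec_in_not dec_in_conj dec_in_disj dec_in_imp dec_in_iff dec_in_const
  dec_in_le dec_in_less dec_in_eq dec_in_Ball dec_in_Bex dec_in_even

text \<open>The table of finitely many values is written into the program, so \<open>F\<close> may
  be an arbitrary function. This admits finite pieces of noncomputable sequences as
  parameters.\<close>

lemma rec_in_finite_support:
  assumes "rec_in A k f" shows "rec_in A k (\<lambda>\<rho>. if f \<rho> < (l::nat) then F (f \<rho>) else 0)"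
proof (rule rec_in_comp1[OF _ assms], induction l)
  case 0
  then show ?case by (simp add: rec_in_const)
next
  case (Suc l)
  have "rec_in A 1 (\<lambda>\<rho>. if \<rho> 0 = l then F l else if \<rho> 0 < l then F (\<rho> 0) else 0)"
    by (intro rec_in_if dec_in_eq rec_in_var rec_in_const Suc) simp
  moreover have "(if x = l then F l else if x < l then F x else 0) = (if x < Suc l then F x else 0)" for x
    by auto
  ultimately show ?case by simp
qed

lemma dec_in_finite:
  assumes "finite S" "rec_in A k f" shows "dec_in A k (\<lambda>\<rho>. f \<rho> \<in> S)"
proof -
  obtain l where "\<And>i. i \<in> S \<Longrightarrow> i < l" 
    using assms(1) by (auto simp: finite_nat_set_iff_bounded)
  then have "(if x < l then of_bool (x \<in> S) else 0) = (of_bool (x \<in> S) :: nat)" for x by auto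
  then show ?thesis using rec_in_finite_support[OF assms(2), of l "\<lambda>x. of_bool (x \<in> S)"] by simp
qed

section \<open>Substitution of oracles and determinism of evaluation\<close>

fun subst_oracle :: "recf \<Rightarrow> recf \<Rightarrow> recf" where
  "subst_oracle h Oracle = h"
| "subst_oracle h (Comp f gs) = Comp (subst_oracle h f) (map (subst_oracle h) gs)"
| "subst_oracle h (Prim f g) = Prim (subst_oracle h f) (subst_oracle h g)"
| "subst_oracle h (Mu f) = Mu (subst_oracle h f)"
| "subst_oracle h e = e"

lemma eval_subst_oracle:
  assumes h: "\<And>n. eval B h [n] (A n)"
  shows "eval A e xs y \<Longrightarrow> eval B (subst_oracle h e) xs y"
proof (induction rule: eval.induct)
  case (eval_Comp ys gs xs f z)
  then show ?case by (auto intro!: eval.eval_Comp[where ys = ys])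
next
  case (eval_Mu f n xs)
  then show ?case by (auto intro!: eval.eval_Mu)
next
  case (eval_Prim_Suc f g n xs y z)
  then show ?case by (auto intro: eval.eval_Prim_Suc)
qed (auto intro: h eval_Zero eval_Succ eval_Proj eval_Prim_0)

lemma rec_in_oracle_trans:
  assumes "rec_in A k f" "rec_in B 1 (\<lambda>\<rho>. A (\<rho> 0))" shows "rec_in B k f"
proof -
  obtain h where "\<And>xs. length xs = 1 \<Longrightarrow> eval B h xs (A (xs ! 0))"
    using assms(2) unfolding rec_in_def by blast
  from this[of "[n]" for n] have "\<And>n. eval B h [n] (A n)" by simp
  then show ?thesis using assms(1) eval_subst_oracle unfolding rec_in_def by blast
qed

abbreviation no_oracle :: "nat \<Rightarrow> nat" where "no_oracle \<equiv> \<lambda>_. 0"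

lemma rec_in_any_oracle: "rec_in no_oracle k f \<Longrightarrow> rec_in A k f"
  by (erule rec_in_oracle_trans) (rule rec_in_const)

inductive_cases eval_ZeroE: "eval A Zero xs y"
inductive_cases eval_SuccE: "eval A Succ xs y"
inductive_cases eval_ProjE: "eval A (Proj i) xs y"
inductive_cases eval_OracleE: "eval A Oracle xs y"
inductive_cases eval_CompE: "eval A (Comp f gs) xs y"
inductive_cases eval_Prim_0E: "eval A (Prim f g) (0 # xs) y"
inductive_cases eval_Prim_SucE: "eval A (Prim f g) (Suc n # xs) y"
inductive_cases eval_MuE: "eval A (Mu f) xs y"

lemma eval_deterministic: "eval A e xs y \<Longrightarrow> eval A e xs z \<Longrightarrow> y = z"
proof (induction arbitrary: z rule: eval.induct)
  case (eval_Comp ys gs xs f y)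
  from eval_Comp.prems obtain zs where zs: "length zs = length gs"
    "\<forall>i<length gs. eval A (gs ! i) xs (zs ! i)" "eval A f zs z"
    by (rule eval_CompE)
  have "ys = zs"
  proof (rule nth_equalityI)
    show "ys ! i = zs ! i" if "i < length ys" for i using that eval_Comp.IH(1) eval_Comp.hyps zs by auto
  qed (use eval_Comp.hyps zs in simp)
  then show ?case using eval_Comp.IH(2) zs(3) by blast
next
  case (eval_Prim_0 f xs y g)
  from eval_Prim_0.prems have "eval A f xs z" by (rule eval_Prim_0E)
  then show ?case by (rule eval_Prim_0.IH)
next
  case (eval_Prim_Suc f g n xs y z')
  from eval_Prim_Suc.prems obtain y' where "eval A (Prim f g) (n # xs) y'" "eval A g (n # y' # xs) z"
    by (rule eval_Prim_SucE)
  then show ?case using eval_Prim_Suc.IH by blast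
next
  case (eval_Mu f n xs)
  from eval_Mu.prems have z: "eval A f (z # xs) 0" "\<forall>m<z. \<exists>k. eval A f (m # xs) (Suc k)"
    by (auto elim: eval_MuE)
  have "\<not> z < n" using eval_Mu.IH(2) z(1) by fastforce
  moreover have "\<not> n < z" using eval_Mu.IH(1) z(2) by fastforce
  ultimately show ?case by simp
next
  case (eval_Zero xs) then show ?case by (auto elim: eval_ZeroE)
next
  case (eval_Succ x) then show ?case by (auto elim: eval_SuccE)
next
  case (eval_Proj i xs) then show ?case by (auto elim: eval_ProjE)
next
  case (eval_Oracle x) then show ?case by (auto elim: eval_OracleE)
qed

section \<open>Evaluation with bounded fuel\<close>

text \<open>The value \<open>0\<close> means no answer, \<open>Suc y\<close> the answer \<open>y\<close>; fuel bounds the unbounded searches only.\<close>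

fun fuel_eval :: "(nat \<Rightarrow> nat) \<Rightarrow> nat \<Rightarrow> recf \<Rightarrow> nat list \<Rightarrow> nat" where
  "fuel_eval A t Zero xs = 1"
| "fuel_eval A t Succ xs = (case xs of [x] \<Rightarrow> Suc (Suc x) | _ \<Rightarrow> 0)"
| "fuel_eval A t (Proj i) xs = (if i < length xs then Suc (xs ! i) else 0)"
| "fuel_eval A t Oracle xs = (case xs of [x] \<Rightarrow> Suc (A x) | _ \<Rightarrow> 0)"
| "fuel_eval A t (Comp f gs) xs =
    (if \<exists>g \<in> set gs. fuel_eval A t g xs = 0 then 0 else fuel_eval A t f (map (\<lambda>g. fuel_eval A t g xs - 1) gs))"
| "fuel_eval A t (Prim f g) xs =
    (case xs of [] \<Rightarrow> 0
     | n # ys \<Rightarrow> rec_nat (fuel_eval A t f ys)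
         (\<lambda>i v. if v = 0 then 0 else fuel_eval A t g (i # (v - 1) # ys)) n)"
| "fuel_eval A t (Mu f) xs =
    (let n = (LEAST n. t \<le> n \<or> fuel_eval A t f (n # xs) < 2)
     in if fuel_eval A t f (n # xs) = 1 then Suc n else 0)"

lemma fuel_eval_sound: "fuel_eval A t e xs = Suc y \<Longrightarrow> eval A e xs y"
proof (induction e arbitrary: xs y)
  case Zero
  then show ?case by (auto intro: eval_Zero)
next
  case Succ
  then show ?case by (auto intro: eval_Succ split: list.splits)
next
  case (Proj i)
  then show ?case by (auto intro: eval_Proj split: if_splits)
next
  case Oracle
  then show ?case by (auto intro: eval_Oracle split: list.splits)
next
  case (Comp f gs)
  have nz: "\<forall>g \<in> set gs. fuel_eval A t g xs \<noteq> 0"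
    and f: "fuel_eval A t f (map (\<lambda>g. fuel_eval A t g xs - 1) gs) = Suc y"
    using Comp.prems by (auto split: if_splits)
  show ?case
  proof (rule eval_Comp[where ys = "map (\<lambda>g. fuel_eval A t g xs - 1) gs"])
    show "\<forall>i<length gs. eval A (gs ! i) xs (map (\<lambda>g. fuel_eval A t g xs - 1) gs ! i)"
    proof (intro allI impI)
      fix i assume i: "i < length gs"
      then have "fuel_eval A t (gs ! i) xs = Suc (fuel_eval A t (gs ! i) xs - 1)" using nz by simp
      then show "eval A (gs ! i) xs (map (\<lambda>g. fuel_eval A t g xs - 1) gs ! i)"
        using Comp.IH(2)[of "gs ! i"] i by simp
    qed
  qed (use Comp.IH(1) f in auto)
next
  case (Prim f g)
  then obtain n ys where xs: "xs = n # ys" by (cases xs) auto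
  have "rec_nat (fuel_eval A t f ys) (\<lambda>i v. if v = 0 then 0 else fuel_eval A t g (i # (v - 1) # ys)) m = Suc z \<Longrightarrow>
      eval A (Prim f g) (m # ys) z" for m z
  proof (induction m arbitrary: z)
    case 0
    then show ?case using Prim.IH(1) by (auto intro: eval_Prim_0)
  next
    case (Suc m)
    let ?v = "rec_nat (fuel_eval A t f ys) (\<lambda>i v. if v = 0 then 0 else fuel_eval A t g (i # (v - 1) # ys)) m"
    obtain v where v: "?v = Suc v" using Suc.prems by (cases ?v) auto
    then have "eval A (Prim f g) (m # ys) v" by (rule Suc.IH)
    moreover have "eval A g (m # v # ys) z" using Suc.prems v by (intro Prim.IH(2)) simp
    ultimately show ?case by (rule eval_Prim_Suc)
  qed
  then show ?case using Prim.prems xs by simp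
next
  case (Mu f)
  \<comment> \<open>A value of at least 2 is an answer different from 0. The search stops at the
    first missing answer, at the first answer 0, or when the fuel is used up; only an answer 0 at
    the stopping place counts as success.\<close>
  define n where "n = (LEAST n. t \<le> n \<or> fuel_eval A t f (n # xs) < 2)"
  have n: "fuel_eval A t f (n # xs) = 1" "n = y"
    using Mu.prems unfolding fuel_eval.simps Let_def n_def[symmetric] by (auto split: if_splits)
  show ?case
  proof (rule eval_Mu)
    show "eval A f (y # xs) 0" using Mu.IH n by simp
    show "\<forall>m<y. \<exists>k. eval A f (m # xs) (Suc k)"
    proof (intro allI impI)
      fix m assume "m < y"
      then have "\<not> fuel_eval A t f (m # xs) < 2" using not_less_Least n(2) unfolding n_def by blast
      then obtain k where "fuel_eval A t f (m # xs) = Suc (Suc k)"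
        by (metis One_nat_def less_2_cases_iff not0_implies_Suc)
      then show "\<exists>k. eval A f (m # xs) (Suc k)" using Mu.IH by blast
    qed
  qed
qed

text \<open>The bound \<open>u\<close> serves both as a fuel bound and as a bound on the oracle queries.\<close>

lemma fuel_eval_complete:
  "eval A e xs y \<Longrightarrow> \<exists>u. \<forall>B t. u \<le> t \<longrightarrow> (\<forall>i<u. B i = A i) \<longrightarrow> fuel_eval B t e xs = Suc y"
proof (induction rule: eval.induct)
  case (eval_Oracle x)
  then show ?case by (intro exI[of _ "Suc x"]) auto
next
  case (eval_Comp ys gs xs f z)
  obtain u where u: "\<And>i B t. i < length gs \<Longrightarrow> u i \<le> t \<Longrightarrow> \<forall>j<u i. B j = A j \<Longrightarrow>
      fuel_eval B t (gs ! i) xs = Suc (ys ! i)"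
    using eval_Comp.IH(1) by metis
  obtain v where v: "\<And>B t. v \<le> t \<Longrightarrow> \<forall>j<v. B j = A j \<Longrightarrow> fuel_eval B t f ys = Suc z"
    using eval_Comp.IH(2) by metis
  show ?case
  proof (intro exI[of _ "(\<Sum>i<length gs. u i) + v"] allI impI)
    fix B t assume t: "(\<Sum>i<length gs. u i) + v \<le> t" and B: "\<forall>i<(\<Sum>i<length gs. u i) + v. B i = A i"
    have le: "u i \<le> (\<Sum>i<length gs. u i)" if "i < length gs" for i
      using that by (intro member_le_sum) auto
    have g: "fuel_eval B t (gs ! i) xs = Suc (ys ! i)" if "i < length gs" for i
      using le[OF that] t B by (intro u that) auto
    then have "map (\<lambda>g. fuel_eval B t g xs - 1) gs = ys"
      using eval_Comp.hyps by (intro nth_equalityI) auto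
    moreover have "\<not> (\<exists>g \<in> set gs. fuel_eval B t g xs = 0)" using g by (auto simp: in_set_conv_nth)
    moreover have "fuel_eval B t f ys = Suc z" using t B by (intro v) auto
    ultimately show "fuel_eval B t (Comp f gs) xs = Suc z" by simp
  qed
next
  case (eval_Prim_0 f xs z g)
  then show ?case by simp
next
  case (eval_Prim_Suc f g n xs y z)
  obtain u where u: "\<And>B t. u \<le> t \<Longrightarrow> \<forall>j<u. B j = A j \<Longrightarrow> fuel_eval B t (Prim f g) (n # xs) = Suc y"
    using eval_Prim_Suc.IH(1) by metis
  obtain v where v: "\<And>B t. v \<le> t \<Longrightarrow> \<forall>j<v. B j = A j \<Longrightarrow> fuel_eval B t g (n # y # xs) = Suc z"
    using eval_Prim_Suc.IH(2) by metis
  show ?case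
  proof (intro exI[of _ "u + v"] allI impI)
    fix B t assume t: "u + v \<le> t" and B: "\<forall>i<u + v. B i = A i"
    have "fuel_eval B t (Prim f g) (n # xs) = Suc y" using t B by (intro u) auto
    moreover have "fuel_eval B t g (n # y # xs) = Suc z" using t B by (intro v) auto
    ultimately show "fuel_eval B t (Prim f g) (Suc n # xs) = Suc z" by simp
  qed
next
  case (eval_Mu f n xs)
  obtain u where u: "\<And>B t. u \<le> t \<Longrightarrow> \<forall>j<u. B j = A j \<Longrightarrow> fuel_eval B t f (n # xs) = Suc 0"
    using eval_Mu.IH(1) by metis
  have "\<forall>m. \<exists>w. m < n \<longrightarrow>
      (\<forall>B t. w \<le> t \<longrightarrow> (\<forall>j<w. B j = A j) \<longrightarrow> \<not> fuel_eval B t f (m # xs) < 2)"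
  proof
    fix m
    show "\<exists>w. m < n \<longrightarrow> (\<forall>B t. w \<le> t \<longrightarrow> (\<forall>j<w. B j = A j) \<longrightarrow> \<not> fuel_eval B t f (m # xs) < 2)"
    proof (cases "m < n")
      case True
      then obtain k w where "\<forall>B t. w \<le> t \<longrightarrow> (\<forall>j<w. B j = A j) \<longrightarrow> fuel_eval B t f (m # xs) = Suc (Suc k)"
        using eval_Mu.IH(2) by metis
      then show ?thesis by (intro exI[of _ w]) auto
    qed simp
  qed
  then obtain w where w: "\<And>m B t. m < n \<Longrightarrow> w m \<le> t \<Longrightarrow> \<forall>j<w m. B j = A j \<Longrightarrow>
      \<not> fuel_eval B t f (m # xs) < 2"
    by metis
  show ?case
  \<comment> \<open>The summand \<open>Suc n\<close> prevents the fuel bound from stopping the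
    search before \<open>n\<close>.\<close>
  proof (intro exI[of _ "(\<Sum>m<n. w m) + u + Suc n"] allI impI)
    fix B t assume t: "(\<Sum>m<n. w m) + u + Suc n \<le> t"
      and B: "\<forall>i<(\<Sum>m<n. w m) + u + Suc n. B i = A i"
    have le: "w m \<le> (\<Sum>m<n. w m)" if "m < n" for m
      using that by (intro member_le_sum) auto
    have n: "fuel_eval B t f (n # xs) = Suc 0" using t B by (intro u) auto
    have m: "\<not> fuel_eval B t f (m # xs) < 2" if "m < n" for m
      using le[OF that] t B by (intro w that) auto
    have "(LEAST n. t \<le> n \<or> fuel_eval B t f (n # xs) < 2) = n"
    proof (rule Least_equality)
      show "n \<le> y" if "t \<le> y \<or> fuel_eval B t f (y # xs) < 2" for y
        using that m[of y] t by (cases "y < n") auto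
    qed (use n in simp)
    then show "fuel_eval B t (Mu f) xs = Suc n" using n by (simp add: Let_def)
  qed
qed (auto intro: exI[of _ 0])

lemma dec_in_Bex_list:
  assumes "\<And>g. g \<in> set gs \<Longrightarrow> dec_in A k (P g)" shows "dec_in A k (\<lambda>\<rho>. \<exists>g \<in> set gs. P g \<rho>)"
  using assms
proof (induction gs)
  case Nil
  then show ?case by (simp add: rec_in_const)
next
  case (Cons g gs)
  have "dec_in A k (\<lambda>\<rho>. P g \<rho> \<or> (\<exists>g \<in> set gs. P g \<rho>))"
    using Cons by (intro dec_in_disj) auto
  then show ?case by simp
qed

lemma rec_in_fuel_eval_comp:
  assumes "rec_in C (Suc q) (\<lambda>\<rho>. fuel_eval (B (\<rho> 0)) (\<rho> 0) e (map (\<lambda>i. \<rho> (Suc i)) [0..<q]))"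
    and "rec_in C k T" and "\<And>i. i < q \<Longrightarrow> rec_in C k (H i)"
  shows "rec_in C k (\<lambda>\<rho>. fuel_eval (B (T \<rho>)) (T \<rho>) e (map (\<lambda>i. H i \<rho>) [0..<q]))"
proof -
  have "rec_in C k (case i of 0 \<Rightarrow> T | Suc j \<Rightarrow> H j)" if "i < Suc q" for i
    using assms(2,3) that by (cases i) auto
  note rec_in_comp_list[where G = "\<lambda>i. case i of 0 \<Rightarrow> T | Suc j \<Rightarrow> H j", OF assms(1) this]
  then have "rec_in C k (\<lambda>\<rho>. fuel_eval (B (T \<rho>)) (T \<rho>) e
      (map (\<lambda>i. map (\<lambda>i. (case i of 0 \<Rightarrow> T | Suc j \<Rightarrow> H j) \<rho>) [0..<Suc q] ! Suc i) [0..<q]))"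
    by (simp add: upt_rec[of 0 "Suc q"] del: upt_Suc)
  moreover have "map (\<lambda>i. map (\<lambda>i. (case i of 0 \<Rightarrow> T | Suc j \<Rightarrow> H j) \<rho>) [0..<Suc q] ! Suc i) [0..<q]
      = map (\<lambda>i. H i \<rho>) [0..<q]" for \<rho>
    by (auto simp del: upt_Suc)
  ultimately show ?thesis by (simp only:)
qed

text \<open>Induction on \<open>e\<close> produces a separate program for each \<open>e\<close>
  rather than one universal program. The oracle may change with the fuel, as in an approximation to
  a noncomputable oracle.\<close>

lemma rec_in_fuel_eval:
  assumes B: "rec_in C 2 (\<lambda>\<rho>. B (\<rho> 0) (\<rho> 1))"
  shows "rec_in C (Suc k) (\<lambda>\<rho>. fuel_eval (B (\<rho> 0)) (\<rho> 0) e (map (\<lambda>i. \<rho> (Suc i)) [0..<k]))"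
proof (induction e arbitrary: k)
  case Zero
  show ?case by (simp add: rec_in_const)
next
  case Succ
  show ?case
  proof (cases "k = 1")
    case True
    then show ?thesis by (auto intro!: rec_in_intros)
  next
    case False
    then have "(case map (\<lambda>i. \<rho> (Suc i)) [0..<k] of [x] \<Rightarrow> Suc (Suc x) | _ \<Rightarrow> 0) = 0" for \<rho> :: "nat \<Rightarrow> nat"
      by (auto split: list.splits dest: arg_cong[of _ _ length])
    then show ?thesis by (simp add: rec_in_const)
  qed
next
  case (Proj i)
  show ?case by (cases "i < k") (auto intro!: rec_in_intros)
next
  case Oracle
  show ?case
  proof (cases "k = 1")
    case True
    have "rec_in C 2 (\<lambda>\<rho>. Suc (B (\<rho> 0) (\<rho> 1)))" by (intro rec_in_Suc B)
    then show ?thesis using True by (simp add: numeral_2_eq_2)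
  next
    case False
    then have "(case map (\<lambda>i. \<rho> (Suc i)) [0..<k] of [x] \<Rightarrow> Suc (B (\<rho> 0) x) | _ \<Rightarrow> 0) = 0" for \<rho> :: "nat \<Rightarrow> nat"
      by (auto split: list.splits dest: arg_cong[of _ _ length])
    then show ?thesis by (simp add: rec_in_const)
  qed
next
  case (Comp f gs)
  let ?xs = "\<lambda>\<rho>. map (\<lambda>i. \<rho> (Suc i)) [0..<k]"
  have "rec_in C (Suc k) (\<lambda>\<rho>. fuel_eval (B (\<rho> 0)) (\<rho> 0) f
      (map (\<lambda>i. fuel_eval (B (\<rho> 0)) (\<rho> 0) (gs ! i) (?xs \<rho>) - 1) [0..<length gs]))"
    by (rule rec_in_fuel_eval_comp[OF Comp.IH(1)]) (intro rec_in_var rec_in_diff rec_in_const Comp.IH(2); simp)+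
  moreover have "map (\<lambda>i. fuel_eval (B (\<rho> 0)) (\<rho> 0) (gs ! i) (?xs \<rho>) - 1) [0..<length gs] =
      map (\<lambda>g. fuel_eval (B (\<rho> 0)) (\<rho> 0) g (?xs \<rho>) - 1) gs" for \<rho>
    by (intro nth_equalityI) auto
  ultimately have "rec_in C (Suc k) (\<lambda>\<rho>. fuel_eval (B (\<rho> 0)) (\<rho> 0) f
      (map (\<lambda>g. fuel_eval (B (\<rho> 0)) (\<rho> 0) g (?xs \<rho>) - 1) gs))"
    by simp
  then show ?case
    unfolding fuel_eval.simps
    by (intro rec_in_if dec_in_Bex_list dec_in_eq rec_in_const Comp.IH(2))
next
  case (Prim f g)
  show ?case
  proof (cases k)
    case 0
    then show ?thesis by (simp add: rec_in_const)
  next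
    case (Suc k')
    have xs: "map (\<lambda>i. \<rho> (Suc i)) [0..<k] = \<rho> 1 # map (\<lambda>i. \<rho> (Suc (Suc i))) [0..<k']"
      for \<rho> :: "nat \<Rightarrow> nat"
      unfolding Suc by (intro nth_equalityI) (auto simp: nth_Cons' simp del: upt_Suc)
    have f: "rec_in C (Suc k) (\<lambda>\<rho>. fuel_eval (B (\<rho> 0)) (\<rho> 0) f (map (\<lambda>i. \<rho> (Suc (Suc i))) [0..<k']))"
      unfolding Suc by (rule rec_in_fuel_eval_comp[OF Prim.IH(1)]) (rule rec_in_var; simp)+
    \<comment> \<open>Inside the recursion the environment lists the counter, the previous value,
      the fuel, the recursion argument and the remaining arguments. The call of \<open>g\<close>
      reads the counter, the previous value without the successor that marks an answer, and the
      remaining arguments.\<close>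
    let ?h = "\<lambda>i (\<rho> :: nat \<Rightarrow> nat). case i of 0 \<Rightarrow> \<rho> 0 | Suc 0 \<Rightarrow> \<rho> 1 - 1 | Suc (Suc i) \<Rightarrow> \<rho> (i + 4)"
    have "rec_in C (Suc (Suc (Suc k))) (?h i)" if "i < Suc k" for i
    proof -
      consider "i = 0" | "i = Suc 0" | j where "i = Suc (Suc j)" by (metis nat.exhaust)
      then show ?thesis using that by cases (auto intro: rec_in_var rec_in_diff[OF rec_in_var rec_in_const, simplified])
    qed
    then have "rec_in C (Suc (Suc (Suc k))) (\<lambda>\<rho>. fuel_eval (B (\<rho> 2)) (\<rho> 2) g
        (map (\<lambda>i. ?h i \<rho>) [0..<Suc k]))"
      by (intro rec_in_fuel_eval_comp[OF Prim.IH(2)] rec_in_var) auto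
    moreover have "map (\<lambda>i. ?h i \<rho>) [0..<Suc k] =
        \<rho> 0 # (\<rho> 1 - 1) # map (\<lambda>i. \<rho> (Suc (Suc (Suc (Suc i))))) [0..<k']" for \<rho>
      unfolding Suc
      by (intro nth_equalityI) (auto simp: nth_Cons' numeral_eq_Suc split: nat.split simp del: upt_Suc)
    ultimately have g: "rec_in C (Suc (Suc (Suc k))) (\<lambda>\<rho>. fuel_eval (B (\<rho> 2)) (\<rho> 2) g
        (\<rho> 0 # (\<rho> 1 - 1) # map (\<lambda>i. \<rho> (Suc (Suc (Suc (Suc i))))) [0..<k']))"
      by (simp only:)
    have "rec_in C (Suc k) (\<lambda>\<rho>. rec_nat
        (fuel_eval (B (\<rho> 0)) (\<rho> 0) f (map (\<lambda>i. \<rho> (Suc (Suc i))) [0..<k']))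
        (\<lambda>i v. if v = 0 then 0 else fuel_eval (B (\<rho> 0)) (\<rho> 0) g
          (i # (v - 1) # map (\<lambda>i. \<rho> (Suc (Suc i))) [0..<k'])) (\<rho> 1))"
    proof (intro rec_in_rec_nat[OF f] rec_in_if)
      show "rec_in C (Suc (Suc (Suc k))) (\<lambda>\<rho>. fuel_eval (B (\<rho> (Suc (Suc 0)))) (\<rho> (Suc (Suc 0))) g
        (\<rho> 0 # (\<rho> 1 - 1) # map (\<lambda>i. \<rho> (Suc (Suc (Suc (Suc i))))) [0..<k']))"
        using g by (simp add: numeral_2_eq_2)
    qed (auto intro!: rec_in_intros simp: Suc)
    then show ?thesis unfolding fuel_eval.simps xs by simp
  qed
next
  case (Mu f)
  let ?h = "\<lambda>i (\<rho> :: nat \<Rightarrow> nat). case i of 0 \<Rightarrow> \<rho> 0 | Suc i \<Rightarrow> \<rho> (Suc (Suc i))"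
  have "rec_in C (Suc (Suc k)) (?h i)" if "i < Suc k" for i
    using that by (cases i) (auto intro: rec_in_var)
  then have "rec_in C (Suc (Suc k)) (\<lambda>\<rho>. fuel_eval (B (\<rho> 1)) (\<rho> 1) f (map (\<lambda>i. ?h i \<rho>) [0..<Suc k]))"
    by (intro rec_in_fuel_eval_comp[OF Mu] rec_in_var) auto
  moreover have "map (\<lambda>i. ?h i \<rho>) [0..<Suc k] = \<rho> 0 # map (\<lambda>i. \<rho> (Suc (Suc i))) [0..<k]" for \<rho>
    by (intro nth_equalityI) (auto simp: nth_Cons' split: nat.split simp del: upt_Suc)
  ultimately have f: "rec_in C (Suc (Suc k)) (\<lambda>\<rho>. fuel_eval (B (\<rho> 1)) (\<rho> 1) f
      (\<rho> 0 # map (\<lambda>i. \<rho> (Suc (Suc i))) [0..<k]))"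
    by (simp only:)
  have n: "rec_in C (Suc k) (\<lambda>\<rho>. LEAST n. \<rho> 0 \<le> n \<or>
      fuel_eval (B (\<rho> 0)) (\<rho> 0) f (n # map (\<lambda>i. \<rho> (Suc i)) [0..<k]) < 2)"
    by (rule rec_in_Least)
      (intro dec_in_disj dec_in_le dec_in_less rec_in_const rec_in_var f[unfolded One_nat_def], auto)
  let ?n = "\<lambda>\<rho>. LEAST n. \<rho> 0 \<le> n \<or> fuel_eval (B (\<rho> 0)) (\<rho> 0) f (n # map (\<lambda>i. \<rho> (Suc i)) [0..<k]) < 2"
  let ?h' = "\<lambda>i (\<rho> :: nat \<Rightarrow> nat). case i of 0 \<Rightarrow> ?n \<rho> | Suc i \<Rightarrow> \<rho> (Suc i)"
  have "rec_in C (Suc k) (?h' i)" if "i < Suc k" for i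
    using that n by (cases i) (auto intro: rec_in_var)
  then have "rec_in C (Suc k) (\<lambda>\<rho>. fuel_eval (B (\<rho> 0)) (\<rho> 0) f (map (\<lambda>i. ?h' i \<rho>) [0..<Suc k]))"
    by (intro rec_in_fuel_eval_comp[OF Mu] rec_in_var) auto
  moreover have "map (\<lambda>i. ?h' i \<rho>) [0..<Suc k] = ?n \<rho> # map (\<lambda>i. \<rho> (Suc i)) [0..<k]" for \<rho>
    by (intro nth_equalityI) (auto simp: nth_Cons' split: nat.split simp del: upt_Suc)
  ultimately have "rec_in C (Suc k) (\<lambda>\<rho>. fuel_eval (B (\<rho> 0)) (\<rho> 0) f (?n \<rho> # map (\<lambda>i. \<rho> (Suc i)) [0..<k]))"
    by (simp only:)
  then show ?case
    unfolding fuel_eval.simps Let_def by (intro rec_in_if dec_in_eq rec_in_Suc n rec_in_const)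
qed

section \<open>Enumerable relations, codes of strings and limit approximations\<close>

text \<open>Since evaluation is deterministic, \<open>Comp\<close> halts exactly when the outer
  program halts on the unique tuple of inner values.\<close>

lemma ce_rel_subst:
  assumes "ce_rel q W" and "\<And>i. i < q \<Longrightarrow> rec_in no_oracle k (G i)"
  shows "ce_rel k (\<lambda>xs. W (map (\<lambda>i. G i ((!) xs)) [0..<q]))"
proof -
  obtain e where e: "\<And>xs. length xs = q \<Longrightarrow> W xs \<longleftrightarrow> (\<exists>y. eval0 e xs y)"
    using assms(1) unfolding ce_rel_def by blast
  have "\<exists>g. \<forall>i<q. \<forall>xs. length xs = k \<longrightarrow> eval0 (g i) xs (G i ((!) xs))"
    using assms(2) unfolding rec_in_def by metis
  then obtain g where g: "\<And>i xs. i < q \<Longrightarrow> length xs = k \<Longrightarrow> eval0 (g i) xs (G i ((!) xs))"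
    by blast
  have "W (map (\<lambda>i. G i ((!) xs)) [0..<q]) \<longleftrightarrow> (\<exists>y. eval0 (Comp e (map g [0..<q])) xs y)"
    if len: "length xs = k" for xs
  proof -
    let ?ys = "map (\<lambda>i. G i ((!) xs)) [0..<q]"
    have "eval0 e ?ys y \<longleftrightarrow> eval0 (Comp e (map g [0..<q])) xs y" for y
    proof
      assume "eval0 e ?ys y"
      then show "eval0 (Comp e (map g [0..<q])) xs y"
        by (intro eval_Comp[where ys = ?ys]) (auto intro: g len)
    next
      assume "eval0 (Comp e (map g [0..<q])) xs y"
      then obtain zs where zs: "length zs = length (map g [0..<q])"
        "\<forall>i<length (map g [0..<q]). eval0 (map g [0..<q] ! i) xs (zs ! i)" "eval0 e zs y"
        by (rule eval_CompE)
      have "zs = ?ys"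
      proof (rule nth_equalityI)
        fix i assume "i < length zs"
        then have i: "i < q" using zs(1) by simp
        then have "eval0 (g i) xs (zs ! i)" using zs(2) by simp
        then show "zs ! i = ?ys ! i" using eval_deterministic[OF _ g[OF i len]] i by simp
      qed (use zs in simp)
      then show "eval0 e ?ys y" using zs(3) by simp
    qed
    then show ?thesis using e[of ?ys] by simp
  qed
  then show ?thesis unfolding ce_rel_def by blast
qed

text \<open>The unbounded search for a witness halts exactly when one exists.\<close>

lemma ce_rel_Ex:
  assumes "dec_in no_oracle (Suc k) (\<lambda>\<rho>. P (\<rho> 0) (\<lambda>i. \<rho> (Suc i)))"
  shows "ce_rel k (\<lambda>xs. \<exists>n. P n ((!) xs))"
proof -
  obtain e where e: "\<And>xs. length xs = Suc k \<Longrightarrow>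
      eval0 e xs (of_bool (\<not> P (xs ! 0) (\<lambda>i. xs ! Suc i)))"
    using dec_in_not[OF assms] unfolding rec_in_def by blast
  have "(\<exists>n. P n ((!) xs)) \<longleftrightarrow> (\<exists>y. eval0 (Mu e) xs y)" if len: "length xs = k" for xs
  proof
    assume ex: "\<exists>n. P n ((!) xs)"
    have "eval0 (Mu e) xs (LEAST n. P n ((!) xs))"
    proof (rule eval_Mu)
      have "P (LEAST n. P n ((!) xs)) ((!) xs)" by (rule LeastI_ex[OF ex])
      then show "eval0 e ((LEAST n. P n ((!) xs)) # xs) 0"
        using e[of "(LEAST n. P n ((!) xs)) # xs"] len by simp
      show "\<forall>m<LEAST n. P n ((!) xs). \<exists>i. eval0 e (m # xs) (Suc i)"
      proof (intro allI impI exI)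
        fix m assume "m < (LEAST n. P n ((!) xs))"
        then have "\<not> P m ((!) xs)" by (rule not_less_Least)
        then show "eval0 e (m # xs) (Suc 0)" using e[of "m # xs"] len by simp
      qed
    qed
    then show "\<exists>y. eval0 (Mu e) xs y" by blast
  next
    assume "\<exists>y. eval0 (Mu e) xs y"
    then obtain y where "eval0 e (y # xs) 0" by (auto elim: eval_MuE)
    then have "of_bool (\<not> P y ((!) xs)) = (0 :: nat)"
      using eval_deterministic[OF e[of "y # xs"]] len by simp
    then show "\<exists>n. P n ((!) xs)" by auto
  qed
  then show ?thesis unfolding ce_rel_def by blast
qed

lemma ce_rel_dec: "dec_in no_oracle k P \<Longrightarrow> ce_rel k (\<lambda>xs. P ((!) xs))"
  using ce_rel_Ex[of k "\<lambda>_. P"] rec_in_shift by force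

lemma ce_rel_stages:
  assumes "ce_rel 1 W"
  obtains D where "dec_in no_oracle 2 (\<lambda>\<rho>. D (\<rho> 0) (\<rho> 1))"
    and "\<And>t t' z. t \<le> t' \<Longrightarrow> D t z \<Longrightarrow> D t' z" and "\<And>z. W [z] \<longleftrightarrow> (\<exists>t. D t z)"
proof -
  obtain e where e: "\<And>z. W [z] \<longleftrightarrow> (\<exists>y. eval0 e [z] y)"
    using assms unfolding ce_rel_def by auto
  \<comment> \<open>Collecting all fuel values up to \<open>t\<close> makes the stages increasing by
    construction.\<close>
  define D where "D = (\<lambda>t z. \<exists>t'<Suc t. fuel_eval no_oracle t' e [z] \<noteq> 0)"
  show ?thesis
  proof
    have "rec_in no_oracle (Suc 2) (\<lambda>\<rho>. fuel_eval no_oracle (\<rho> 0) e (map (\<lambda>i. \<rho> 2) [0..<1]))"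
      by (rule rec_in_fuel_eval_comp[where B = "\<lambda>_. no_oracle", OF rec_in_fuel_eval])
        (intro rec_in_const rec_in_var; simp)+
    then show "dec_in no_oracle 2 (\<lambda>\<rho>. D (\<rho> 0) (\<rho> 1))"
      unfolding D_def
      by (intro dec_in_Bex dec_in_not dec_in_eq rec_in_Suc rec_in_var rec_in_const)
        (simp_all add: numeral_2_eq_2)
    show "D t' z" if "t \<le> t'" "D t z" for t t' z
      using that unfolding D_def by (meson Suc_le_mono less_le_trans)
    show "W [z] \<longleftrightarrow> (\<exists>t. D t z)" for z
    proof
      assume "W [z]"
      then obtain y where "eval0 e [z] y" using e by blast
      from fuel_eval_complete[OF this] obtain u where
        "\<forall>B t. u \<le> t \<longrightarrow> (\<forall>i<u. B i = 0) \<longrightarrow> fuel_eval B t e [z] = Suc y" by blast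
      then have "fuel_eval no_oracle u e [z] = Suc y" by simp
      then have "D u z" unfolding D_def by (intro exI[of _ u]) simp
      then show "\<exists>t. D t z" by blast
    next
      assume "\<exists>t. D t z"
      then obtain t where "fuel_eval no_oracle t e [z] \<noteq> 0" unfolding D_def by blast
      then show "W [z]" using e fuel_eval_sound by (metis not0_implies_Suc)
    qed
  qed
qed

section \<open>Codes of finite strings\<close>

definition agree :: "nat \<Rightarrow> cantor \<Rightarrow> cantor \<Rightarrow> bool" where
  "agree n X Y \<longleftrightarrow> (\<forall>i<n. X i = Y i)"

text \<open>Beyond the length of the coded string, \<open>code_bit\<close> takes junk values.\<close>

definition code_bit :: "nat \<Rightarrow> cantor" where
  "code_bit z i \<longleftrightarrow> even (((\<lambda>z. (z - 1) div 2) ^^ i) z)"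

text \<open>Removing letters from \<open>z\<close> reaches 0 after as many steps as the string has
  letters, and a string is no longer than its code; hence the range of the sum.\<close>

definition code_length :: "nat \<Rightarrow> nat" where
  "code_length z = (\<Sum>i<z. of_bool (((\<lambda>z. (z - 1) div 2) ^^ i) z \<noteq> 0))"

text \<open>The value of \<open>code\<close> on the prefix of length \<open>n\<close>, as a sum of
  bijective binary digits 1 and 2.\<close>

definition prefix_code :: "cantor \<Rightarrow> nat \<Rightarrow> nat" where
  "prefix_code X n = (\<Sum>i<n. 2 ^ i * (if X i then 2 else 1))"

lemma code_drop: "((\<lambda>z. (z - 1) div 2) ^^ i) (code s) = code (drop i s)"
proof (induction i arbitrary: s)
  case (Suc i)
  have "(code s - 1) div 2 = code (drop 1 s)" by (cases s) auto
  then show ?case using Suc[of "drop 1 s"] by (simp only: funpow_Suc_right o_apply drop_drop) simp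
qed simp

lemma code_bit_code: "i < length s \<Longrightarrow> code_bit (code s) i = s ! i"
  unfolding code_bit_def code_drop by (simp flip: Cons_nth_drop_Suc)

lemma length_le_code: "length s \<le> code s"
  by (induction s) auto

lemma code_eq_0: "code s = 0 \<longleftrightarrow> s = []"
  by (cases s) auto

lemma code_length_code: "code_length (code s) = length s"
proof -
  have "code_length (code s) = (\<Sum>i<code s. of_bool (i < length s))"
    unfolding code_length_def code_drop by (intro sum.cong) (auto simp: code_eq_0)
  also have "\<dots> = card ({..<code s} \<inter> {..<length s})"
    by (simp add: of_bool_def sum.If_cases lessThan_def)
  also have "{..<code s} \<inter> {..<length s} = {..<length s}" using length_le_code[of s] by auto
  finally show ?thesis by simp
qed

lemma code_append: "code (s @ [b]) = code s + 2 ^ length s * (if b then 2 else 1)"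
  by (induction s) auto

lemma code_prefix_of: "code (prefix_of X n) = prefix_code X n"
  by (induction n) (auto simp: prefix_of_def prefix_code_def code_append)

lemma length_prefix [simp]: "length (prefix_of X n) = n"
  by (simp add: prefix_of_def)

lemma nth_prefix [simp]: "i < n \<Longrightarrow> prefix_of X n ! i = X i"
  by (simp add: prefix_of_def)

lemma code_bit_prefix_code: "i < n \<Longrightarrow> code_bit (prefix_code X n) i = X i"
  using code_bit_code[of i "prefix_of X n"] by (simp add: code_prefix_of)

lemma code_length_prefix_code: "code_length (prefix_code X n) = n"
  using code_length_code[of "prefix_of X n"] by (simp add: code_prefix_of)

lemma prefix_code_cong: "agree n X Y \<Longrightarrow> prefix_code X n = prefix_code Y n"
  unfolding prefix_code_def agree_def by (intro sum.cong) auto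

lemma prefix_code_eq_iff: "prefix_code X n = prefix_code Y n \<longleftrightarrow> agree n X Y"
  using prefix_code_cong code_bit_prefix_code unfolding agree_def by metis

text \<open>Turns a search through all strings of length \<open>n\<close> into a bounded quantifier
  over codes.\<close>

lemma prefix_code_less: "prefix_code X n < 2 ^ Suc n"
proof (induction n)
  case (Suc n)
  have "prefix_code X (Suc n) \<le> prefix_code X n + 2 * 2 ^ n" unfolding prefix_code_def by simp
  also have "\<dots> < 2 ^ Suc (Suc n)" using Suc by simp
  finally show ?case .
qed (simp add: prefix_code_def)

lemma agree_code_bit_prefix_code: "agree n (code_bit (prefix_code X n)) X"
  unfolding agree_def by (simp add: code_bit_prefix_code)

lemma agree_refl [simp]: "agree n X X" and agree_sym: "agree n X Y \<Longrightarrow> agree n Y X"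
  and agree_trans: "agree n X Y \<Longrightarrow> agree n Y Z \<Longrightarrow> agree n X Z"
  and agree_mono: "m \<le> n \<Longrightarrow> agree n X Y \<Longrightarrow> agree m X Y"
  by (auto simp: agree_def)

lemma prefix_eq_iff: "prefix_of X n = prefix_of Y n \<longleftrightarrow> agree n X Y"
  by (auto simp: prefix_of_def agree_def)

lemma cylinder_prefix: "cylinder (prefix_of X n) = {Y. agree n Y X}"
  by (auto simp: cylinder_def prefix_eq_iff)

lemma prefix_of_nth: "prefix_of (\<lambda>i. s ! i) (length s) = s"
  by (simp add: prefix_of_def map_nth)

lemma in_cylinder: "X \<in> cylinder s \<longleftrightarrow> s = prefix_of X (length s)"
  by (auto simp: cylinder_def)

text \<open>A string whose cylinder contains \<open>X\<close> is a prefix of \<open>X\<close>, so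
  only the prefixes have to be tested.\<close>

lemma Union_cylinders:
  "X \<in> (\<Union>s \<in> {s. W (code s)}. cylinder s) \<longleftrightarrow> (\<exists>n. W (prefix_code X n))"
  by (auto simp: in_cylinder) (metis code_prefix_of, metis code_prefix_of length_prefix)

lemma dec_in_code_bit:
  assumes "rec_in A k z" "rec_in A k i" shows "dec_in A k (\<lambda>\<rho>. code_bit (z \<rho>) (i \<rho>))"
  unfolding code_bit_def
  by (intro dec_in_even rec_in_iter assms rec_in_half rec_in_diff rec_in_var rec_in_const) simp

lemma rec_in_code_length:
  assumes "rec_in A k z" shows "rec_in A k (\<lambda>\<rho>. code_length (z \<rho>))"
  unfolding code_length_def
  by (intro rec_in_sum assms dec_in_not dec_in_eq rec_in_iter rec_in_half rec_in_diff rec_in_var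
      rec_in_const assms[THEN rec_in_shift]) auto

lemma rec_in_prefix_code:
  assumes "dec_in A (Suc k) (\<lambda>\<rho>. X (\<rho> 0) (\<lambda>i. \<rho> (Suc i)))" "rec_in A k n"
  shows "rec_in A k (\<lambda>\<rho>. prefix_code (\<lambda>i. X i \<rho>) (n \<rho>))"
  unfolding prefix_code_def
  by (intro rec_in_sum assms rec_in_mult rec_in_power rec_in_if rec_in_var rec_in_const) simp

section \<open>Limit approximations and Turing reducibility\<close>

definition limit_approx :: "(nat \<Rightarrow> nat \<Rightarrow> bool) \<Rightarrow> cantor \<Rightarrow> bool" where
  "limit_approx x X \<longleftrightarrow> dec_in no_oracle 2 (\<lambda>\<rho>. x (\<rho> 0) (\<rho> 1)) \<and>
    (\<forall>m. \<exists>s0. \<forall>s\<ge>s0. x s m = X m)"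

lemma limit_approx_stable:
  assumes "limit_approx x X" shows "\<exists>s0. \<forall>s\<ge>s0. \<forall>m<n. x s m = X m"
proof (induction n)
  case (Suc n)
  then obtain a where "\<forall>s\<ge>a. \<forall>m<n. x s m = X m" by blast
  moreover obtain b where "\<forall>s\<ge>b. x s n = X n" using assms unfolding limit_approx_def by blast
  ultimately show ?case by (intro exI[of _ "max a b"]) (auto simp: less_Suc_eq)
qed simp

text \<open>One direction of the limit lemma. A number \<open>a\<close> settles \<open>n\<close> if
  it witnesses membership through \<open>P\<close> or non-membership through \<open>Q\<close>. Stage
  \<open>s\<close> takes the least candidate that is not refuted on both counts below
  \<open>s\<close>; this stabilises at the least true witness.\<close>

lemma delta02_limit_approx:
  assumes "delta02 X" obtains x where "limit_approx x X"
proof -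
  obtain P where P: "computable_rel 3 P" "\<And>n. X n \<longleftrightarrow> (\<exists>a. \<forall>b. P [n, a, b])"
    using assms unfolding delta02_def sigma02_def by blast
  obtain Q where Q: "computable_rel 3 Q" "\<And>n. X n \<longleftrightarrow> (\<forall>a. \<exists>b. Q [n, a, b])"
    using assms unfolding delta02_def pi02_def by blast
  have dec: "dec_in no_oracle k (\<lambda>\<rho>. R [f \<rho>, g \<rho>, h \<rho>])" if R: "computable_rel 3 R"
    and fgh: "rec_in no_oracle k f" "rec_in no_oracle k g" "rec_in no_oracle k h" for R k f g h
  proof -
    have "dec_in no_oracle 3 (\<lambda>\<rho>. R [\<rho> 0, \<rho> 1, \<rho> 2])"
      unfolding rec_in_def
    proof -
      obtain e where e: "\<And>xs. length xs = 3 \<Longrightarrow> eval0 e xs (of_bool (R xs))"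
        using R unfolding computable_rel_def computable_def by blast
      have "[xs ! 0, xs ! 1, xs ! 2] = xs" if "length xs = 3" for xs :: "nat list"
        using that by (auto simp: numeral_eq_Suc length_Suc_conv)
      then show "\<exists>e. \<forall>xs. length xs = 3 \<longrightarrow> eval0 e xs (of_bool (R [xs ! 0, xs ! 1, xs ! 2]))"
        using e by (intro exI[of _ e]) simp
    qed
    from rec_in_comp_list[OF this, of k "\<lambda>i. if i = 0 then f else if i = 1 then g else h"]
    show ?thesis using fgh by (simp add: numeral_eq_Suc)
  qed
  \<comment> \<open>The disjunct \<open>s \<le> a\<close> makes the search total.\<close>
  define w where "w = (\<lambda>s n. LEAST a. s \<le> a \<or> (\<forall>b<s. P [n, a, b]) \<or> (\<forall>b<s. \<not> Q [n, a, b]))"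
  have rec_w: "rec_in no_oracle 2 (\<lambda>\<rho>. w (\<rho> 0) (\<rho> 1))"
    unfolding w_def
    by (rule rec_in_Least)
      (intro dec_in_disj dec_in_le dec_in_Ball dec_in_not dec[OF P(1)] dec[OF Q(1)] rec_in_var, auto)
  define x where "x = (\<lambda>s n. \<forall>b<s. P [n, w s n, b])"
  have "dec_in no_oracle 2 (\<lambda>\<rho>. x (\<rho> 0) (\<rho> 1))"
    unfolding x_def
    by (intro dec_in_Ball dec[OF P(1)] rec_in_var rec_in_shift[OF rec_w]) auto
  moreover have "\<exists>s0. \<forall>s\<ge>s0. x s n = X n" for n
  proof -
    define G where "G a \<longleftrightarrow> (\<forall>b. P [n, a, b]) \<or> (\<forall>b. \<not> Q [n, a, b])" for a
    have exG: "\<exists>a. G a" unfolding G_def using P(2)[of n] Q(2)[of n] by blast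
    define a0 where "a0 = (LEAST a. G a)"
    have a0: "G a0" unfolding a0_def by (rule LeastI_ex[OF exG])
    \<comment> \<open>Finitely many false candidates are all refuted from some common stage
      on.\<close>
    have "\<exists>c. \<forall>a<m. \<not> G a \<longrightarrow> (\<forall>s\<ge>c. \<not> (\<forall>b<s. P [n, a, b]) \<and> \<not> (\<forall>b<s. \<not> Q [n, a, b]))" for m
    proof (induction m)
      case (Suc m)
      then obtain c where c: "\<forall>a<m. \<not> G a \<longrightarrow> (\<forall>s\<ge>c. \<not> (\<forall>b<s. P [n, a, b]) \<and> \<not> (\<forall>b<s. \<not> Q [n, a, b]))"
        by blast
      show ?case
      proof (cases "G m")
        case True
        then show ?thesis using c by (auto simp: less_Suc_eq)
      next
        case False
        then obtain b1 b2 where b: "\<not> P [n, m, b1]" "Q [n, m, b2]" unfolding G_def by blast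
        show ?thesis
        proof (intro exI[of _ "c + Suc b1 + Suc b2"] allI impI)
          fix a s assume a: "a < Suc m" "\<not> G a" and s: "c + Suc b1 + Suc b2 \<le> s"
          then have "b1 < s" "b2 < s" "c \<le> s" by auto
          then show "\<not> (\<forall>b<s. P [n, a, b]) \<and> \<not> (\<forall>b<s. \<not> Q [n, a, b])"
            using a b c by (cases "a = m") (blast, auto simp: less_Suc_eq)
        qed
      qed
    qed simp
    then obtain c where c: "\<And>a s. a < a0 \<Longrightarrow> c \<le> s \<Longrightarrow>
        \<not> (\<forall>b<s. P [n, a, b]) \<and> \<not> (\<forall>b<s. \<not> Q [n, a, b])"
      using not_less_Least unfolding a0_def by metis
    have w: "w s n = a0" if "c + Suc a0 \<le> s" for s
      unfolding w_def
    proof (rule Least_equality)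
      show "s \<le> a0 \<or> (\<forall>b<s. P [n, a0, b]) \<or> (\<forall>b<s. \<not> Q [n, a0, b])"
        using a0 unfolding G_def by blast
      show "a0 \<le> y" if "s \<le> y \<or> (\<forall>b<s. P [n, y, b]) \<or> (\<forall>b<s. \<not> Q [n, y, b])" for y
        using that c[of y s] \<open>c + Suc a0 \<le> s\<close> by (cases "y < a0") auto
    qed
    show ?thesis
    proof (cases "X n")
      case True
      then have "\<forall>b. P [n, a0, b]" using a0 Q(2)[of n] unfolding G_def by blast
      then show ?thesis using w True unfolding x_def by (intro exI[of _ "c + Suc a0"]) simp
    next
      case False
      then obtain b where "\<not> P [n, a0, b]" using P(2)[of n] by blast
      then have "\<not> x s n" if "c + Suc a0 + Suc b \<le> s" for s
        unfolding x_def using w[of s] that by (intro notI) (auto dest: spec[of _ b])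
      then show ?thesis using False by blast
    qed
  qed
  ultimately show ?thesis using that unfolding limit_approx_def by blast
qed

lemma turing_reducible_iff:
  "turing_reducible X Y \<longleftrightarrow> dec_in (\<lambda>k. of_bool (Y k)) 1 (\<lambda>\<rho>. X (\<rho> 0))"
proof -
  have "(\<forall>xs :: nat list. length xs = 1 \<longrightarrow> P xs) \<longleftrightarrow> (\<forall>n. P [n])" for P
    by (auto simp: length_Suc_conv)
  then show ?thesis unfolding turing_reducible_def rec_in_def by simp
qed

lemma turing_reducible_trans: "turing_reducible X Y \<Longrightarrow> turing_reducible Y Z \<Longrightarrow> turing_reducible X Z"
  unfolding turing_reducible_iff by (rule rec_in_oracle_trans)

text \<open>Stage \<open>s\<close> runs the reduction with fuel \<open>s\<close> and oracle
  \<open>y s\<close>. The true computation queries only finitely many bits, so the answer is correct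
  once these have settled and the fuel suffices.\<close>

lemma limit_approx_reducible:
  assumes "limit_approx y Y" "turing_reducible X Y" obtains x where "limit_approx x X"
proof -
  let ?y = "\<lambda>s k. of_bool (y s k) :: nat"
  obtain e where e: "\<And>m. eval (\<lambda>k. of_bool (Y k)) e [m] (of_bool (X m))"
    using assms(2) unfolding turing_reducible_def by blast
  \<comment> \<open>The value 2 stands for the answer 1.\<close>
  define x where "x = (\<lambda>s m. fuel_eval (?y s) s e [m] = 2)"
  have "rec_in no_oracle (Suc 1) (\<lambda>\<rho>. fuel_eval (?y (\<rho> 0)) (\<rho> 0) e (map (\<lambda>i. \<rho> (Suc i)) [0..<1]))"
    using assms(1) unfolding limit_approx_def by (intro rec_in_fuel_eval) auto
  then have "dec_in no_oracle 2 (\<lambda>\<rho>. x (\<rho> 0) (\<rho> 1))"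
    unfolding x_def by (intro dec_in_eq rec_in_const) (simp add: numeral_2_eq_2)
  moreover have "\<exists>s0. \<forall>s\<ge>s0. x s m = X m" for m
  proof -
    obtain u where u: "\<And>B t. u \<le> t \<Longrightarrow> \<forall>i<u. B i = of_bool (Y i) \<Longrightarrow> fuel_eval B t e [m] = Suc (of_bool (X m))"
      using fuel_eval_complete[OF e[of m]] by metis
    obtain s0 where "\<forall>s\<ge>s0. \<forall>i<u. y s i = Y i" using limit_approx_stable[OF assms(1)] by blast
    then have "x s m = X m" if "s \<ge> s0 + u" for s
      using u[of s "?y s"] that unfolding x_def by simp
    then show ?thesis by blast
  qed
  ultimately show ?thesis using that unfolding limit_approx_def by blast
qed

text \<open>The column of \<open>s\<close> is its distance to the largest square below, so that every column is infinite.\<close>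

definition col :: "nat \<Rightarrow> nat" where
  "col s = s - (LEAST r. s < (Suc r)\<^sup>2)\<^sup>2"

text \<open>The root starts at \<open>j\<close>, so that the offset \<open>j\<close> stays below the
  next square; elements of column \<open>j\<close> with smaller roots are not listed.\<close>

definition col_elem :: "nat \<Rightarrow> nat \<Rightarrow> nat" where
  "col_elem j k = (j + k)\<^sup>2 + j"

lemma col_col_elem: "col (col_elem j k) = j"
proof -
  have "(LEAST r. col_elem j k < (Suc r)\<^sup>2) = j + k"
  proof (rule Least_equality)
    show "col_elem j k < (Suc (j + k))\<^sup>2" unfolding col_elem_def by (simp add: power2_eq_square)
    show "j + k \<le> r" if "col_elem j k < (Suc r)\<^sup>2" for r
    proof (rule ccontr)
      assume "\<not> j + k \<le> r"
      then have "(Suc r)\<^sup>2 \<le> (j + k)\<^sup>2" by (intro power_mono) auto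
      then show False using that unfolding col_elem_def by linarith
    qed
  qed
  then show ?thesis unfolding col_def col_elem_def by simp
qed

lemma le_col_elem: "k \<le> col_elem j k"
  unfolding col_elem_def using self_le_power[of "j + k" 2] by (cases "j + k = 0") auto

lemma inj_col_elem: "inj (col_elem j)"
  unfolding col_elem_def inj_on_def by (auto simp: power2_eq_iff)

lemma rec_in_col:
  assumes "rec_in A k f" shows "rec_in A k (\<lambda>\<rho>. col (f \<rho>))"
proof (rule rec_in_comp1[OF _ assms])
  have "rec_in A 1 (\<lambda>\<rho>. LEAST r. \<rho> 0 < (Suc r)\<^sup>2)"
  proof (rule rec_in_Least)
    show "\<exists>r. \<rho> 0 < (Suc r)\<^sup>2" for \<rho> :: "nat \<Rightarrow> nat"
      by (intro exI[of _ "\<rho> 0"]) (simp add: power2_eq_square)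
  qed (intro rec_in_intros; simp)
  then show "rec_in A 1 (\<lambda>\<rho>. col (\<rho> 0))"
    unfolding col_def by (intro rec_in_diff rec_in_power rec_in_var rec_in_const) auto
qed

lemma rec_in_col_elem:
  assumes "rec_in A k f" "rec_in A k g" shows "rec_in A k (\<lambda>\<rho>. col_elem (f \<rho>) (g \<rho>))"
  unfolding col_elem_def by (intro rec_in_add rec_in_power rec_in_const assms)

section \<open>Cantor space and Lebesgue measure\<close>

lemma open_agree: "open {Y. agree n Y X}"
proof -
  have "{Y. agree n Y X} = (\<Pi>\<^sub>E i\<in>UNIV. if i < n then {X i} else UNIV)"
    by (auto simp: agree_def PiE_def Pi_def split: if_splits)
  moreover have "finite {i. (if i < n then {X i} else UNIV) \<noteq> UNIV}"
    by (rule finite_subset[of _ "{..<n}"]) auto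
  moreover have "open {b}" for b :: bool
  proof -
    have "{b} = (if b then {False<..} else {..<True})" by auto
    then show ?thesis by (simp split: if_splits)
  qed
  ultimately show ?thesis by (auto intro!: open_PiE)
qed

lemma open_cantor_iff: "open U \<longleftrightarrow> (\<forall>X\<in>U. \<exists>n. \<forall>Y. agree n Y X \<longrightarrow> Y \<in> U)"
proof
  assume U: "open U"
  show "\<forall>X\<in>U. \<exists>n. \<forall>Y. agree n Y X \<longrightarrow> Y \<in> U"
  proof
    fix X assume "X \<in> U"
    from product_topology_open_contains_basis[OF U[unfolded open_fun_def] this]
    obtain T where T: "X \<in> (\<Pi>\<^sub>E i\<in>UNIV. T i)" "finite {i. T i \<noteq> UNIV}" "(\<Pi>\<^sub>E i\<in>UNIV. T i) \<subseteq> U"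
      by auto
    then obtain n where "\<forall>i\<in>{i. T i \<noteq> UNIV}. i < n" using finite_nat_set_iff_bounded by blast
    then have "Y \<in> (\<Pi>\<^sub>E i\<in>UNIV. T i)" if "agree n Y X" for Y
      using T(1) that by (fastforce simp: agree_def PiE_def Pi_def)
    then show "\<exists>n. \<forall>Y. agree n Y X \<longrightarrow> Y \<in> U" using T(3) by blast
  qed
next
  assume *: "\<forall>X\<in>U. \<exists>n. \<forall>Y. agree n Y X \<longrightarrow> Y \<in> U"
  show "open U"
  proof (subst open_subopen, intro ballI)
    fix X assume "X \<in> U"
    then obtain n where "\<forall>Y. agree n Y X \<longrightarrow> Y \<in> U" using * by blast
    then show "\<exists>T. open T \<and> X \<in> T \<and> T \<subseteq> U"
      by (intro exI[of _ "{Y. agree n Y X}"]) (auto simp: open_agree)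
  qed
qed

lemma isolated_in_cantor_iff:
  "X isolated_in P \<longleftrightarrow> X \<in> P \<and> (\<exists>n. \<forall>Y\<in>P. agree n Y X \<longrightarrow> Y = X)"
proof
  assume iso: "X isolated_in P"
  then obtain T where T: "open T" "T \<inter> P = {X}" "X \<in> P" unfolding isolated_in_def by blast
  then obtain n where "\<forall>Y. agree n Y X \<longrightarrow> Y \<in> T" using open_cantor_iff by blast
  then show "X \<in> P \<and> (\<exists>n. \<forall>Y\<in>P. agree n Y X \<longrightarrow> Y = X)" using T by blast
next
  assume "X \<in> P \<and> (\<exists>n. \<forall>Y\<in>P. agree n Y X \<longrightarrow> Y = X)"
  then obtain n where n: "X \<in> P" "\<forall>Y\<in>P. agree n Y X \<longrightarrow> Y = X" by blast
  then have "{Y. agree n Y X} \<inter> P = {X}" by auto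
  then show "X isolated_in P" unfolding isolated_in_def using n(1) open_agree by blast
qed

lemma compact_cantor: "compact (UNIV :: cantor set)"
proof -
  have "compact_space (euclidean :: bool topology)" by (simp add: compact_space_def finite_imp_compact)
  then have "compact_space (product_topology (\<lambda>_ :: nat. euclidean :: bool topology) UNIV)"
    by (simp add: compact_space_product_topology)
  then show ?thesis by (simp add: euclidean_product_topology compact_space_def)
qed

text \<open>Koenig's lemma as compactness: membership in \<open>{Y. Q n Y}\<close> depends only on
  the first \<open>n\<close> bits, so these sets are closed, and they are nonempty and
  decreasing.\<close>

lemma konig:
  assumes ex: "\<And>n. \<exists>Y. Q n Y" and mono: "\<And>n Y. Q (Suc n) Y \<Longrightarrow> Q n Y"
    and dep: "\<And>n Y Z. agree n Y Z \<Longrightarrow> Q n Z \<Longrightarrow> Q n Y"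
  shows "\<exists>Y :: cantor. \<forall>n. Q n Y"
proof -
  have le: "Q n Y \<Longrightarrow> m \<le> n \<Longrightarrow> Q m Y" for m n Y
    by (induction n) (auto simp: le_Suc_eq dest: mono)
  have "UNIV \<inter> (\<Inter>n\<in>UNIV. {Y. Q n Y}) \<noteq> {}"
  proof (rule compact_imp_fip_image[OF compact_cantor])
    show "closed {Y. Q n Y}" for n
      unfolding closed_def open_cantor_iff by (auto intro!: exI[of _ n] dest: dep[OF agree_sym])
    show "UNIV \<inter> (\<Inter>n\<in>I. {Y. Q n Y}) \<noteq> {}" if "finite I" for I
    proof -
      obtain Y where "Q (Max (insert 0 I)) Y" using ex by blast
      then have "\<forall>n\<in>I. Q n Y" using that le by (meson Max_ge finite_insert insertI2)
      then show ?thesis by blast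
    qed
  qed
  then show ?thesis by blast
qed

section \<open>Lebesgue measure and bit flips\<close>

interpretation lebesgue: prob_space cantor_lebesgue
  using cantor_prob_lebesgue unfolding cantor_prob_def by blast

lemma sets_cantor_lebesgue [measurable_cong]: "sets cantor_lebesgue = sets borel"
  using cantor_prob_lebesgue unfolding cantor_prob_def by blast

lemma space_cantor_lebesgue [simp]: "space cantor_lebesgue = UNIV"
  using sets_eq_imp_space_eq[OF sets_cantor_lebesgue] by simp

lemma open_in_sets: "open U \<Longrightarrow> U \<in> sets cantor_lebesgue"
  unfolding sets_cantor_lebesgue by (rule borel_open)

lemma measure_agree: "measure cantor_lebesgue {Y. agree n Y X} = (1/2) ^ n"
proof -
  interpret product_prob_space "\<lambda>_::nat. measure_pmf (bernoulli_pmf (1/2))" UNIV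
    by unfold_locales
  let ?M = "\<lambda>_::nat. measure_pmf (bernoulli_pmf (1/2))"
  have "{Y. agree n Y X} = {Y \<in> space (PiM UNIV ?M). \<forall>i\<in>{..<n}. Y i \<in> {X i}}"
    unfolding agree_def space_PiM by (simp add: Ball_def)
  then have "emeasure cantor_lebesgue {Y. agree n Y X} = (\<Prod>i<n. emeasure (?M i) {X i})"
    unfolding cantor_lebesgue_def by (simp only:) (rule emeasure_PiM_Collect, auto)
  also have "\<dots> = (\<Prod>i<n. ennreal (1/2))"
    by (intro prod.cong refl) (simp add: emeasure_pmf_single pmf_bernoulli_half)
  also have "\<dots> = ennreal ((1/2) ^ n)" by (simp only: prod_constant card_lessThan ennreal_power)
  finally show ?thesis by (simp add: measure_def)
qed

definition flip :: "nat set \<Rightarrow> cantor \<Rightarrow> cantor" where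
  "flip E Y = (\<lambda>m. Y m \<noteq> (m \<in> E))"

lemma flip_measurable: "flip E \<in> measurable cantor_lebesgue cantor_lebesgue"
  unfolding cantor_lebesgue_def flip_def by (rule measurable_PiM_single') (auto simp: space_PiM)

text \<open>Negation preserves a fair coin, and a product measure is determined by its values on
  boxes with finitely many constrained coordinates.\<close>

lemma distr_flip: "distr cantor_lebesgue cantor_lebesgue (flip E) = cantor_lebesgue"
proof -
  interpret product_prob_space "\<lambda>_::nat. measure_pmf (bernoulli_pmf (1/2))" UNIV
    by unfold_locales
  let ?M = "\<lambda>_::nat. measure_pmf (bernoulli_pmf (1/2))"
  have "distr cantor_lebesgue cantor_lebesgue (flip E) = PiM UNIV ?M"
  proof (rule PiM_eq)
    show "sets (distr cantor_lebesgue cantor_lebesgue (flip E)) = sets (PiM UNIV ?M)"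
      by (simp add: cantor_lebesgue_def)
    fix J :: "nat set" and F :: "nat \<Rightarrow> bool set"
    assume J: "finite J"
    let ?F = "\<lambda>j. {b. (b \<noteq> (j \<in> E)) \<in> F j}"
    have emb: "prod_emb UNIV ?M J (Pi\<^sub>E J F) \<in> sets cantor_lebesgue"
      unfolding cantor_lebesgue_def using J by (intro sets_PiM_I) auto
    have "flip E -` prod_emb UNIV ?M J (Pi\<^sub>E J F) \<inter> space cantor_lebesgue =
        prod_emb UNIV ?M J (Pi\<^sub>E J ?F)"
      by (auto simp: prod_emb_def flip_def PiE_iff)
    then have "emeasure (distr cantor_lebesgue cantor_lebesgue (flip E)) (prod_emb UNIV ?M J (Pi\<^sub>E J F))
        = emeasure (PiM UNIV ?M) (prod_emb UNIV ?M J (Pi\<^sub>E J ?F))"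
      using emeasure_distr[OF flip_measurable emb] by (simp add: cantor_lebesgue_def)
    also have "\<dots> = (\<Prod>j\<in>J. emeasure (?M j) (?F j))"
      using J by (intro emeasure_PiM_emb) auto
    also have "\<dots> = (\<Prod>j\<in>J. emeasure (?M j) (F j))"
    proof (rule prod.cong)
      fix j
      have "map_pmf (\<lambda>b. b \<noteq> (j \<in> E)) (bernoulli_pmf (1/2)) = bernoulli_pmf (1/2)"
      proof -
        have "bij (\<lambda>b. b \<noteq> (j \<in> E))" by (rule bijI') auto
        then have "map_pmf (\<lambda>b. b \<noteq> (j \<in> E)) (pmf_of_set UNIV) = pmf_of_set UNIV"
          by (subst map_pmf_of_set_inj) (auto simp: bij_def)
        then show ?thesis by (simp only: bernoulli_pmf_half_conv_pmf_of_set)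
      qed
      then have "emeasure (measure_pmf (bernoulli_pmf (1/2))) (F j) =
          emeasure (measure_pmf (bernoulli_pmf (1/2))) ((\<lambda>b. b \<noteq> (j \<in> E)) -` F j)"
        using emeasure_map_pmf by metis
      then show "emeasure (?M j) (?F j) = emeasure (?M j) (F j)" by (simp add: vimage_def)
    qed simp
    finally show "emeasure (distr cantor_lebesgue cantor_lebesgue (flip E)) (prod_emb UNIV ?M J (Pi\<^sub>E J F))
        = (\<Prod>j\<in>J. emeasure (?M j) (F j))" .
  qed
  then show ?thesis by (simp add: cantor_lebesgue_def)
qed

lemma measure_flip:
  assumes "U \<in> sets cantor_lebesgue"
  shows "measure cantor_lebesgue (flip E -` U) = measure cantor_lebesgue U"
  using measure_distr[OF flip_measurable assms, of E] by (simp add: distr_flip)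

text \<open>The copies of \<open>U\<close> flipped by the subsets of \<open>E\<close> have equal
  measure, and they are pairwise disjoint because within \<open>U\<close> the values off
  \<open>E\<close> determine those on \<open>E\<close>. There are \<open>2 ^ card E\<close> of
  them.\<close>

lemma measure_section_bound:
  assumes U: "U \<in> sets cantor_lebesgue" and E: "finite E"
    and sec: "\<And>Y Z. Y \<in> U \<Longrightarrow> Z \<in> U \<Longrightarrow> (\<And>m. m \<notin> E \<Longrightarrow> Y m = Z m) \<Longrightarrow> (\<And>m. m \<in> E \<Longrightarrow> Y m = Z m)"
  shows "measure cantor_lebesgue U \<le> (1/2) ^ card E"
proof -
  let ?A = "\<lambda>F. flip F -` U"
  have meas: "?A F \<in> sets cantor_lebesgue" for F
    using measurable_sets[OF flip_measurable U, of F] by simp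
  have disj: "disjoint_family_on ?A (Pow E)"
  proof -
    have "F = G" if "F \<subseteq> E" "G \<subseteq> E" "flip F Y \<in> U" "flip G Y \<in> U" for F G Y
    proof (rule set_eqI)
      fix m
      have "m \<in> E \<Longrightarrow> flip F Y m = flip G Y m"
        by (rule sec[OF that(3,4)]) (use that in \<open>auto simp: flip_def\<close>)
      then show "m \<in> F \<longleftrightarrow> m \<in> G" using that by (auto simp: flip_def)
    qed
    then show ?thesis unfolding disjoint_family_on_def by auto
  qed
  have "2 ^ card E * measure cantor_lebesgue U = (\<Sum>F\<in>Pow E. measure cantor_lebesgue (?A F))"
    using E by (simp add: measure_flip[OF U] card_Pow)
  also have "\<dots> = measure cantor_lebesgue (\<Union>F\<in>Pow E. ?A F)"
    by (rule lebesgue.finite_measure_finite_Union[symmetric]) (use E meas disj in auto)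
  also have "\<dots> \<le> 1" by simp
  finally show ?thesis by (simp add: field_simps power_divide)
qed

text \<open>
  A form of van Lambalgen's theorem: were \<open>X\<close> the only element of \<open>G\<close> with its values off
  \<open>C\<close>, then these values would determine \<open>X\<close> on \<open>C\<close> effectively, and the sets \<open>V i\<close> of
  sequences whose first \<open>i\<close> values on \<open>C\<close> are so determined would form a test.
\<close>

lemma random_section:
  assumes X: "ml_random cantor_lebesgue X" and G: "pi01_class G" "X \<in> G"
    and C: "dec_in no_oracle 1 (\<lambda>\<rho>. C (\<rho> 0))"
    and e: "rec_in no_oracle 1 (\<lambda>\<rho>. e (\<rho> 0))" "inj e" "\<And>k. C (e k)"
  obtains B where "B \<in> G" "B \<noteq> X" "\<And>m. \<not> C m \<Longrightarrow> B m = X m"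
proof -
  obtain W where W: "ce_rel 1 W" "G = - (\<Union>s \<in> {s. W [code s]}. cylinder s)"
    using G(1) unfolding pi01_class_def by blast
  obtain D where D: "dec_in no_oracle 2 (\<lambda>\<rho>. D (\<rho> 0) (\<rho> 1))"
    "\<And>t t' z. t \<le> t' \<Longrightarrow> D t z \<Longrightarrow> D t' z" "\<And>z. W [z] \<longleftrightarrow> (\<exists>t. D t z)"
    using ce_rel_stages[OF W(1)] by blast
  \<comment> \<open>By stage \<open>t\<close> some prefix of \<open>Y\<close> of length at most
    \<open>t\<close> is seen to leave \<open>G\<close>. Only the first \<open>t\<close> bits of
    \<open>Y\<close> are read.\<close>
  define killed where "killed t Y \<longleftrightarrow> (\<exists>q<Suc t. D t (prefix_code Y q))" for t Y
  have killed_mono: "killed t' Y" if "killed t Y" "t \<le> t'" for t t' Y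
    using that D(2)[of t t'] unfolding killed_def by (meson Suc_le_mono less_le_trans)
  have killed_cong: "killed t Y \<longleftrightarrow> killed t Z" if "agree t Y Z" for t Y Z
    using that unfolding killed_def by (metis agree_mono less_Suc_eq_le prefix_code_cong)
  have G_iff: "Y \<in> G \<longleftrightarrow> (\<forall>t. \<not> killed t Y)" for Y
  proof -
    have "Y \<in> G \<longleftrightarrow> \<not> (\<exists>q t. D t (prefix_code Y q))"
      unfolding W(2) Compl_iff Union_cylinders[of Y "\<lambda>z. W [z]"] by (simp only: D(3))
    also have "(\<exists>q t. D t (prefix_code Y q)) \<longleftrightarrow> (\<exists>t. killed t Y)"
    proof
      assume "\<exists>q t. D t (prefix_code Y q)"
      then obtain q t where "D t (prefix_code Y q)" by blast
      then have "D (max t q) (prefix_code Y q)" by (rule D(2)[rotated]) simp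
      then have "killed (max t q) Y" unfolding killed_def by (intro exI[of _ q]) simp
      then show "\<exists>t. killed t Y" by blast
    qed (auto simp: killed_def)
    finally show ?thesis by blast
  qed
  \<comment> \<open>At stage \<open>t\<close> the bits of \<open>Y\<close> off \<open>C\<close>
    below \<open>t\<close> force its values at the first \<open>i\<close> points \<open>e k\<close>.
    The numbers below \<open>2 ^ Suc t\<close> include the codes of all strings of length
    \<open>t\<close>; the others give further sequences subject to the same test of \<open>t\<close>
    bits.\<close>
  define good where "good i t Y \<longleftrightarrow> (\<forall>k<i. e k < t) \<and> \<not> killed t Y \<and>
    (\<forall>z<2 ^ Suc t. \<not> killed t (code_bit z) \<and> (\<forall>m<t. \<not> C m \<longrightarrow> code_bit z m = Y m) \<longrightarrow>
      (\<forall>k<i. code_bit z (e k) = Y (e k)))" for i t Y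
  have goodD: "Z (e k) = Y (e k)"
    if "good i t Y" "\<not> killed t Z" "\<And>m. m < t \<Longrightarrow> \<not> C m \<Longrightarrow> Z m = Y m" "k < i" for i t Y Z k
  proof -
    have ag: "agree t (code_bit (prefix_code Z t)) Z" by (rule agree_code_bit_prefix_code)
    then have "\<not> killed t (code_bit (prefix_code Z t))" using killed_cong that(2) by blast
    moreover have "\<forall>m<t. \<not> C m \<longrightarrow> code_bit (prefix_code Z t) m = Y m" using ag that(3) by (simp add: agree_def)
    ultimately have "code_bit (prefix_code Z t) (e k) = Y (e k)"
      using that(1,4) prefix_code_less[of Z t] unfolding good_def by blast
    moreover have "e k < t" using that(1,4) unfolding good_def by blast
    ultimately show ?thesis using ag by (simp add: agree_def)
  qed
  have good_cong: "good i t Z" if "good i t Y" "agree t Z Y" for i t Y Z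
    using that killed_cong[OF that(2)] unfolding good_def agree_def by simp
  define V where "V = (\<lambda>i. {Y. \<exists>t. good i t Y})"
  have unif: "uniformly_sigma01 V"
  proof -
    define T where "T xs \<longleftrightarrow> good (xs ! 0) (code_length (xs ! 1)) (code_bit (xs ! 1))" for xs :: "nat list"
    note [simp del] = One_nat_def
    have "dec_in no_oracle 2 (\<lambda>\<rho>. good (\<rho> 0) (code_length (\<rho> 1)) (code_bit (\<rho> 1)))"
      unfolding good_def killed_def
      by (intro dec_in_conj dec_in_Ball dec_in_Bex dec_in_not dec_in_imp dec_in_iff dec_in_less
          rec_in_comp1[OF C] rec_in_comp1[OF e(1)] rec_in_comp2[OF D(1)] rec_in_code_length rec_in_prefix_code
          dec_in_code_bit rec_in_power rec_in_Suc rec_in_const rec_in_var) (simp_all add: numeral_2_eq_2)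
    then have "ce_rel 2 T" unfolding T_def using ce_rel_dec by force
    moreover have "Y \<in> V i \<longleftrightarrow> Y \<in> (\<Union>s \<in> {s. T [i, code s]}. cylinder s)" for i Y
    proof -
      have "good i t Y \<longleftrightarrow> good i t (code_bit (prefix_code Y t))" for t
        using good_cong agree_code_bit_prefix_code agree_sym by metis
      then show ?thesis
        using Union_cylinders[of Y "\<lambda>z. T [i, z]"] by (simp add: V_def T_def code_length_prefix_code One_nat_def)
    qed
    ultimately show ?thesis unfolding uniformly_sigma01_def by blast
  qed
  have "measure cantor_lebesgue (V i) \<le> (1/2) ^ i" for i
  proof -
    have "open (V i)"
      unfolding open_cantor_iff V_def using good_cong by blast
    moreover have "Y m = Z m" if YZ: "Y \<in> V i" "Z \<in> V i" "\<And>m. m \<notin> e ` {..<i} \<Longrightarrow> Y m = Z m"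
      and m: "m \<in> e ` {..<i}" for Y Z m
    proof -
      \<comment> \<open>The sequence that is good at the earlier stage forces the other one, which
        is alive at the later stage and hence also at the earlier one.\<close>
      have *: "Z (e k) = Y (e k)" if "good i t Y" "good i t' Z" "t \<le> t'" "k < i"
        "\<And>m. m \<notin> e ` {..<i} \<Longrightarrow> Y m = Z m" for t t' Y Z k
      proof (rule goodD[OF that(1) _ _ that(4)])
        show "\<not> killed t Z" using that(2,3) killed_mono unfolding good_def by blast
        show "Z m = Y m" if "\<not> C m" for m
          using that e(3) \<open>\<And>m. m \<notin> e ` {..<i} \<Longrightarrow> Y m = Z m\<close>[of m] by auto
      qed
      obtain t t' where t: "good i t Y" "good i t' Z" using YZ unfolding V_def by blast
      obtain k where k: "m = e k" "k < i" using m by blast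
      show ?thesis
      proof (cases "t \<le> t'")
        case True
        then show ?thesis using *[OF t True k(2)] YZ(3) k(1) by simp
      next
        case False
        then have "t' \<le> t" by simp
        then show ?thesis using *[OF t(2,1) _ k(2)] YZ(3) k(1) by simp
      qed
    qed
    ultimately have "measure cantor_lebesgue (V i) \<le> (1/2) ^ card (e ` {..<i})"
      by (intro measure_section_bound open_in_sets) auto
    then show ?thesis using e(2) by (simp add: card_image inj_on_subset)
  qed
  then have "ml_test cantor_lebesgue V" using unif unfolding ml_test_def by blast
  \<comment> \<open>Randomness yields an \<open>i\<close> for which the bits of \<open>X\<close> off
    \<open>C\<close> never force its first \<open>i\<close> values along \<open>e\<close>.\<close>
  then obtain i where i: "X \<notin> V i" using X unfolding ml_random_def by blast
  \<comment> \<open>From stage \<open>N\<close> on all \<open>e k\<close> with \<open>k < i\<close>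
    lie below the stage. So the failure of \<open>good\<close> gives a competitor that differs from
    \<open>X\<close> at some such \<open>e k\<close>, and this difference is visible in the first
    \<open>t\<close> bits, as \<open>konig\<close> demands.\<close>
  define N where "N = (\<Sum>k<i. Suc (e k))"
  have N: "e k < N" if "k < i" for k
    using member_le_sum[of k "{..<i}" "\<lambda>k. Suc (e k)"] that unfolding N_def by auto
  have "\<exists>B. \<forall>t. \<not> killed t B \<and> (\<forall>m<t. \<not> C m \<longrightarrow> B m = X m) \<and> (N \<le> t \<longrightarrow> (\<exists>k<i. B (e k) \<noteq> X (e k)))"
  proof (rule konig)
    fix t
    show "\<exists>Y. \<not> killed t Y \<and> (\<forall>m<t. \<not> C m \<longrightarrow> Y m = X m) \<and> (N \<le> t \<longrightarrow> (\<exists>k<i. Y (e k) \<noteq> X (e k)))"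
    proof (cases "N \<le> t")
      case True
      have "\<not> good i t X" using i unfolding V_def by blast
      moreover have "\<forall>k<i. e k < t" using N True less_le_trans by blast
      moreover have "\<not> killed t X" using G(2) G_iff by blast
      ultimately obtain z where "\<not> killed t (code_bit z)" "\<forall>m<t. \<not> C m \<longrightarrow> code_bit z m = X m"
        "\<not> (\<forall>k<i. code_bit z (e k) = X (e k))"
        unfolding good_def by blast
      then show ?thesis by blast
    next
      case False
      then show ?thesis using G(2) G_iff by blast
    qed
  next
    fix t Y
    assume "\<not> killed (Suc t) Y \<and> (\<forall>m<Suc t. \<not> C m \<longrightarrow> Y m = X m) \<and>
      (N \<le> Suc t \<longrightarrow> (\<exists>k<i. Y (e k) \<noteq> X (e k)))"
    then show "\<not> killed t Y \<and> (\<forall>m<t. \<not> C m \<longrightarrow> Y m = X m) \<and> (N \<le> t \<longrightarrow> (\<exists>k<i. Y (e k) \<noteq> X (e k)))"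
      using killed_mono[of t Y "Suc t"] by auto
  next
    fix t Y Z
    assume ag: "agree t Y Z" and Z: "\<not> killed t Z \<and> (\<forall>m<t. \<not> C m \<longrightarrow> Z m = X m) \<and>
      (N \<le> t \<longrightarrow> (\<exists>k<i. Z (e k) \<noteq> X (e k)))"
    have "Y (e k) = Z (e k)" if "k < i" "N \<le> t" for k
      using ag N[OF that(1)] that(2) by (simp add: agree_def)
    then show "\<not> killed t Y \<and> (\<forall>m<t. \<not> C m \<longrightarrow> Y m = X m) \<and> (N \<le> t \<longrightarrow> (\<exists>k<i. Y (e k) \<noteq> X (e k)))"
      using Z ag killed_cong[OF ag] by (auto simp: agree_def)
  qed
  then obtain B where B: "\<And>t. \<not> killed t B" "\<And>t m. m < t \<Longrightarrow> \<not> C m \<Longrightarrow> B m = X m"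
    "\<And>t. N \<le> t \<Longrightarrow> \<exists>k<i. B (e k) \<noteq> X (e k)"
    by blast
  show ?thesis
  proof (rule that)
    show "B \<in> G" using B(1) G_iff by blast
    show "B \<noteq> X" using B(3) by auto
    show "B m = X m" if "\<not> C m" for m using B(2) that by blast
  qed
qed

section \<open>Pushforwards of Lebesgue measure\<close>

text \<open>Lipschitz continuity with constant 1 in the usual metric: preimages of cylinders are
  unions of cylinders of the same length.\<close>

definition causal :: "(cantor \<Rightarrow> cantor) \<Rightarrow> bool" where
  "causal F \<longleftrightarrow> (\<forall>n Y Z. agree n Y Z \<longrightarrow> agree n (F Y) (F Z))"

text \<open>The junk that \<open>code_bit\<close> returns beyond a coded string cannot influence the
  output up to the length of the string, by causality.\<close>

definition computable_map :: "(cantor \<Rightarrow> cantor) \<Rightarrow> bool" where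
  "computable_map F \<longleftrightarrow> causal F \<and> rec_in no_oracle 2 (\<lambda>\<rho>. prefix_code (F (code_bit (\<rho> 0))) (\<rho> 1))"

lemma causal_prefix_code: "causal F \<Longrightarrow> prefix_code (F (code_bit (prefix_code Y n))) n = prefix_code (F Y) n"
  unfolding causal_def by (intro prefix_code_cong) (blast intro: agree_code_bit_prefix_code)

lemma computable_map_causal: "computable_map F \<Longrightarrow> causal F"
  by (simp add: computable_map_def)

lemma rec_in_computable_map:
  assumes "computable_map F" "rec_in no_oracle k z" "rec_in no_oracle k n"
  shows "rec_in no_oracle k (\<lambda>\<rho>. prefix_code (F (code_bit (z \<rho>))) (n \<rho>))"
  by (rule rec_in_comp2[OF _ assms(2,3)]) (use assms(1) in \<open>simp add: computable_map_def\<close>)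

lemma continuous_causal:
  assumes "causal F" shows "continuous_on UNIV F"
proof (subst continuous_on_open_vimage[OF open_UNIV], intro allI impI)
  fix U :: "cantor set" assume "open U"
  then show "open (F -` U \<inter> UNIV)"
    using assms unfolding open_cantor_iff causal_def by (metis Int_UNIV_right vimage_eq)
qed

text \<open>Whether a prefix of \<open>F Y\<close> is enumerated into the complement of
  \<open>Q\<close> can be read from the prefix of \<open>Y\<close> of the same length.\<close>

lemma pi01_class_vimage:
  assumes F: "computable_map F" and Q: "pi01_class Q" shows "pi01_class (F -` Q)"
proof -
  obtain W where W: "ce_rel 1 W" "Q = - (\<Union>s \<in> {s. W [code s]}. cylinder s)"
    using Q unfolding pi01_class_def by blast
  define T where "T xs \<longleftrightarrow> W [prefix_code (F (code_bit (xs ! 0))) (code_length (xs ! 0))]" for xs :: "nat list"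
  have "rec_in no_oracle 1 (\<lambda>\<rho>. prefix_code (F (code_bit (\<rho> 0))) (code_length (\<rho> 0)))"
    by (intro rec_in_computable_map F rec_in_code_length rec_in_var) simp_all
  then have "ce_rel 1 T"
    using ce_rel_subst[OF W(1), of 1 "\<lambda>_ \<rho>. prefix_code (F (code_bit (\<rho> 0))) (code_length (\<rho> 0))"]
    unfolding T_def by simp
  moreover have "Y \<in> F -` Q \<longleftrightarrow> Y \<in> - (\<Union>s \<in> {s. T [code s]}. cylinder s)" for Y
    unfolding W(2) vimage_eq Compl_iff Union_cylinders[of _ "\<lambda>z. W [z]"]
      Union_cylinders[of _ "\<lambda>z. T [z]"]
    using F by (simp add: T_def code_length_prefix_code causal_prefix_code computable_map_def)
  ultimately show ?thesis unfolding pi01_class_def by blast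
qed

lemma uniformly_sigma01_vimage:
  assumes F: "computable_map F" and U: "uniformly_sigma01 U"
  shows "uniformly_sigma01 (\<lambda>i. F -` U i)"
proof -
  obtain W where W: "ce_rel 2 W" "\<And>i. U i = (\<Union>s \<in> {s. W [i, code s]}. cylinder s)"
    using U unfolding uniformly_sigma01_def by blast
  define T where "T xs \<longleftrightarrow> W [xs ! 0, prefix_code (F (code_bit (xs ! 1))) (code_length (xs ! 1))]" for xs :: "nat list"
  have "rec_in no_oracle 2 (\<lambda>\<rho>. prefix_code (F (code_bit (\<rho> 1))) (code_length (\<rho> 1)))"
    by (intro rec_in_computable_map F rec_in_code_length rec_in_var) simp_all
  then have "rec_in no_oracle 2 (\<lambda>\<rho>. if i = 0 then \<rho> 0 else prefix_code (F (code_bit (\<rho> 1))) (code_length (\<rho> 1)))" for i :: nat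
    by (cases "i = 0") (simp_all add: rec_in_var)
  from ce_rel_subst[where G = "\<lambda>i \<rho>. if i = 0 then \<rho> 0 else prefix_code (F (code_bit (\<rho> 1))) (code_length (\<rho> 1))",
      OF W(1) this]
  have "ce_rel 2 T" unfolding T_def by (simp add: upt_rec numeral_2_eq_2)
  moreover have "Y \<in> F -` U i \<longleftrightarrow> Y \<in> (\<Union>s \<in> {s. T [i, code s]}. cylinder s)" for Y i
    unfolding W(2) vimage_eq Union_cylinders[of _ "\<lambda>z. W [i, z]"]
      Union_cylinders[of _ "\<lambda>z. T [i, z]"]
    using F by (simp add: T_def code_length_prefix_code causal_prefix_code computable_map_def)
  ultimately show ?thesis unfolding uniformly_sigma01_def by blast
qed

definition pushforward :: "(cantor \<Rightarrow> cantor) \<Rightarrow> cantor measure" where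
  "pushforward F = distr cantor_lebesgue borel F"

lemma measurable_causal: "causal F \<Longrightarrow> F \<in> borel_measurable cantor_lebesgue"
  unfolding measurable_cong_sets[OF sets_cantor_lebesgue refl]
  by (intro borel_measurable_continuous_onI continuous_causal)

lemma cantor_prob_pushforward: "causal F \<Longrightarrow> cantor_prob (pushforward F)"
  unfolding cantor_prob_def pushforward_def
  by (auto intro: lebesgue.prob_space_distr measurable_causal)

lemma measure_pushforward:
  assumes "causal F" "U \<in> sets borel"
  shows "measure (pushforward F) U = measure cantor_lebesgue (F -` U)"
  unfolding pushforward_def using measure_distr[OF measurable_causal[OF assms(1)] assms(2)] by simp

lemma open_cylinder: "open (cylinder s)"
  using open_agree[of "length s" "\<lambda>i. s ! i"] by (metis cylinder_prefix prefix_of_nth)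

lemma uniformly_sigma01_open: "uniformly_sigma01 U \<Longrightarrow> open (U i)"
  unfolding uniformly_sigma01_def by (metis (mono_tags, lifting) open_UN open_cylinder)

text \<open>Preservation of randomness: preimages turn a test for the image measure that captures
  \<open>F X\<close> into a Lebesgue test with the same bounds that captures
  \<open>X\<close>.\<close>

lemma ml_random_pushforward:
  assumes F: "computable_map F" and X: "ml_random cantor_lebesgue X"
  shows "ml_random (pushforward F) (F X)"
  unfolding ml_random_def
proof (intro allI impI)
  fix U assume U: "ml_test (pushforward F) U"
  then have unif: "uniformly_sigma01 U" unfolding ml_test_def by blast
  have "measure (pushforward F) (U i) = measure cantor_lebesgue (F -` U i)" for i
    by (intro measure_pushforward computable_map_causal F borel_open uniformly_sigma01_open unif)
  then have "ml_test cantor_lebesgue (\<lambda>i. F -` U i)"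
    using U uniformly_sigma01_vimage[OF F unif] unfolding ml_test_def by simp
  then show "F X \<notin> (\<Inter>i. U i)" using X unfolding ml_random_def by auto
qed

lemma in_cylinder_iff_prefix_code: "X \<in> cylinder s \<longleftrightarrow> prefix_code X (length s) = code s"
proof
  assume "X \<in> cylinder s"
  then have "prefix_of X (length s) = s" by (simp add: cylinder_def)
  then show "prefix_code X (length s) = code s" using code_prefix_of[of X "length s"] by simp
next
  assume eq: "prefix_code X (length s) = code s"
  have "prefix_of X (length s) = s"
    by (intro nth_equalityI) (auto simp: eq code_bit_code simp flip: code_bit_prefix_code[of _ "length s" X])
  then show "X \<in> cylinder s" by (simp add: cylinder_def)
qed

definition fiber_count :: "(cantor \<Rightarrow> cantor) \<Rightarrow> nat \<Rightarrow> nat" where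
  \<comment> \<open>The first conjunct selects the codes of strings of the right length.\<close>
  "fiber_count F z = (\<Sum>w<2 ^ Suc (code_length z).
    of_bool (prefix_code (code_bit w) (code_length z) = w \<and> prefix_code (F (code_bit w)) (code_length z) = z))"

text \<open>By causality the preimage of the cylinder is a disjoint union of cylinders of the same
  length, and \<open>fiber_count\<close> counts them.\<close>

lemma measure_pushforward_cylinder:
  assumes F: "causal F"
  shows "measure (pushforward F) (cylinder s) = fiber_count F (code s) / 2 ^ length s"
proof -
  let ?n = "length s"
  define K where "K = {w. w < 2 ^ Suc ?n \<and> prefix_code (code_bit w) ?n = w \<and> prefix_code (F (code_bit w)) ?n = code s}"
  have fin: "finite K" unfolding K_def by simp
  note in_cyl = in_cylinder_iff_prefix_code[of _ s]
  have vim: "F -` cylinder s = (\<Union>w\<in>K. {Y. agree ?n Y (code_bit w)})"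
  proof (rule set_eqI)
    fix Y
    have "F Y \<in> cylinder s" if "agree ?n Y (code_bit w)" "w \<in> K" for w
      using that F prefix_code_cong unfolding in_cyl K_def causal_def by (metis (mono_tags, lifting) mem_Collect_eq)
    moreover have "agree ?n Y (code_bit (prefix_code Y ?n))" by (rule agree_sym[OF agree_code_bit_prefix_code])
    moreover have "prefix_code Y ?n \<in> K" if "F Y \<in> cylinder s"
      using that prefix_code_less causal_prefix_code[OF F] prefix_code_cong[OF agree_code_bit_prefix_code]
      unfolding in_cyl K_def by simp
    ultimately show "Y \<in> F -` cylinder s \<longleftrightarrow> Y \<in> (\<Union>w\<in>K. {Y. agree ?n Y (code_bit w)})"
      by blast
  qed
  have disj: "disjoint_family_on (\<lambda>w. {Y. agree ?n Y (code_bit w)}) K"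
    unfolding disjoint_family_on_def K_def
    by (auto simp: set_eq_iff) (metis prefix_code_cong)
  have "measure (pushforward F) (cylinder s) = measure cantor_lebesgue (F -` cylinder s)"
    by (rule measure_pushforward[OF F borel_open[OF open_cylinder]])
  also have "\<dots> = (\<Sum>w\<in>K. measure cantor_lebesgue {Y. agree ?n Y (code_bit w)})"
    unfolding vim
    by (rule lebesgue.finite_measure_finite_Union[OF fin _ disj]) (auto intro: open_in_sets open_agree)
  also have "\<dots> = card K / 2 ^ ?n"
    by (simp add: measure_agree power_divide)
  also have "card K = fiber_count F (code s)"
  proof -
    have "fiber_count F (code s) = card ({..<2 ^ Suc ?n} \<inter>
        {w. prefix_code (code_bit w) ?n = w \<and> prefix_code (F (code_bit w)) ?n = code s})"
      unfolding fiber_count_def code_length_code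
      by (simp add: of_bool_def sum.If_cases del: power_Suc)
    also have "{..<2 ^ Suc ?n} \<inter> {w. prefix_code (code_bit w) ?n = w \<and> prefix_code (F (code_bit w)) ?n = code s} = K"
      unfolding K_def by auto
    finally show ?thesis by simp
  qed
  finally show ?thesis .
qed

lemma computable_measure_pushforward:
  assumes F: "computable_map F" shows "computable_measure (pushforward F)"
proof -
  have c: "causal F" by (rule computable_map_causal[OF F])
  have comp: "computable k (\<lambda>xs. f ((!) xs))" if "rec_in no_oracle k f" for k f
    using that unfolding rec_in_def computable_def by blast
  have "rec_in no_oracle 2 (\<lambda>\<rho>. fiber_count F (\<rho> 0))"
    unfolding fiber_count_def
    by (intro rec_in_sum dec_in_conj dec_in_eq rec_in_prefix_code dec_in_code_bit rec_in_computable_map[OF F]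
        rec_in_code_length rec_in_power rec_in_const rec_in_Suc rec_in_var) simp_all
  note p = comp[OF this]
  \<comment> \<open>Computable reals are given with 1 added to the denominator, hence the
    subtraction. The dyadic values obtained are exact at every precision.\<close>
  have "rec_in no_oracle 2 (\<lambda>\<rho>. 2 ^ code_length (\<rho> 0) - 1)"
    by (intro rec_in_diff rec_in_code_length rec_in_power rec_in_const rec_in_var) simp
  note r = comp[OF this]
  have "real (2 ^ code_length (code s) - 1) + 1 = 2 ^ length s" for s
    unfolding code_length_code by (simp add: of_nat_diff)
  then show ?thesis
    unfolding computable_measure_def computable_real_fun_def measure_pushforward_cylinder[OF c]
    using p comp[OF rec_in_const[of no_oracle 2 0]] r
    by (intro exI[of _ "\<lambda>xs. fiber_count F (xs ! 0)"] exI[of _ "\<lambda>xs. 0"]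
        exI[of _ "\<lambda>xs. 2 ^ code_length (xs ! 0) - 1"]) simp
qed

section \<open>Range and support of the image measure\<close>

lemma in_range_causal:
  assumes "causal F" shows "X \<in> range F \<longleftrightarrow> (\<forall>n. \<exists>Y. agree n (F Y) X)"
proof
  assume "\<forall>n. \<exists>Y. agree n (F Y) X"
  \<comment> \<open>Compactness: agreement of \<open>F Y\<close> with \<open>X\<close> up to
    \<open>n\<close> depends only on the first \<open>n\<close> bits of \<open>Y\<close>.\<close>
  then have "\<exists>Y. \<forall>n. agree n (F Y) X"
  proof (intro konig)
    show "agree n (F Y) X" if "agree (Suc n) (F Y) X" for n Y
      using that by (rule agree_mono[rotated]) simp
    show "agree n (F Y) X" if "agree n Y Z" "agree n (F Z) X" for n Y Z
      using assms that agree_trans unfolding causal_def by blast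
  qed blast
  then obtain Y where "\<forall>n. agree n (F Y) X" by blast
  then have "F Y = X" unfolding agree_def by auto
  then show "X \<in> range F" by blast
qed (auto intro: agree_refl)

text \<open>A cylinder that meets the range has a nonempty open preimage, which has positive
  Lebesgue measure; and a sequence all of whose cylinders meet the range lies in it by
  compactness.\<close>

lemma support_pushforward:
  assumes F: "causal F" shows "support (pushforward F) = range F"
proof (rule set_eqI)
  fix X
  have "measure (pushforward F) (cylinder (prefix_of X n)) > 0 \<longleftrightarrow> (\<exists>Y. agree n (F Y) X)" for n
  proof -
    have eq: "measure (pushforward F) (cylinder (prefix_of X n)) =
        measure cantor_lebesgue {Y. agree n (F Y) X}"
      unfolding cylinder_prefix using measure_pushforward[OF F borel_open[OF open_agree]]
      by (simp add: vimage_def)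
    have "measure cantor_lebesgue {Y. agree n (F Y) X} > 0" if Y: "agree n (F Y) X" for Y
    proof -
      have "{Z. agree n Z Y} \<subseteq> {Z. agree n (F Z) X}"
        using F Y agree_trans unfolding causal_def by blast
      moreover have "open {Z. agree n (F Z) X}"
        unfolding open_cantor_iff using F agree_trans unfolding causal_def by blast
      ultimately have "measure cantor_lebesgue {Z. agree n Z Y} \<le> measure cantor_lebesgue {Z. agree n (F Z) X}"
        by (intro lebesgue.finite_measure_mono open_in_sets)
      then show ?thesis unfolding measure_agree by (meson less_le_trans zero_less_power half_gt_zero_iff zero_less_one)
    qed
    moreover have "\<exists>Y. agree n (F Y) X" if "measure cantor_lebesgue {Y. agree n (F Y) X} > 0"
    proof (rule ccontr)
      assume "\<not> ?thesis"
      then have "{Y. agree n (F Y) X} = {}" by blast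
      then show False using that by simp
    qed
    ultimately show ?thesis unfolding eq by blast
  qed
  then show "X \<in> support (pushforward F) \<longleftrightarrow> X \<in> range F"
    unfolding support_def in_range_causal[OF F] by simp
qed

text \<open>A string is excluded exactly when none of the finitely many strings of its length is
  mapped to it, which is decidable.\<close>

lemma pi01_class_range:
  assumes F: "computable_map F" shows "pi01_class (range F)"
proof -
  have c: "causal F" by (rule computable_map_causal[OF F])
  define T where "T xs \<longleftrightarrow> (\<forall>w<2 ^ Suc (code_length (xs ! 0)). prefix_code (F (code_bit w)) (code_length (xs ! 0)) \<noteq>
    prefix_code (code_bit (xs ! 0)) (code_length (xs ! 0)))" for xs :: "nat list"
  have "dec_in no_oracle 1 (\<lambda>\<rho>. \<forall>w<2 ^ Suc (code_length (\<rho> 0)). prefix_code (F (code_bit w)) (code_length (\<rho> 0)) \<noteq>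
    prefix_code (code_bit (\<rho> 0)) (code_length (\<rho> 0)))"
    by (intro dec_in_Ball dec_in_not dec_in_eq rec_in_prefix_code dec_in_code_bit rec_in_computable_map[OF F]
        rec_in_code_length rec_in_power rec_in_const rec_in_Suc rec_in_var) simp_all
  then have "ce_rel 1 T" unfolding T_def using ce_rel_dec by force
  moreover have "X \<in> range F \<longleftrightarrow> X \<in> - (\<Union>s \<in> {s. T [code s]}. cylinder s)" for X
  proof -
    have "T [prefix_code X n] \<longleftrightarrow> \<not> (\<exists>Y. agree n (F Y) X)" for n
    proof -
      have "prefix_code (code_bit (prefix_code X n)) n = prefix_code X n" by (rule prefix_code_cong[OF agree_code_bit_prefix_code])
      then have T: "T [prefix_code X n] \<longleftrightarrow> (\<forall>w<2 ^ Suc n. \<not> agree n (F (code_bit w)) X)"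
        unfolding T_def by (simp add: code_length_prefix_code flip: prefix_code_eq_iff)
      moreover have "agree n (F (code_bit (prefix_code Y n))) X" if "agree n (F Y) X" for Y
        using that causal_prefix_code[OF c] prefix_code_eq_iff by metis
      ultimately show ?thesis using prefix_code_less by blast
    qed
    then show ?thesis
      unfolding Compl_iff Union_cylinders[of _ "\<lambda>z. T [z]"] in_range_causal[OF c] by simp
  qed
  ultimately show ?thesis unfolding pi01_class_def by blast
qed

lemma countably_supported_pushforward:
  assumes F: "causal F" and count: "countable (range F)" shows "countably_supported (pushforward F)"
proof -
  have "open (- range F)"
    unfolding open_cantor_iff
  proof
    fix X assume "X \<in> - range F"
    then obtain n where "\<not> (\<exists>Y. agree n (F Y) X)" using in_range_causal[OF F] by blast
    then have "Y \<in> - range F" if "agree n Y X" for Y using that by auto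
    then show "\<exists>n. \<forall>Y. agree n Y X \<longrightarrow> Y \<in> - range F" by blast
  qed
  then have "range F \<in> sets borel" by (intro borel_closed) (simp add: closed_def)
  moreover have "F -` range F = space cantor_lebesgue" by auto
  ultimately have "measure (pushforward F) (range F) = 1"
    using measure_pushforward[OF F] lebesgue.prob_space by simp
  moreover have "range (from_nat_into (range F)) = range F"
    using count by (intro range_from_nat_into) auto
  ultimately show ?thesis unfolding countably_supported_def by metis
qed

section \<open>The coding\<close>

text \<open>One more than the position of the last hit in column \<open>i\<close> before stage
  \<open>s\<close>, and 0 if there is none; so \<open>m < last_hit Z i s\<close> includes the
  position of that hit.\<close>

primrec last_hit :: "cantor \<Rightarrow> nat \<Rightarrow> nat \<Rightarrow> nat" where
  "last_hit Z i 0 = 0"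
| "last_hit Z i (Suc s) = (if col s = i \<and> Z s then Suc s else last_hit Z i s)"

lemma last_hit_le: "last_hit Z i s \<le> s"
  by (induction s) auto

lemma last_hit_mono: "s \<le> t \<Longrightarrow> last_hit Z i s \<le> last_hit Z i t"
proof (induction t)
  case (Suc t)
  then show ?case using last_hit_le[of Z i s] by (auto simp: le_Suc_eq)
qed simp

lemma last_hit_cong: "agree s Y Z \<Longrightarrow> last_hit Y i s = last_hit Z i s"
  by (induction s) (auto simp: agree_def)

lemma last_hit_eq:
  assumes "\<And>t. l \<le> t \<Longrightarrow> t < s \<Longrightarrow> col t = i \<Longrightarrow> \<not> Z t" "l \<le> s"
  shows "last_hit Z i s = last_hit Z i l"
  using assms(2,1) by (induction s rule: dec_induct) auto

lemma last_hit_bound: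
  assumes "\<And>t. l \<le> t \<Longrightarrow> col t = i \<Longrightarrow> \<not> Z t" shows "last_hit Z i s \<le> l"
proof (cases "l \<le> s")
  case True
  then show ?thesis using last_hit_eq[of l s i Z] assms last_hit_le[of Z i l] by simp
next
  case False
  then show ?thesis using last_hit_le[of Z i s] by simp
qed

lemma last_hit_gt: "m \<le> s \<Longrightarrow> col s = i \<Longrightarrow> Z s \<Longrightarrow> s < t \<Longrightarrow> m < last_hit Z i t"
  using last_hit_mono[of "Suc s" t Z i] by simp

lemma rec_in_last_hit:
  assumes Z: "dec_in A (Suc k) (\<lambda>\<rho>. Z (\<rho> 0) (\<lambda>i. \<rho> (Suc i)))"
    and i: "rec_in A k i" and s: "rec_in A k s"
  shows "rec_in A k (\<lambda>\<rho>. last_hit (\<lambda>m. Z m \<rho>) (i \<rho>) (s \<rho>))"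
proof -
  have "dec_in A (Suc (Suc k)) (\<lambda>\<rho>. Z (\<rho> 0) (\<lambda>i. \<rho> (Suc (Suc i))))"
    using rec_in_skip[of A k "\<lambda>m \<rho>. of_bool (Z m \<rho>)"] Z by simp
  then have "rec_in A k (\<lambda>\<rho>. rec_nat 0 (\<lambda>s v. if col s = i \<rho> \<and> Z s \<rho> then Suc s else v) (s \<rho>))"
    by (intro rec_in_rec_nat rec_in_const s rec_in_if dec_in_conj dec_in_eq rec_in_col rec_in_Suc
        rec_in_var i[THEN rec_in_shift, THEN rec_in_shift]) simp_all
  moreover have "last_hit Y j n = rec_nat 0 (\<lambda>s v. if col s = j \<and> Y s then Suc s else v) n" for Y j n
    by (induction n) auto
  ultimately show ?thesis by simp
qed

definition hit_cols :: "cantor \<Rightarrow> nat set" where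
  "hit_cols Z = {i. \<forall>n. \<exists>s\<ge>n. col s = i \<and> Z s}"

text \<open>With the approximated sequence as \<open>B\<close> and suitable \<open>S\<close> and
  \<open>l\<close> this is a normal form of \<open>Y\<close> with the same coding; varying
  \<open>B\<close> then gives the perturbations.\<close>

definition patch :: "nat set \<Rightarrow> nat \<Rightarrow> cantor \<Rightarrow> cantor \<Rightarrow> cantor" where
  "patch S l Y B = (\<lambda>m. if m < l then Y m else col m \<in> S \<and> B m)"

locale limit_coding =
  fixes x :: "nat \<Rightarrow> nat \<Rightarrow> bool" and X :: cantor
  assumes approx: "limit_approx x X"
begin

lemma limit: "\<exists>s0. \<forall>s\<ge>s0. x s m = X m"
  using approx unfolding limit_approx_def by blast

text \<open>\<open>Z\<close> is read only before \<open>s\<close>, through \<open>last_hit\<close>,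
  so \<open>hit\<close> can serve as the step of a course-of-values recursion.\<close>

definition hit :: "cantor \<Rightarrow> cantor \<Rightarrow> nat \<Rightarrow> bool" where
  "hit Y Z s \<longleftrightarrow> (col s = 0 \<or> col s < last_hit Z 0 s) \<and>
    (\<forall>m < last_hit Z (col s) s. col s = 0 \<or> col m = col s \<longrightarrow> Y m = x s m)"

primrec stage :: "cantor \<Rightarrow> nat \<Rightarrow> cantor" where
  "stage Y 0 = (\<lambda>_. False)"
| "stage Y (Suc n) = (stage Y n)(n := hit Y (stage Y n) n)"

definition coding :: "cantor \<Rightarrow> cantor" where
  "coding Y s = stage Y (Suc s) s"

lemma hit_cong: "agree s Y Y' \<Longrightarrow> agree s Z Z' \<Longrightarrow> hit Y Z s = hit Y' Z' s"
  unfolding hit_def using last_hit_cong[of s Z Z'] last_hit_le[of Z' _ s]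
  by (auto simp: agree_def) (metis order.strict_trans2)+

lemma stage_agree: "agree n (stage Y n) (coding Y)"
proof -
  have "i < n \<Longrightarrow> stage Y n i = stage Y (Suc i) i" for i
    by (induction n) (auto simp: less_Suc_eq)
  then show ?thesis unfolding agree_def coding_def by blast
qed

lemma coding_eq: "coding Y s = hit Y (coding Y) s"
  using hit_cong[OF agree_refl stage_agree, of Y Y] by (simp add: coding_def)

text \<open>The recursion determines each bit from the earlier ones. This identifies codings of
  different inputs.\<close>

lemma coding_unique:
  assumes "\<And>s. s < n \<Longrightarrow> Z s = hit Y Z s" shows "agree n Z (coding Y)"
proof -
  have "s < n \<Longrightarrow> Z s = coding Y s" for s
  proof (induction s rule: less_induct)
    case (less s)
    then have "agree s Z (coding Y)" by (simp add: agree_def)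
    then show ?case using assms[OF less.prems] coding_eq hit_cong[OF agree_refl] by metis
  qed
  then show ?thesis by (simp add: agree_def)
qed

lemma causal_coding: "causal coding"
  unfolding causal_def
proof (intro allI impI)
  fix n Y Z assume ag: "agree n Y Z"
  show "agree n (coding Y) (coding Z)"
  proof (rule coding_unique)
    fix s assume "s < n"
    then have "agree s Y Z" using ag agree_mono[of s n] by simp
    then show "coding Y s = hit Z (coding Y) s" using coding_eq hit_cong[OF _ agree_refl] by metis
  qed
qed

lemma dec_in_hit:
  assumes Y: "dec_in A (Suc k) (\<lambda>\<rho>. Y (\<rho> 0) (\<lambda>i. \<rho> (Suc i)))"
    and Z: "dec_in A (Suc k) (\<lambda>\<rho>. Z (\<rho> 0) (\<lambda>i. \<rho> (Suc i)))" and s: "rec_in A k s"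
  shows "dec_in A k (\<lambda>\<rho>. hit (\<lambda>m. Y m \<rho>) (\<lambda>m. Z m \<rho>) (s \<rho>))"
proof -
  have x: "dec_in A 2 (\<lambda>\<rho>. x (\<rho> 0) (\<rho> 1))"
    by (rule rec_in_any_oracle) (use approx in \<open>simp add: limit_approx_def\<close>)
  show ?thesis
    unfolding hit_def
    by (intro dec_in_conj dec_in_disj dec_in_eq dec_in_less dec_in_Ball dec_in_imp dec_in_iff
        rec_in_comp2[OF x] rec_in_last_hit Y Z rec_in_col s s[THEN rec_in_shift] rec_in_const rec_in_var)
      simp_all
qed

lemma rec_in_coding:
  assumes Y: "dec_in A (Suc k) (\<lambda>\<rho>. Y (\<rho> 0) (\<lambda>i. \<rho> (Suc i)))" and n: "rec_in A k n"
  shows "rec_in A k (\<lambda>\<rho>. prefix_code (coding (\<lambda>m. Y m \<rho>)) (n \<rho>))"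
proof -
  let ?step = "\<lambda>Y s z. z + 2 ^ s * (if hit Y (code_bit z) s then 2 else 1)"
  have "dec_in A (Suc (Suc k)) (\<lambda>\<rho>. Y (\<rho> 0) (\<lambda>i. \<rho> (Suc (Suc i))))"
    using rec_in_skip[of A k "\<lambda>m \<rho>. of_bool (Y m \<rho>)"] Y by simp
  then have "dec_in A (Suc (Suc (Suc k))) (\<lambda>\<rho>. Y (\<rho> 0) (\<lambda>i. \<rho> (Suc (Suc (Suc i)))))"
    using rec_in_skip[of A "Suc k" "\<lambda>m \<rho>. of_bool (Y m (\<lambda>i. \<rho> (Suc i)))"] by simp
  then have "dec_in A (Suc (Suc k)) (\<lambda>\<rho>. hit (\<lambda>m. Y m (\<lambda>i. \<rho> (Suc (Suc i)))) (code_bit (\<rho> 1)) (\<rho> 0))"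
    by (intro dec_in_hit[where Z = "\<lambda>m \<rho>. code_bit (\<rho> 1) m" and Y = "\<lambda>m \<rho>. Y m (\<lambda>i. \<rho> (Suc (Suc i)))"]
        dec_in_code_bit rec_in_var) simp_all
  then have "rec_in A k (\<lambda>\<rho>. rec_nat 0 (\<lambda>s z. ?step (\<lambda>m. Y m \<rho>) s z) (n \<rho>))"
    by (intro rec_in_rec_nat rec_in_const n rec_in_add rec_in_mult rec_in_power rec_in_if rec_in_var) simp_all
  moreover have "prefix_code (coding Y) n = rec_nat 0 (?step Y) n" for Y n
  proof (induction n)
    case (Suc n)
    \<comment> \<open>\<open>hit\<close> reads its second argument only below \<open>n\<close>,
      where the coded prefix is correct.\<close>
    have "hit Y (code_bit (prefix_code (coding Y) n)) n = coding Y n"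
      using coding_eq hit_cong[OF agree_refl agree_code_bit_prefix_code] by metis
    then show ?case using Suc by (simp add: prefix_code_def)
  qed (simp add: prefix_code_def)
  ultimately show ?thesis by simp
qed

section \<open>Columns with infinitely many hits\<close>

lemma cols_coding_eq:
  assumes "i \<in> hit_cols (coding Y)" "i = 0 \<or> col m = i" shows "Y m = X m"
proof -
  \<comment> \<open>After a hit \<open>s1\<close> at or past \<open>m\<close> every later hit of the
    column requires agreement at \<open>m\<close>; a hit \<open>s2\<close> after the approximation
    has settled at \<open>m\<close> requires agreement with \<open>X m\<close>.\<close>
  obtain s0 where s0: "\<And>s. s \<ge> s0 \<Longrightarrow> x s m = X m" using limit by blast
  obtain s1 where s1: "s1 \<ge> m" "col s1 = i" "coding Y s1" using assms(1) unfolding hit_cols_def by blast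
  obtain s2 where s2: "s2 \<ge> s0 + Suc s1" "col s2 = i" "coding Y s2"
    using assms(1) unfolding hit_cols_def by blast
  have "m < last_hit (coding Y) i s2" using s1 s2(1) by (intro last_hit_gt[of m s1]) auto
  then have "Y m = x s2 m" using s2(2,3) assms(2) coding_eq[of Y s2] unfolding hit_def by blast
  then show ?thesis using s0[of s2] s2(1) by simp
qed

lemma coding_0_in_cols: "0 \<in> hit_cols (coding Y) \<Longrightarrow> Y = X"
  using cols_coding_eq[of 0] by blast

text \<open>If the hits stopped, the column would compare on finitely many positions only; once it
  is active and the approximation is correct on these, its next stage is a hit.\<close>

lemma in_cols_coding:
  assumes act: "i = 0 \<or> i < last_hit (coding Y) 0 a" and eq: "\<And>m. i = 0 \<or> col m = i \<Longrightarrow> Y m = X m"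
  shows "i \<in> hit_cols (coding Y)"
proof (rule ccontr)
  assume "i \<notin> hit_cols (coding Y)"
  then obtain n where n: "\<And>s. s \<ge> n \<Longrightarrow> col s = i \<Longrightarrow> \<not> coding Y s" unfolding hit_cols_def by blast
  obtain s0 where s0: "\<And>s m. s \<ge> s0 \<Longrightarrow> m < n \<Longrightarrow> x s m = X m"
    using limit_approx_stable[OF approx] by blast
  define s where "s = col_elem i (n + s0 + a)"
  have s: "n + s0 + a \<le> s" "col s = i" unfolding s_def by (simp_all add: le_col_elem col_col_elem)
  have "hit Y (coding Y) s"
    unfolding hit_def s(2)
  proof (intro conjI allI impI)
    show "i = 0 \<or> i < last_hit (coding Y) 0 s"
      using act last_hit_mono[of a s "coding Y" 0] s(1) by auto
    fix m assume m: "m < last_hit (coding Y) i s" "i = 0 \<or> col m = i"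
    have "last_hit (coding Y) i s \<le> n" by (rule last_hit_bound) (use n in blast)
    then show "Y m = x s m" using m s0[of s m] s(1) eq by simp
  qed
  then show False using n[of s] s coding_eq by simp
qed

lemma zero_in_cols_coding: "0 \<in> hit_cols (coding X)"
  by (rule in_cols_coding) auto

lemma coding_active: "coding Y s \<Longrightarrow> col s = 0 \<or> col s < last_hit (coding Y) 0 s"
  using coding_eq[of Y s] unfolding hit_def by blast

text \<open>When column 0 has only finitely many hits, they bound the indices of the columns that
  ever become active, so only finitely many columns have hits at all.\<close>

lemma hits_outside_cols:
  assumes "0 \<notin> hit_cols (coding Y)"
  shows "finite (hit_cols (coding Y))" "\<exists>l. \<forall>s\<ge>l. col s \<notin> hit_cols (coding Y) \<longrightarrow> \<not> coding Y s"
proof -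
  let ?Z = "coding Y"
  obtain n where n: "\<And>s. s \<ge> n \<Longrightarrow> col s = 0 \<Longrightarrow> \<not> ?Z s" using assms unfolding hit_cols_def by blast
  have act: "col s < Suc n" if "?Z s" for s
    using coding_active[OF that] last_hit_bound[of n 0 ?Z s] n by auto
  have "hit_cols ?Z \<subseteq> {..<Suc n}" unfolding hit_cols_def using act by blast
  then show "finite (hit_cols ?Z)" by (rule finite_subset) simp
  have "\<forall>i. \<exists>b. i \<notin> hit_cols ?Z \<longrightarrow> (\<forall>s\<ge>b. col s = i \<longrightarrow> \<not> ?Z s)" unfolding hit_cols_def by blast
  then obtain b where b: "\<And>i s. i \<notin> hit_cols ?Z \<Longrightarrow> s \<ge> b i \<Longrightarrow> col s = i \<Longrightarrow> \<not> ?Z s" by metis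
  show "\<exists>l. \<forall>s\<ge>l. col s \<notin> hit_cols ?Z \<longrightarrow> \<not> ?Z s"
  proof (intro exI[of _ "\<Sum>i<Suc n. b i"] allI impI notI)
    fix s assume s: "(\<Sum>i<Suc n. b i) \<le> s" "col s \<notin> hit_cols ?Z" "?Z s"
    then have "b (col s) \<le> (\<Sum>i<Suc n. b i)" using act by (intro member_le_sum) auto
    from b[OF s(2) order_trans[OF this s(1)] refl] s(3) show False by blast
  qed
qed

text \<open>Without further hits the comparison range of the column stays fixed and below
  \<open>l\<close>. A failure at an active stage \<open>t\<close> is therefore a mismatch at a
  position where the approximation has settled, and it recurs at every later stage of the
  column.\<close>

lemma no_hit_persists:
  assumes none: "\<And>s. l \<le> s \<Longrightarrow> s < n \<Longrightarrow> col s = i \<Longrightarrow> \<not> coding Y s"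
    and t: "l \<le> t" "t < n" "col t = i" "i = 0 \<or> i < last_hit (coding Y) 0 t"
    and stable: "\<And>s m. t \<le> s \<Longrightarrow> m < l \<Longrightarrow> x s m = X m"
  shows "l \<le> s \<Longrightarrow> col s = i \<Longrightarrow> \<not> coding Y s"
proof (induction s rule: less_induct)
  case (less s)
  let ?Z = "coding Y"
  show ?case
  proof (cases "s < n")
    case True
    then show ?thesis using none less.prems by blast
  next
    case False
    have "last_hit ?Z i s = last_hit ?Z i l" "last_hit ?Z i t = last_hit ?Z i l"
      by (rule last_hit_eq; use less none t in force)+
    moreover have "\<not> hit Y ?Z t" using none[OF t(1-3)] coding_eq by blast
    ultimately obtain m where m: "m < last_hit ?Z i s" "i = 0 \<or> col m = i" "Y m \<noteq> x t m"
      using t(3,4) unfolding hit_def by auto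
    have "m < l" using m(1) \<open>last_hit ?Z i s = last_hit ?Z i l\<close> last_hit_le[of ?Z i l] by simp
    then have "x s m = x t m" using stable[of s m] stable[of t m] False t(2) by simp
    then have "\<not> hit Y ?Z s" using m less.prems(2) unfolding hit_def by auto
    then show ?thesis using coding_eq by blast
  qed
qed

text \<open>Agreement up to \<open>n\<close> includes one late test stage for each column
  \<open>i \<le> l\<close>. A failure there is permanent, which freezes the columns that are finite
  for \<open>Y\<close>.\<close>

lemma coding_near_cols:
  assumes fin: "0 \<notin> hit_cols (coding Y)"
  obtains n where "\<And>Y' s. agree n (coding Y') (coding Y) \<Longrightarrow> col s \<notin> hit_cols (coding Y) \<Longrightarrow>
    coding Y' s = coding Y s"
proof -
  let ?Z = "coding Y"
  obtain l where l: "\<And>s. s \<ge> l \<Longrightarrow> col s \<notin> hit_cols ?Z \<Longrightarrow> \<not> ?Z s"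
    using hits_outside_cols(2)[OF fin] by blast
  obtain s0 where s0: "\<And>s m. s \<ge> s0 \<Longrightarrow> m < l \<Longrightarrow> x s m = X m"
    using limit_approx_stable[OF approx] by blast
  \<comment> \<open>The test stage of column \<open>i\<close> lies past all hits of finite columns
    and past the settling of the approximation below \<open>l\<close>.\<close>
  define t where "t i = col_elem i (l + s0)" for i
  have t: "l + s0 \<le> t i" "col (t i) = i" for i unfolding t_def by (simp_all add: le_col_elem col_col_elem)
  define n where "n = (\<Sum>i<Suc l. Suc (t i))"
  have tn: "t i < n" if "i < Suc l" for i
    using member_le_sum[of i "{..<Suc l}" "\<lambda>i. Suc (t i)"] that unfolding n_def by simp
  show ?thesis
  proof (rule that[of n])
    fix Y' s
    let ?Z' = "coding Y'"
    assume ag: "agree n ?Z' ?Z" and s: "col s \<notin> hit_cols ?Z"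
    have none: "\<not> ?Z' r" if "i \<notin> hit_cols ?Z" "l \<le> r" "r < n" "col r = i" for r i
      using l[of r] ag that by (simp add: agree_def)
    have persists: "\<not> ?Z' r" if "i \<notin> hit_cols ?Z" "i < Suc l" "i = 0 \<or> i < last_hit ?Z' 0 (t i)"
      "l \<le> r" "col r = i" for r i
      by (rule no_hit_persists[of l n i Y' "t i"]) (use none that t[of i] tn[of i] s0 in auto)
    \<comment> \<open>Column 0 comes first: once it is frozen, only columns with index below its
      last hit, hence below \<open>l\<close>, can ever be active.\<close>
    have zero: "\<not> ?Z' r" if "l \<le> r" "col r = 0" for r
      using persists[OF fin _ _ that] by simp
    have last: "last_hit ?Z' 0 r = last_hit ?Z' 0 l" if "l \<le> r" for r
      using zero that by (intro last_hit_eq) auto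
    have out: "\<not> ?Z' r" if r: "l \<le> r" "col r \<notin> hit_cols ?Z" for r
    proof (cases "col r < last_hit ?Z' 0 l")
      case True
      then have "col r < Suc l" using last_hit_le[of ?Z' 0 l] by simp
      moreover have "col r < last_hit ?Z' 0 (t (col r))" using True last[of "t (col r)"] t(1)[of "col r"] by simp
      ultimately show ?thesis using persists[OF r(2) _ _ r(1)] by blast
    next
      case False
      show ?thesis
      proof (cases "col r = 0")
        case True
        then show ?thesis using zero r(1) by blast
      next
        case nz: False
        then show ?thesis using coding_active[of Y' r] last[OF r(1)] False by auto
      qed
    qed
    show "?Z' s = ?Z s"
    proof (cases "s < n")
      case True
      then show ?thesis using ag by (simp add: agree_def)
    next
      case False
      moreover have "l \<le> n" using tn[of 0] t(1)[of 0] by simp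
      ultimately show ?thesis using out[of s] l[of s] s by simp
    qed
  qed
qed

lemma coding_near:
  assumes fin: "0 \<notin> hit_cols (coding Y)"
  obtains n where "\<And>Y'. agree n (coding Y') (coding Y) \<Longrightarrow>
    coding Y' = coding Y \<or> hit_cols (coding Y') \<subset> hit_cols (coding Y)"
proof -
  obtain n where n: "\<And>Y' s. agree n (coding Y') (coding Y) \<Longrightarrow> col s \<notin> hit_cols (coding Y) \<Longrightarrow>
    coding Y' s = coding Y s"
    using coding_near_cols[OF fin] by blast
  show ?thesis
  proof (rule that[of n])
    fix Y' assume ag: "agree n (coding Y') (coding Y)"
    have sub: "hit_cols (coding Y') \<subseteq> hit_cols (coding Y)"
    proof
      fix i assume i: "i \<in> hit_cols (coding Y')"
      show "i \<in> hit_cols (coding Y)"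
      proof (rule ccontr)
        assume "i \<notin> hit_cols (coding Y)"
        then have "i \<in> hit_cols (coding Y)" using i n[OF ag] unfolding hit_cols_def by blast
        then show False using \<open>i \<notin> hit_cols (coding Y)\<close> by blast
      qed
    qed
    \<comment> \<open>On the columns with infinitely many hits both inputs equal \<open>X\<close>,
      so their hits agree by induction; the other columns are frozen.\<close>
    have "coding Y' = coding Y" if eq: "hit_cols (coding Y') = hit_cols (coding Y)"
    proof
      fix s show "coding Y' s = coding Y s"
      proof (induction s rule: less_induct)
        case (less s)
        show ?case
        proof (cases "col s \<in> hit_cols (coding Y)")
          case True
          then have nz: "col s \<noteq> 0" using fin by metis
          have "Y' m = Y m" if "col m = col s" for m
            using cols_coding_eq[of "col s" Y' m] cols_coding_eq[of "col s" Y m] True eq that by simp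
          then have "hit Y' (coding Y') s = hit Y (coding Y') s"
            using nz unfolding hit_def by auto
          also have "\<dots> = hit Y (coding Y) s"
            by (rule hit_cong) (use less in \<open>auto simp: agree_def\<close>)
          finally show ?thesis using coding_eq by metis
        qed (rule n[OF ag])
      qed
    qed
    then show "coding Y' = coding Y \<or> hit_cols (coding Y') \<subset> hit_cols (coding Y)" using sub by blast
  qed
qed

text \<open>The coding depends on \<open>Y\<close> only at compared positions. In a column whose
  hits stop these lie below \<open>l0\<close>; in the other columns \<open>Y\<close> equals
  \<open>X\<close> already.\<close>

lemma coding_patch:
  assumes fin: "0 \<notin> hit_cols (coding Y)"
  obtains l0 where "\<And>l. l \<ge> l0 \<Longrightarrow> coding (patch (hit_cols (coding Y)) l Y X) = coding Y"
proof -
  let ?Z = "coding Y"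
  obtain l0 where l0: "\<And>s. s \<ge> l0 \<Longrightarrow> col s \<notin> hit_cols ?Z \<Longrightarrow> \<not> ?Z s"
    using hits_outside_cols(2)[OF fin] by blast
  show ?thesis
  proof (rule that[of l0])
    fix l assume l: "l \<ge> l0"
    let ?Y = "patch (hit_cols ?Z) l Y X"
    have "?Z s = hit ?Y ?Z s" for s
    proof -
      have "?Y m = Y m" if m: "m < last_hit ?Z (col s) s" "col s = 0 \<or> col m = col s" for m
      proof (cases "m < l")
        case True
        then show ?thesis by (simp add: patch_def)
      next
        case False
        have "col s \<in> hit_cols ?Z"
        proof (rule ccontr)
          assume "col s \<notin> hit_cols ?Z"
          then have "last_hit ?Z (col s) s \<le> l0" using l0 by (intro last_hit_bound) auto
          then show False using m(1) False l by simp
        qed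
        then have "col m \<in> hit_cols ?Z" "Y m = X m" using m(2) fin cols_coding_eq[of "col m" Y m] by auto
        then show ?thesis using False by (simp add: patch_def)
      qed
      then have "hit ?Y ?Z s = hit Y ?Z s" unfolding hit_def by auto
      then show ?thesis using coding_eq by metis
    qed
    then have "agree (Suc s) ?Z (coding ?Y)" for s by (intro coding_unique)
    then show "coding ?Y = ?Z" unfolding agree_def by auto
  qed
qed

text \<open>By the normal form, an image other than that of \<open>X\<close> is given by a finite
  set of columns, a number and the code of a finite string.\<close>

lemma countable_range_coding: "countable (range coding)"
proof -
  let ?f = "\<lambda>(S, l, w). coding (patch S l (code_bit w) X)"
  have "range coding \<subseteq> insert (coding X) (?f ` ({S. finite S} \<times> UNIV \<times> UNIV))"
  proof
    fix Z assume "Z \<in> range coding"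
    then obtain Y where Y: "Z = coding Y" by blast
    show "Z \<in> insert (coding X) (?f ` ({S. finite S} \<times> UNIV \<times> UNIV))"
    proof (cases "0 \<in> hit_cols Z")
      case True
      then show ?thesis using Y coding_0_in_cols by blast
    next
      case False
      then obtain l where "coding (patch (hit_cols Z) l Y X) = Z" using coding_patch Y by (metis order_refl)
      moreover have "patch (hit_cols Z) l Y X = patch (hit_cols Z) l (code_bit (prefix_code Y l)) X"
        unfolding patch_def by (auto simp: code_bit_prefix_code)
      moreover have "finite (hit_cols Z)" using hits_outside_cols(1) False Y by blast
      ultimately show ?thesis by (intro insertI2 image_eqI[of _ _ "(hit_cols Z, l, prefix_code Y l)"]) auto
    qed
  qed
  moreover have "countable (insert (coding X) (?f ` ({S. finite S} \<times> UNIV \<times> UNIV)))"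
    by (intro countable_insert countable_image countable_SIGMA countable_Collect_finite) auto
  ultimately show ?thesis by (rule countable_subset)
qed

section \<open>Computability and Turing degree of the coding\<close>

lemma computable_map_coding_patch:
  assumes S: "dec_in no_oracle 1 (\<lambda>\<rho>. \<rho> 0 \<in> S)"
  shows "computable_map (\<lambda>B. coding (patch S l Y B))"
  unfolding computable_map_def
proof
  have "agree n (patch S l Y B) (patch S l Y B')" if "agree n B B'" for n B B'
    using that by (auto simp: agree_def patch_def)
  then show "causal (\<lambda>B. coding (patch S l Y B))"
    using causal_coding unfolding causal_def by blast
  \<comment> \<open>Only the bits of \<open>Y\<close> below \<open>l\<close> enter, as a finite set
    written into the program, so \<open>Y\<close> may be noncomputable.\<close>
  have "dec_in no_oracle (Suc 2) (\<lambda>\<rho>. \<rho> 0 \<in> {m. m < l \<and> Y m} \<or> \<not> \<rho> 0 < l \<and> col (\<rho> 0) \<in> S \<and> code_bit (\<rho> (Suc 0)) (\<rho> 0))"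
    by (intro dec_in_disj dec_in_conj dec_in_not dec_in_less dec_in_finite dec_in_code_bit
        rec_in_comp1[OF S] rec_in_col rec_in_const rec_in_var) auto
  moreover have "patch S l Y B m \<longleftrightarrow> m \<in> {m. m < l \<and> Y m} \<or> \<not> m < l \<and> col m \<in> S \<and> B m" for B m
    by (auto simp: patch_def)
  ultimately have "dec_in no_oracle (Suc 2) (\<lambda>\<rho>. patch S l Y (code_bit (\<rho> (Suc 0))) (\<rho> 0))" by simp
  then show "rec_in no_oracle 2 (\<lambda>\<rho>. prefix_code (coding (patch S l Y (code_bit (\<rho> 0)))) (\<rho> 1))"
    using rec_in_coding[of no_oracle 2 "\<lambda>m \<rho>. patch S l Y (code_bit (\<rho> 0)) m" "\<lambda>\<rho>. \<rho> 1"]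
    by (simp add: rec_in_var)
qed

lemma patch_UNIV: "patch UNIV 0 Y B = B"
  by (simp add: patch_def)

lemma computable_map_coding: "computable_map coding"
  using computable_map_coding_patch[of UNIV 0 undefined] by (simp add: patch_UNIV rec_in_const)

lemma turing_equiv_coding: "(X, coding X) \<in> turing_equiv"
proof -
  let ?X = "\<lambda>k. of_bool (X k) :: nat" and ?R = "\<lambda>k. of_bool (coding X k) :: nat"
  have "rec_in ?X 1 (\<lambda>\<rho>. prefix_code (coding X) (Suc (\<rho> 0)))"
    using rec_in_coding[of ?X 1 "\<lambda>m \<rho>. X m"] rec_in_oracle[of ?X] by (simp add: rec_in_var rec_in_Suc)
  then have "dec_in ?X 1 (\<lambda>\<rho>. code_bit (prefix_code (coding X) (Suc (\<rho> 0))) (\<rho> 0))"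
    by (intro dec_in_code_bit rec_in_var) auto
  then have 1: "turing_reducible (coding X) X"
    unfolding turing_reducible_iff by (simp add: code_bit_prefix_code)
  \<comment> \<open>A hit of column 0 whose comparison range contains \<open>m\<close> certifies
    \<open>x s m = X m\<close>. Column 0 has infinitely many hits, so a search through
    \<open>coding X\<close> finds one.\<close>
  define h where "h m s \<longleftrightarrow> m < last_hit (coding X) 0 s \<and> col s = 0 \<and> coding X s" for m s
  have ex: "\<exists>s. h m s" for m
  proof -
    obtain s1 where s1: "s1 \<ge> m" "col s1 = 0" "coding X s1"
      using zero_in_cols_coding unfolding hit_cols_def by blast
    obtain s2 where s2: "s2 \<ge> Suc s1" "col s2 = 0" "coding X s2"
      using zero_in_cols_coding unfolding hit_cols_def by blast
    have "h m s2" unfolding h_def using s1 s2 by (auto intro: last_hit_gt)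
    then show ?thesis by blast
  qed
  have "x (LEAST s. h m s) m = X m" for m
  proof -
    have "h m (LEAST s. h m s)" by (rule LeastI_ex[OF ex])
    then show ?thesis using coding_eq[of X "LEAST s. h m s"] unfolding h_def hit_def by auto
  qed
  moreover have "dec_in ?R 1 (\<lambda>\<rho>. x (LEAST s. h (\<rho> 0) s) (\<rho> 0))"
  proof -
    have x: "dec_in ?R 2 (\<lambda>\<rho>. x (\<rho> 0) (\<rho> 1))"
      by (rule rec_in_any_oracle) (use approx in \<open>simp add: limit_approx_def\<close>)
    have R: "dec_in ?R k (\<lambda>\<rho>. coding X (f \<rho>))" if "rec_in ?R k f" for k f
      using rec_in_oracle[OF that] .
    have "rec_in ?R 1 (\<lambda>\<rho>. LEAST s. h (\<rho> 0) s)"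
    proof (rule rec_in_Least)
      show "dec_in ?R (Suc 1) (\<lambda>\<rho>. h (\<rho> (Suc 0)) (\<rho> 0))"
        unfolding h_def
        by (intro dec_in_conj dec_in_less dec_in_eq rec_in_last_hit[where Z = "\<lambda>m \<rho>. coding X m"] R
            rec_in_col rec_in_const rec_in_var) simp_all
    qed (rule ex)
    then show ?thesis by (intro rec_in_comp2[OF x] rec_in_var) simp_all
  qed
  ultimately have 2: "turing_reducible X (coding X)" unfolding turing_reducible_iff by simp
  show ?thesis unfolding turing_equiv_def using 1 2 by simp
qed

end

section \<open>Cantor-Bendixson ranks of coded sequences\<close>

lemma cb_derivative_subset: "cb_derivative P \<subseteq> P"
  unfolding cb_derivative_def by blast

lemma cord_cases:
  obtains "\<beta> = 0" | \<gamma> where "\<beta> = osucc \<gamma>" | "\<beta> \<noteq> 0" "\<not> is_osucc \<beta>"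
  unfolding is_osucc_def by blast

lemma less_osucc_iff: "\<beta> < osucc \<gamma> \<longleftrightarrow> \<beta> \<le> \<gamma>"
  using osucc_le[of \<gamma> \<beta>] less_osucc[of \<gamma>] by (meson not_le order.strict_trans1)

lemma cb_iter_antimono: "\<beta> \<le> \<gamma> \<Longrightarrow> cb_iter P \<gamma> \<subseteq> cb_iter P \<beta>"
proof (induction \<gamma> rule: less_induct)
  case (less \<gamma>)
  show ?case
  proof (cases "\<beta> = \<gamma>")
    case False
    then have lt: "\<beta> < \<gamma>" using less.prems by simp
    show ?thesis
    proof (cases \<gamma> rule: cord_cases)
      case 1
      then show ?thesis using lt zero_le_cord[of \<beta>] by simp
    next
      case (2 \<delta>)
      then have "cb_iter P \<delta> \<subseteq> cb_iter P \<beta>" using lt less_osucc by (intro less.IH) (auto simp: less_osucc_iff)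
      then show ?thesis unfolding 2 cb_iter_osucc using cb_derivative_subset by blast
    next
      case 3
      then show ?thesis using lt by (auto simp: cb_iter_limit)
    qed
  qed simp
qed

definition cord_of_nat :: "nat \<Rightarrow> cord" where
  "cord_of_nat k = (osucc ^^ k) 0"

lemma cord_of_nat_Suc: "cord_of_nat (Suc k) = osucc (cord_of_nat k)"
  by (simp add: cord_of_nat_def)

lemma cord_of_nat_less_omega: "cord_of_nat k < omega"
proof (induction k)
  case 0
  then show ?case using omega_limit(1) zero_le_cord[of omega] by (simp add: cord_of_nat_def)
next
  case (Suc k)
  then have "cord_of_nat (Suc k) \<le> omega" unfolding cord_of_nat_Suc by (rule osucc_le)
  moreover have "cord_of_nat (Suc k) \<noteq> omega" using omega_limit(2) unfolding cord_of_nat_Suc is_osucc_def by metis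
  ultimately show ?case by simp
qed

lemma less_omegaD: "\<beta> < omega \<Longrightarrow> \<exists>k. \<beta> = cord_of_nat k"
proof (induction \<beta> rule: less_induct)
  case (less \<beta>)
  have "\<not> (\<beta> \<noteq> 0 \<and> \<not> is_osucc \<beta>)" using less.prems unfolding omega_def by (rule not_less_Least)
  then consider "\<beta> = 0" | \<gamma> where "\<beta> = osucc \<gamma>" unfolding is_osucc_def by blast
  then show ?case
  proof cases
    case 1
    then show ?thesis by (intro exI[of _ 0]) (simp add: cord_of_nat_def)
  next
    case (2 \<gamma>)
    then obtain k where "\<gamma> = cord_of_nat k" using less less_osucc[of \<gamma>] by (meson order.strict_trans)
    then show ?thesis using 2 cord_of_nat_Suc by metis
  qed
qed

lemma cb_iter_omega: "cb_iter P omega = (\<Inter>k. cb_iter P (cord_of_nat k))"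
proof -
  have "{..<omega} = range cord_of_nat" using less_omegaD cord_of_nat_less_omega by auto
  then show ?thesis using cb_iter_limit[OF omega_limit, of P] by simp
qed

lemma rank_in_eq:
  assumes "X \<in> cb_iter P \<beta>" "X \<notin> cb_iter P (osucc \<beta>)" shows "rank_in P X = Some \<beta>"
proof -
  have "(LEAST \<beta>. X \<in> cb_iter P \<beta> - cb_iter P (osucc \<beta>)) = \<beta>"
  proof (rule Least_equality)
    fix \<gamma> assume \<gamma>: "X \<in> cb_iter P \<gamma> - cb_iter P (osucc \<gamma>)"
    show "\<beta> \<le> \<gamma>"
    proof (rule ccontr)
      assume "\<not> \<beta> \<le> \<gamma>"
      then have "osucc \<gamma> \<le> \<beta>" by (intro osucc_le) simp
      then show False using \<gamma> assms(1) cb_iter_antimono by blast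
    qed
  qed (use assms in blast)
  moreover have "\<exists>\<beta>. X \<in> cb_iter P \<beta> - cb_iter P (osucc \<beta>)" using assms by blast
  ultimately show ?thesis unfolding rank_in_def by (simp only: if_True)
qed

lemma rank_in_SomeD: "rank_in P X = Some \<beta> \<Longrightarrow> X \<notin> cb_iter P (osucc \<beta>)"
proof -
  assume rank: "rank_in P X = Some \<beta>"
  then have ex: "\<exists>\<beta>. X \<in> cb_iter P \<beta> - cb_iter P (osucc \<beta>)"
    unfolding rank_in_def by (metis option.distinct(1))
  then have "\<beta> = (LEAST \<beta>. X \<in> cb_iter P \<beta> - cb_iter P (osucc \<beta>))"
    using rank unfolding rank_in_def by (simp only: if_True option.inject)
  then show ?thesis using LeastI_ex[OF ex] by simp
qed

text \<open>The class \<open>P\<close> bounds the rank by \<open>\<beta>\<close>, and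
  \<open>min\<close> excludes a smaller rank in any class because the iterated derivatives
  decrease.\<close>

lemma cb_rank_eq:
  assumes P: "pi01_class P" and X: "X \<in> cb_iter P \<beta>" "X \<notin> cb_iter P (osucc \<beta>)"
    and min: "\<And>Q. pi01_class Q \<Longrightarrow> X \<in> Q \<Longrightarrow> X \<in> cb_iter Q \<beta>"
  shows "cb_rank X = Some \<beta>"
proof -
  have rank: "rank_in P X = Some \<beta>" using X by (rule rank_in_eq)
  have "X \<in> P" using X(1) cb_iter_antimono[OF zero_le_cord, of P \<beta>] by (auto simp: cb_iter_0)
  then have "ranked X" unfolding ranked_def using P rank by auto
  moreover have "(LEAST \<gamma>. \<exists>Q. pi01_class Q \<and> X \<in> Q \<and> rank_in Q X = Some \<gamma>) = \<beta>"
  proof (rule Least_equality)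
    fix \<gamma> assume "\<exists>Q. pi01_class Q \<and> X \<in> Q \<and> rank_in Q X = Some \<gamma>"
    then obtain Q where Q: "pi01_class Q" "X \<in> Q" "rank_in Q X = Some \<gamma>" by blast
    show "\<beta> \<le> \<gamma>"
    proof (rule ccontr)
      assume "\<not> \<beta> \<le> \<gamma>"
      then have "osucc \<gamma> \<le> \<beta>" by (intro osucc_le) simp
      then show False using rank_in_SomeD[OF Q(3)] min[OF Q(1,2)] cb_iter_antimono by blast
    qed
  qed (use P rank \<open>X \<in> P\<close> in blast)
  ultimately show ?thesis unfolding cb_rank_def by simp
qed

lemma in_cb_derivative_iff:
  "X \<in> cb_derivative P \<longleftrightarrow> X \<in> P \<and> (\<forall>n. \<exists>Y\<in>P. agree n Y X \<and> Y \<noteq> X)"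
  unfolding cb_derivative_def isolated_in_cantor_iff by blast

section \<open>Perturbing the random sequence within a class\<close>

locale random_limit_coding = limit_coding +
  assumes random: "ml_random cantor_lebesgue X"
begin

text \<open>\<open>random_section\<close> for the preimage of \<open>Q\<close>, with the part of
  column \<open>j\<close> from \<open>l\<close> on as the set of free positions.\<close>

lemma perturb_column:
  assumes F: "computable_map F" and Q: "pi01_class Q" "F X \<in> Q"
  obtains B where "F B \<in> Q" "B \<noteq> X" "\<And>m. \<not> (col m = j \<and> l \<le> m) \<Longrightarrow> B m = X m"
proof -
  have "pi01_class (F -` Q)" by (rule pi01_class_vimage[OF F Q(1)])
  moreover have "X \<in> F -` Q" using Q(2) by simp
  moreover have "dec_in no_oracle 1 (\<lambda>\<rho>. col (\<rho> 0) = j \<and> l \<le> \<rho> 0)"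
    by (intro dec_in_conj dec_in_eq dec_in_le rec_in_col rec_in_const rec_in_var) simp_all
  moreover have "rec_in no_oracle 1 (\<lambda>\<rho>. col_elem j (l + \<rho> 0))"
    by (intro rec_in_col_elem rec_in_add rec_in_const rec_in_var) simp
  moreover have "inj (\<lambda>k. col_elem j (l + k))"
    by (intro injI) (auto dest: injD[OF inj_col_elem])
  moreover have "col (col_elem j (l + k)) = j \<and> l \<le> col_elem j (l + k)" for k
    using le_col_elem[of "l + k" j] by (simp add: col_col_elem)
  ultimately obtain B where "B \<in> F -` Q" "B \<noteq> X" "\<And>m. \<not> (col m = j \<and> l \<le> m) \<Longrightarrow> B m = X m"
    by (rule random_section[OF random]) blast
  then show ?thesis using that by simp
qed

text \<open>Randomness is available for \<open>X\<close>, so \<open>Y\<close> is first replaced by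
  its normal form, which follows \<open>X\<close> beyond \<open>l\<close> on the infinite columns. A
  change of \<open>X\<close> in column \<open>j\<close> then spoils this column and leaves the other
  infinite ones intact.\<close>

lemma perturb_finite_cols:
  assumes Q: "pi01_class Q" "coding Y \<in> Q" and fin: "0 \<notin> hit_cols (coding Y)" and j: "j \<in> hit_cols (coding Y)"
  obtains Y' where "coding Y' \<in> Q" "agree n (coding Y') (coding Y)" "coding Y' \<noteq> coding Y"
    "0 \<notin> hit_cols (coding Y')" "hit_cols (coding Y) - {j} \<subseteq> hit_cols (coding Y')"
proof -
  let ?S = "hit_cols (coding Y)"
  obtain l0 where l0: "\<And>l. l \<ge> l0 \<Longrightarrow> coding (patch ?S l Y X) = coding Y"
    using coding_patch[OF fin] by blast
  have "finite ?S" by (rule hits_outside_cols(1)[OF fin])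
  have "\<forall>i. \<exists>a. i \<in> ?S \<longrightarrow> i < last_hit (coding Y) 0 a"
    using coding_active fin unfolding hit_cols_def by blast
  then obtain a where a: "\<And>i. i \<in> ?S \<Longrightarrow> i < last_hit (coding Y) 0 (a i)" by metis
  \<comment> \<open>Beyond \<open>l0\<close> the normal form has the right coding, \<open>n\<close>
    keeps the perturbation close, and the sum lets all columns of \<open>?S\<close> become active
    before \<open>l\<close>.\<close>
  define l where "l = l0 + n + (\<Sum>i\<in>?S. a i)"
  have active: "i < last_hit (coding Y) 0 l" if "i \<in> ?S" for i
  proof -
    have "a i \<le> (\<Sum>i\<in>?S. a i)" using that \<open>finite ?S\<close> by (intro member_le_sum) auto
    then have "a i \<le> l" unfolding l_def by simp
    then show ?thesis using a[OF that] last_hit_mono[of "a i" l "coding Y" 0] by simp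
  qed
  define F where "F B = coding (patch ?S l Y B)" for B
  have "computable_map F"
    unfolding F_def
    by (intro computable_map_coding_patch dec_in_finite \<open>finite ?S\<close> rec_in_var) simp
  moreover have "F X = coding Y" unfolding F_def by (rule l0) (simp add: l_def)
  ultimately obtain B where B: "F B \<in> Q" "B \<noteq> X" "\<And>m. \<not> (col m = j \<and> l \<le> m) \<Longrightarrow> B m = X m"
    using perturb_column Q by metis
  let ?Y = "patch ?S l Y B"
  obtain m where m: "B m \<noteq> X m" using B(2) by auto
  then have m': "col m = j" "l \<le> m" using B(3) by blast+
  then have Ym: "?Y m \<noteq> X m" using j m by (simp add: patch_def)
  have "agree l ?Y Y" by (simp add: agree_def patch_def)
  then have ag: "agree l (coding ?Y) (coding Y)" using causal_coding unfolding causal_def by blast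
  have nj: "j \<notin> hit_cols (coding ?Y)" using cols_coding_eq[of j ?Y m] Ym m'(1) by blast
  show ?thesis
  proof (rule that[of ?Y])
    show "coding ?Y \<in> Q" using B(1) unfolding F_def .
    show "agree n (coding ?Y) (coding Y)" using agree_mono[OF _ ag, of n] by (simp add: l_def)
    show "coding ?Y \<noteq> coding Y" using nj j by metis
    show "0 \<notin> hit_cols (coding ?Y)" using Ym coding_0_in_cols by metis
    show "?S - {j} \<subseteq> hit_cols (coding ?Y)"
    proof
      fix i assume i: "i \<in> ?S - {j}"
      show "i \<in> hit_cols (coding ?Y)"
      proof (rule in_cols_coding)
        show "i = 0 \<or> i < last_hit (coding ?Y) 0 l"
          using active[of i] i last_hit_cong[OF ag, of 0] by simp
        show "?Y k = X k" if "i = 0 \<or> col k = i" for k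
        proof -
          have "col k = i" using that i fin by blast
          then show ?thesis
            using i B(3)[of k] cols_coding_eq[of i Y k] by (auto simp: patch_def)
        qed
      qed
    qed
  qed
qed

text \<open>A late hit in column 0 activates the columns 1 to \<open>k\<close>. A change of
  \<open>X\<close> in column 0 beyond this hit leaves those columns equal to \<open>X\<close>, while
  column 0 keeps only finitely many hits.\<close>

lemma perturb_top:
  assumes Q: "pi01_class Q" "coding X \<in> Q"
  obtains Y where "coding Y \<in> Q" "agree n (coding Y) (coding X)" "coding Y \<noteq> coding X"
    "k \<le> card (hit_cols (coding Y))" "0 \<notin> hit_cols (coding Y)"
proof -
  obtain s where s: "s \<ge> n + k" "col s = 0" "coding X s"
    using zero_in_cols_coding unfolding hit_cols_def by blast
  have l: "k < last_hit (coding X) 0 (Suc s)" using s by simp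
  obtain B where B: "coding B \<in> Q" "B \<noteq> X" "\<And>m. \<not> (col m = 0 \<and> Suc s \<le> m) \<Longrightarrow> B m = X m"
    using perturb_column[OF computable_map_coding Q] by blast
  have "agree (Suc s) B X" using B(3) by (simp add: agree_def)
  then have ag: "agree (Suc s) (coding B) (coding X)" using causal_coding unfolding causal_def by blast
  have nz: "0 \<notin> hit_cols (coding B)" using B(2) coding_0_in_cols by blast
  have "{1..k} \<subseteq> hit_cols (coding B)"
  proof
    fix i assume i: "i \<in> {1..k}"
    show "i \<in> hit_cols (coding B)"
    proof (rule in_cols_coding)
      show "i = 0 \<or> i < last_hit (coding B) 0 (Suc s)"
        using l i last_hit_cong[OF ag, of 0] by simp
      show "B m = X m" if "i = 0 \<or> col m = i" for m using B(3)[of m] that i by auto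
    qed
  qed
  from card_mono[OF hits_outside_cols(1)[OF nz] this] have "k \<le> card (hit_cols (coding B))" by simp
  moreover have "coding B \<noteq> coding X" using nz zero_in_cols_coding by metis
  ultimately show ?thesis using that[of B] B(1) agree_mono[OF _ ag, of n] nz s(1) by simp
qed

section \<open>Bounds on the Cantor-Bendixson ranks\<close>

lemma rank_lower_bound:
  assumes Q: "pi01_class Q"
  shows "coding Y \<in> Q \<Longrightarrow> 0 \<in> hit_cols (coding Y) \<or> k \<le> card (hit_cols (coding Y)) \<Longrightarrow>
    coding Y \<in> cb_iter Q (cord_of_nat k)"
proof (induction k arbitrary: Y)
  case 0
  then show ?case by (simp add: cord_of_nat_def cb_iter_0)
next
  case (Suc k)
  have "\<exists>Z\<in>cb_iter Q (cord_of_nat k). agree n Z (coding Y) \<and> Z \<noteq> coding Y" for n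
  proof (cases "0 \<in> hit_cols (coding Y)")
    case True
    then have "Y = X" by (rule coding_0_in_cols)
    then show ?thesis using perturb_top[OF Q, of n k] Suc.prems(1) Suc.IH by metis
  next
    case False
    then have card: "Suc k \<le> card (hit_cols (coding Y))" using Suc.prems(2) by simp
    then obtain j where j: "j \<in> hit_cols (coding Y)" by fastforce
    \<comment> \<open>Giving up one infinite column leaves at least \<open>k\<close> of them,
      arbitrarily close and still in \<open>Q\<close>.\<close>
    obtain Y' where Y': "coding Y' \<in> Q" "agree n (coding Y') (coding Y)" "coding Y' \<noteq> coding Y"
      "0 \<notin> hit_cols (coding Y')" "hit_cols (coding Y) - {j} \<subseteq> hit_cols (coding Y')"
      using perturb_finite_cols[OF Q Suc.prems(1) False j] by metis
    have "card (hit_cols (coding Y) - {j}) \<le> card (hit_cols (coding Y'))"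
      by (rule card_mono[OF hits_outside_cols(1)[OF Y'(4)] Y'(5)])
    then have "k \<le> card (hit_cols (coding Y'))" using card j by (simp add: card_Diff_singleton)
    then show ?thesis using Suc.IH[OF Y'(1)] Y'(2,3) by blast
  qed
  moreover have "coding Y \<in> cb_iter Q (cord_of_nat k)" using Suc.prems by (intro Suc.IH) auto
  ultimately show ?case unfolding cord_of_nat_Suc cb_iter_osucc in_cb_derivative_iff by blast
qed

text \<open>All other images near one with exactly \<open>k\<close> infinite columns, column 0 not
  among them, have fewer infinite columns. By induction none of these survives \<open>k\<close>
  derivatives, so the given one is isolated at that level.\<close>

lemma rank_upper_bound:
  "coding Y \<in> cb_iter (range coding) (cord_of_nat k) \<Longrightarrow> 0 \<in> hit_cols (coding Y) \<or> k \<le> card (hit_cols (coding Y))"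
proof (induction k arbitrary: Y)
  case (Suc k)
  let ?D = "cb_iter (range coding) (cord_of_nat k)"
  have D: "coding Y \<in> ?D" "\<And>n. \<exists>Z\<in>?D. agree n Z (coding Y) \<and> Z \<noteq> coding Y"
    using Suc.prems unfolding cord_of_nat_Suc cb_iter_osucc in_cb_derivative_iff by blast+
  show ?case
  proof (rule ccontr)
    assume "\<not> ?thesis"
    then have fin: "0 \<notin> hit_cols (coding Y)" and card: "card (hit_cols (coding Y)) = k"
      using Suc.IH[OF D(1)] by auto
    obtain n where n: "\<And>Y'. agree n (coding Y') (coding Y) \<Longrightarrow>
        coding Y' = coding Y \<or> hit_cols (coding Y') \<subset> hit_cols (coding Y)"
      using coding_near[OF fin] by blast
    obtain Z where Z: "Z \<in> ?D" "agree n Z (coding Y)" "Z \<noteq> coding Y" using D(2) by blast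
    have "Z \<in> range coding"
      using Z(1) cb_iter_antimono[OF zero_le_cord, of "range coding"] by (auto simp: cb_iter_0)
    then obtain Y' where Y': "Z = coding Y'" by blast
    then have sub: "hit_cols (coding Y') \<subset> hit_cols (coding Y)" using n Z by blast
    then have "card (hit_cols (coding Y')) < k"
      using card psubset_card_mono[OF hits_outside_cols(1)[OF fin]] by blast
    then show False using Suc.IH[of Y'] Z(1) Y' sub fin by auto
  qed
qed simp

lemma cb_rank_coding:
  "\<exists>\<beta>. cb_rank (coding Y) = Some \<beta> \<and> rank_in (range coding) (coding Y) = Some \<beta> \<and>
    (0 \<in> hit_cols (coding Y) \<longrightarrow> \<beta> = omega)"
proof -
  have P: "pi01_class (range coding)" by (rule pi01_class_range[OF computable_map_coding])
  have *: "cb_rank (coding Y) = Some \<beta> \<and> rank_in (range coding) (coding Y) = Some \<beta>"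
    if lower: "\<And>Q. pi01_class Q \<Longrightarrow> coding Y \<in> Q \<Longrightarrow> coding Y \<in> cb_iter Q \<beta>"
      and upper: "coding Y \<notin> cb_iter (range coding) (osucc \<beta>)" for \<beta>
    using cb_rank_eq[OF P lower[OF P] upper lower] rank_in_eq[OF lower[OF P] upper] by simp
  show ?thesis
  proof (cases "0 \<in> hit_cols (coding Y)")
    case True
    \<comment> \<open>An image with column 0 finite and surviving every finite level would have more
      infinite columns than it has. Hence at most \<open>coding X\<close> remains, and it is
      isolated.\<close>
    have only: "Z = coding X" if "Z \<in> cb_iter (range coding) omega" for Z
    proof -
      have "Z \<in> range coding"
        using that cb_iter_antimono[OF zero_le_cord, of "range coding"] by (auto simp: cb_iter_0)
      then obtain Y' where Y': "Z = coding Y'" by blast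
      then have "0 \<in> hit_cols (coding Y') \<or> Suc (card (hit_cols (coding Y'))) \<le> card (hit_cols (coding Y'))"
        using that unfolding cb_iter_omega by (intro rank_upper_bound) blast
      then show ?thesis using coding_0_in_cols Y' by auto
    qed
    have "cb_rank (coding Y) = Some omega \<and> rank_in (range coding) (coding Y) = Some omega"
    proof (rule *)
      show "coding Y \<in> cb_iter Q omega" if "pi01_class Q" "coding Y \<in> Q" for Q
        unfolding cb_iter_omega using rank_lower_bound[OF that] True by blast
      show "coding Y \<notin> cb_iter (range coding) (osucc omega)"
      proof
        assume "coding Y \<in> cb_iter (range coding) (osucc omega)"
        then obtain Z where "coding Y \<in> cb_iter (range coding) omega"
          "Z \<in> cb_iter (range coding) omega" "Z \<noteq> coding Y"
          unfolding cb_iter_osucc in_cb_derivative_iff by blast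
        then show False using only by metis
      qed
    qed
    then show ?thesis by blast
  next
    case False
    have "cb_rank (coding Y) = Some (cord_of_nat (card (hit_cols (coding Y)))) \<and>
        rank_in (range coding) (coding Y) = Some (cord_of_nat (card (hit_cols (coding Y))))"
    proof (rule *)
      show "coding Y \<in> cb_iter Q (cord_of_nat (card (hit_cols (coding Y))))" if "pi01_class Q" "coding Y \<in> Q" for Q
        using rank_lower_bound[OF that] by blast
      show "coding Y \<notin> cb_iter (range coding) (osucc (cord_of_nat (card (hit_cols (coding Y)))))"
        using rank_upper_bound[of Y "Suc (card (hit_cols (coding Y)))"] False unfolding cord_of_nat_Suc by auto
    qed
    then show ?thesis using False by blast
  qed
qed

end

section \<open>The image measure and its random sequence in the given degree\<close>

theorem theorem3p5:
  fixes r :: "cantor set"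
  assumes "delta02_random_degree r"
  shows "\<exists>\<mu> R. cantor_prob \<mu> \<and> computable_measure \<mu> \<and> countably_supported \<mu> \<and> R \<in> r \<and>
    ml_random \<mu> R \<and> cb_rank R = Some omega \<and> rank_faithful (support \<mu>)"
proof -
  obtain A X where r: "r \<in> turing_degrees" and A: "A \<in> r" "delta02 A"
    and X: "X \<in> r" "ml_random cantor_lebesgue X"
    using assms unfolding delta02_random_degree_def by blast
  obtain Y where Y: "r = turing_equiv `` {Y}"
    using r unfolding turing_degrees_def quotient_def by blast
  \<comment> \<open>The random member and the Delta-0-2 member of the degree may differ; reducing
    \<open>X\<close> to \<open>A\<close> transfers a limit approximation to
    \<open>X\<close>.\<close>
  have YA: "turing_reducible Y A" and XY: "turing_reducible X Y" and YX: "turing_reducible Y X"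
    using A(1) X(1) unfolding Y turing_equiv_def by auto
  obtain a where "limit_approx a A" using delta02_limit_approx[OF A(2)] .
  then obtain x where "limit_approx x X"
    using limit_approx_reducible turing_reducible_trans[OF XY YA] by blast
  then interpret random_limit_coding x X
    using X(2) by unfold_locales
  have causal: "causal coding" by (rule causal_coding)
  have supp: "support (pushforward coding) = range coding" by (rule support_pushforward[OF causal])
  have "coding X \<in> r"
    using turing_equiv_coding XY YX turing_reducible_trans unfolding Y turing_equiv_def by blast
  moreover have "cb_rank (coding X) = Some omega" using cb_rank_coding[of X] zero_in_cols_coding by auto
  moreover have "cb_rank Z = rank_in (range coding) Z" if "Z \<in> range coding" for Z
    using that cb_rank_coding by (metis imageE)
  then have "rank_faithful (support (pushforward coding))"
    unfolding rank_faithful_def supp using pi01_class_range[OF computable_map_coding] by blast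
  ultimately show ?thesis
    using cantor_prob_pushforward[OF causal] computable_measure_pushforward[OF computable_map_coding]
      countably_supported_pushforward[OF causal countable_range_coding]
      ml_random_pushforward[OF computable_map_coding X(2)]
    by blast
qed

end
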